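(* Let $d\in\mathbb{N}$ and let $\mathcal{V}\in C^1(\mathbb{R}^d;\mathbb{R})$ be bounded from below with $\nabla\mathcal{V}$ antisymmetric (i.e. $\nabla\mathcal{V}(-x)=-\nabla\mathcal{V}(x)$ for all $x$), locally Lipschitz continuous and bounded. Let $\psi\in C(\mathbb{R}_{\ge 0};\mathbb{R}_{\ge 0})$ be bounded and locally Lipschitz continuous and assume that there exists $\underline{\psi}>0$ with $\psi(x)\ge\underline{\psi}$ for all $x\in\mathbb{R}_{\ge 0}$. Then for any initial condition $f_0\in\mathcal{P}_c(\mathbb{R}^d\times\mathbb{R}^d)$ satisfying $\int r\,\mathrm{d}f_0(r,v)=0$, the solution $(f_t)_{t\ge 0}$ of the mean-field equation (in the weak sense stated in the context) with initial condition $f_0$ satisfies $$\int |v-\bar v|^2\,\mathrm{d}f_t(r,v)\to 0\quad\text{as } t\to\infty,\qquad \bar v:=\int v\,\mathrm{d}f_0(r,v).$$ If additionally $\nabla\mathcal{V}$ is uniformly continuous, then $$\int\Big|\int\nabla\mathcal{V}(r-r')\,\mathrm{d}f_t(r',v')\Big|^2\,\mathrm{d}f_t(r,v)\to 0\quad\text{as } t\to\infty.$$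
   Context: $\mathcal{P}_c(\mathbb{R}^d\times\mathbb{R}^d)$ is the set of compactly supported Borel probability measures on $\mathbb{R}^d\times\mathbb{R}^d$, equipped with the $\infty$-Wasserstein distance $\mathcal{W}_\infty(\mu,\nu)=\inf_{\pi\in\Pi(\mu,\nu)}\sup\{|(x-x',y-y')| : (x,y,x',y')\in\mathrm{supp}(\pi)\}$, where $\Pi(\mu,\nu)$ is the set of couplings of $\mu$ and $\nu$. Given $f_0\in\mathcal{P}_c(\mathbb{R}^d\times\mathbb{R}^d)$ with $\int r\,\mathrm{d}f_0(r,v)=0$, and $\bar v:=\int v\,\mathrm{d}f_0(r,v)$, the solution of the mean-field equation with initial condition $f_0$ is the (unique) $f\in C([0,\infty);\mathcal{P}_c(\mathbb{R}^d\times\mathbb{R}^d))$, $t\mapsto f_t$, such that for all test functions $h\in C_c^\infty([0,\infty)\times\mathbb{R}^d\times\mathbb{R}^d)$ $$\int_0^\infty\!\!\int\big(\partial_t h_t(r,v)+(v-\bar v)\cdot\nabla_r h_t(r,v)\big)\,\mathrm{d}f_t(r,v)\,\mathrm{d}t+\int h_0(r,v)\,\mathrm{d}f_0(r,v)$$ $$=\int_0^\infty\!\!\int\Big(\int\big[\psi(|r-r'|)(v-v')-\nabla\mathcal{V}(r'-r)\big]\,\mathrm{d}f_t(r',v')\Big)\cdot\nabla_v h_t(r,v)\,\mathrm{d}f_t(r,v)\,\mathrm{d}t.$$ Under the stated hypotheses on $\mathcal V$ and $\psi$ this solution exists and is unique. *)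

theory Defs
  imports "HOL-Probability.Probability"
begin

section \<open>Differential calculus\<close>

definition grad :: "('a::real_inner \<Rightarrow> real) \<Rightarrow> 'a \<Rightarrow> 'a"
  where "grad f x = (THE D. GDERIV f x :> D)"

lemma grad_eqI:
  assumes "GDERIV f x :> D"
  shows "grad f x = D"
  unfolding grad_def
proof (rule the_equality)
  show "GDERIV f x :> D" by (rule assms)
next
  fix E assume "GDERIV f x :> E"
  with assms have "(\<lambda>h. inner h E) = (\<lambda>h. inner h D)"
    unfolding gderiv_def by (rule has_derivative_unique[THEN sym])
  then show "E = D"
    by (metis inner_commute vector_eq_rdot)
qed

text \<open>On Euclidean spaces, \<open>C_k k f\<close> says that \<open>f\<close> is of class \<open>C\<^sup>k\<close>: \<open>f\<close> is differentiable
  and all its directional derivatives are of class \<open>C\<^bsup>k-1\<^esup>\<close>.\<close>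

primrec C_k :: "nat \<Rightarrow> ('a::euclidean_space \<Rightarrow> real) \<Rightarrow> bool" where
  "C_k 0 f \<longleftrightarrow> continuous_on UNIV f"
| "C_k (Suc k) f \<longleftrightarrow>
     (\<forall>x. f differentiable (at x)) \<and> (\<forall>v. C_k k (\<lambda>x. frechet_derivative f (at x) v))"

text \<open>Compactly supported smooth functions on \<open>[0,\<infinity>) \<times> 'a \<times> 'a\<close> are, as usual, the
  restrictions of compactly supported smooth functions on the whole space
  \<open>\<real> \<times> 'a \<times> 'a\<close>. In particular they need not vanish at time \<open>0\<close>. We work with the
  unrestricted functions, whose values at negative times are never used.\<close>

definition test_function :: "(real \<times> 'a::euclidean_space \<times> 'a \<Rightarrow> real) \<Rightarrow> bool"
  where "test_function h \<longleftrightarrow> (\<forall>k. C_k k h) \<and> compact (closure {z. h z \<noteq> 0})"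

text \<open>The library notion is about families of functions; the one used here is constant.\<close>

definition locally_lipschitz_on ::
    "'a::metric_space set \<Rightarrow> ('a \<Rightarrow> 'b::metric_space) \<Rightarrow> bool"
  where "locally_lipschitz_on X f \<longleftrightarrow> local_lipschitz {0::real} X (\<lambda>_. f)"


section \<open>Compactly supported measures and the \<open>\<infinity>\<close>-Wasserstein distance\<close>

definition supp :: "'a::topological_space measure \<Rightarrow> 'a set"
  where "supp M = {x. \<forall>U. open U \<longrightarrow> x \<in> U \<longrightarrow> emeasure M U > 0}"

definition prob_compact :: "'a::topological_space measure set"
  where "prob_compact = {M. prob_space M \<and> sets M = sets borel \<and> compact (supp M)}"

definition couplings ::
    "'a::topological_space measure \<Rightarrow> 'b::topological_space measure \<Rightarrow> ('a \<times> 'b) measure set"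
  where "couplings M N = {P. prob_space P \<and> sets P = sets borel \<and>
           distr P borel fst = M \<and> distr P borel snd = N}"

definition Winf ::
    "'a::real_normed_vector measure \<Rightarrow> 'a measure \<Rightarrow> ennreal"
  where "Winf M N = (INF P\<in>couplings M N. SUP (z, z')\<in>supp P. ennreal (norm (z - z')))"

text \<open>Curves in \<open>C([0,\<infinity>); prob_compact)\<close>; the values at negative times are irrelevant.\<close>

definition Winf_continuous :: "(real \<Rightarrow> 'a::real_normed_vector measure) \<Rightarrow> bool"
  where "Winf_continuous f \<longleftrightarrow>
    (\<forall>t\<ge>0. f t \<in> prob_compact) \<and>
    (\<forall>t\<ge>0. ((\<lambda>s. Winf (f s) (f t)) \<longlongrightarrow> 0) (at t within {0..}))"


section \<open>The mean-field equation\<close>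

text \<open>Points of phase space are pairs \<open>(r, v)\<close> of a position and a velocity.\<close>

definition mean_position :: "('a::euclidean_space \<times> 'a) measure \<Rightarrow> 'a"
  where "mean_position M = (\<integral>(r, v). r \<partial>M)"

definition mean_velocity :: "('a::euclidean_space \<times> 'a) measure \<Rightarrow> 'a"
  where "mean_velocity M = (\<integral>(r, v). v \<partial>M)"

definition mean_field_solution ::
    "('a::euclidean_space \<Rightarrow> real) \<Rightarrow> (real \<Rightarrow> real) \<Rightarrow>
     ('a \<times> 'a) measure \<Rightarrow> (real \<Rightarrow> ('a \<times> 'a) measure) \<Rightarrow> bool"
  where "mean_field_solution V \<psi> f0 f \<longleftrightarrow>
    Winf_continuous f \<and> f 0 = f0 \<and>
    (\<forall>h. test_function h \<longrightarrow>
      (LBINT t:{0..}. \<integral>(r, v).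
          deriv (\<lambda>s. h (s, r, v)) t +
          inner (v - mean_velocity f0) (grad (\<lambda>x. h (t, x, v)) r) \<partial>f t)
        + (\<integral>(r, v). h (0, r, v) \<partial>f0)
      = (LBINT t:{0..}. \<integral>(r, v).
          inner (\<integral>(r', v'). \<psi> (norm (r - r')) *\<^sub>R (v - v') - grad V (r' - r) \<partial>f t)
                (grad (\<lambda>w. h (t, r, w)) v) \<partial>f t))"

end

theory Submission
  imports Defs
begin

text \<open>Write \<open>w = v - v_mean\<close> and let \<open>X\<^sub>t\<close> be the mean of \<open>\<nabla>V\<close> against the position marginal of \<open>f t\<close>.
  The energy \<open>\<integral>|w|\<^sup>2 df\<^sub>t + \<integral>\<integral>V(r - r') df\<^sub>t df\<^sub>t\<close> is bounded below and its derivative is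
  \<open>- \<integral>\<integral>\<psi>(|r - r'|)|v - v'|\<^sup>2 df\<^sub>t df\<^sub>t\<close>, which is at most \<open>- 2 \<psi>_low \<integral>|w|\<^sup>2 df\<^sub>t\<close> because the mean
  velocity is conserved. So \<open>\<integral>|w|\<^sup>2 df\<^sub>t\<close> is integrable in time; its derivative is bounded above, hence it
  tends to \<open>0\<close>.

  For the second claim fix a time \<open>t\<close> and a unit vector \<open>e\<close>. In the derivative of
  \<open>s \<mapsto> \<integral>(w \<cdot> e)(X\<^sub>t \<cdot> e) df\<^sub>s\<close> the leading term is \<open>- \<integral>(X\<^sub>s \<cdot> e)(X\<^sub>t \<cdot> e) df\<^sub>s\<close>, and all other terms
  as well as the functional itself are small once \<open>\<integral>|w|\<^sup>2 df\<^sub>s\<close> is small. As \<open>X\<^sub>t\<close> need not be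
  differentiable, \<open>X\<^sub>t \<cdot> e\<close> is replaced by a difference quotient of the mean of \<open>V\<close>, which has a bounded
  gradient and is uniformly close to \<open>X\<^sub>t \<cdot> e\<close> when \<open>\<nabla>V\<close> is uniformly continuous.

  The weak formulation only concerns smooth compactly supported test functions. Mollification shows that
  the integral of every \<open>C\<^sup>1\<close> observable is nevertheless differentiable in time with the expected derivative.\<close>

section \<open>Smooth functions\<close>

text \<open>Characteristics are never followed: everything is read off from integrals of observables
  against \<open>f t\<close>, which is what the weak formulation offers. Two quantities are not
  integrals of one fixed observable. The potential energy depends on \<open>f t\<close> twice;
  oddness of \<open>grad V\<close> makes \<open>V\<close> even, so increments in one argument at a
  time suffice. The mean force moves with time, so it is frozen at the start of a window of length 1
  and the cost of freezing is estimated.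

  For the kinetic energy only an upper bound of the derivative is at hand: friction has a negative
  sign and is dropped, and the interaction is at most \<open>C\<close> times the mean speed.

  In the second claim the difference quotient with step \<epsilon> has a gradient of size C /
  \<epsilon>. Errors are of two sorts: those governed by the oscillation of \<open>grad V\<close>
  over distances below \<epsilon>, and those bounded by a constant depending on \<epsilon> times a
  moment of the velocity. Hence \<epsilon> is fixed first and time is sent to infinity afterwards.
  The bound on \<open>grad V\<close> is global, so no bound on the supports of \<open>f t\<close>
  uniform over all times enters.\<close>

lemma C_k_SucI:
  assumes "\<And>x. (f has_derivative D x) (at x)" and "\<And>v. C_k k (\<lambda>x. D x v)"
  shows "C_k (Suc k) f"
proof -
  have "frechet_derivative f (at x) = D x" for x
    using frechet_derivative_at[OF assms(1)] by simp
  then show ?thesis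
    using assms by (auto simp: differentiable_def)
qed

lemma C_k_SucD:
  assumes "C_k (Suc k) f"
  shows "(f has_derivative frechet_derivative f (at x)) (at x)"
    and "C_k k (\<lambda>x. frechet_derivative f (at x) v)"
  using assms frechet_derivative_works by auto

lemma C_k_Suc_imp:
  assumes "C_k (Suc k) f"
  shows "C_k k f"
  using assms
proof (induction k arbitrary: f)
  case 0
  then show ?case
    by (simp add: continuous_at_imp_continuous_on differentiable_imp_continuous_within)
next
  case (Suc k)
  show ?case
    using Suc.prems Suc.IH by (subst C_k.simps) (metis C_k.simps(2))
qed

lemma C_k_continuous: "C_k k f \<Longrightarrow> continuous_on UNIV f"
proof (induction k)
  case (Suc k)
  then show ?case by (blast dest: C_k_Suc_imp)
qed simp

lemma C_k_const: "C_k k (\<lambda>x. c)"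
proof (induction k arbitrary: c)
  case (Suc k)
  show ?case by (rule C_k_SucI[where D="\<lambda>x v. 0"]) (auto intro: Suc)
qed simp

lemma C_k_bounded_linear: "bounded_linear L \<Longrightarrow> C_k k L"
proof (induction k)
  case 0
  then show ?case by (simp add: linear_continuous_on)
next
  case (Suc k)
  show ?case
    by (rule C_k_SucI[where D="\<lambda>x. L"])
      (auto intro: C_k_const bounded_linear_imp_has_derivative Suc.prems)
qed

lemma C_k_add: "C_k k f \<Longrightarrow> C_k k g \<Longrightarrow> C_k k (\<lambda>x. f x + g x)"
proof (induction k arbitrary: f g)
  case 0
  then show ?case by (simp add: continuous_on_add)
next
  case (Suc k)
  show ?case
    by (rule C_k_SucI[OF has_derivative_add[OF C_k_SucD(1)[OF Suc.prems(1)] C_k_SucD(1)[OF Suc.prems(2)]]])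
      (intro Suc.IH C_k_SucD(2) Suc.prems)
qed

lemma C_k_mult: "C_k k f \<Longrightarrow> C_k k g \<Longrightarrow> C_k k (\<lambda>x. f x * g x)"
proof (induction k arbitrary: f g)
  case 0
  then show ?case by (simp add: continuous_on_mult)
next
  case (Suc k)
  show ?case
    by (rule C_k_SucI[OF has_derivative_mult[OF C_k_SucD(1)[OF Suc.prems(1)] C_k_SucD(1)[OF Suc.prems(2)]]])
      (intro C_k_add Suc.IH C_k_SucD(2) Suc.prems C_k_Suc_imp)
qed

lemma C_k_uminus: "C_k k f \<Longrightarrow> C_k k (\<lambda>x. - f x)"
  using C_k_mult[OF C_k_const[of k "-1"], of f] by simp

lemma C_k_compose_linear:
  "bounded_linear L \<Longrightarrow> C_k k f \<Longrightarrow> C_k k (\<lambda>x. f (L x))"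
proof (induction k arbitrary: f)
  case 0
  then show ?case
    by (auto intro: continuous_on_compose2 linear_continuous_on)
next
  case (Suc k)
  show ?case
  proof (rule C_k_SucI)
    show "((\<lambda>x. f (L x)) has_derivative (\<lambda>v. frechet_derivative f (at (L x)) (L v))) (at x)" for x
      by (rule has_derivative_compose[OF bounded_linear_imp_has_derivative[OF Suc.prems(1)]
          C_k_SucD(1)[OF Suc.prems(2)]])
    show "C_k k (\<lambda>x. frechet_derivative f (at (L x)) (L v))" for v
      by (rule Suc.IH[OF Suc.prems(1) C_k_SucD(2)[OF Suc.prems(2)]])
  qed
qed

lemma C_k_compose:
  fixes g :: "real \<Rightarrow> real"
  shows "C_k k g \<Longrightarrow> C_k k f \<Longrightarrow> C_k k (\<lambda>x. g (f x))"
proof (induction k arbitrary: g f)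
  case 0
  then show ?case by (auto intro: continuous_on_compose2)
next
  case (Suc k)
  show ?case
  proof (rule C_k_SucI)
    fix x
    have 1: "((\<lambda>x. g (f x)) has_derivative
        (\<lambda>v. frechet_derivative g (at (f x)) (frechet_derivative f (at x) v))) (at x)"
      by (rule has_derivative_compose[OF C_k_SucD(1)[OF Suc.prems(2)] C_k_SucD(1)[OF Suc.prems(1)]])
    \<comment> \<open>A linear map on the reals is multiplication by its value at 1. This turns the
      chain rule into a product of two factors, one for the induction hypothesis and one that is of
      class \<open>C_k k\<close> already.\<close>
    have 2: "frechet_derivative g (at (f x)) r = frechet_derivative g (at (f x)) 1 * r" for r
      using linear_cmul[OF has_derivative_linear[OF C_k_SucD(1)[OF Suc.prems(1)]], of "f x" r 1]
      by (simp add: mult.commute)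
    show "((\<lambda>x. g (f x)) has_derivative
        (\<lambda>v. frechet_derivative g (at (f x)) 1 * frechet_derivative f (at x) v)) (at x)"
      by (rule has_derivative_eq_rhs[OF 1 ext]) (rule 2)
  next
    show "C_k k (\<lambda>x. frechet_derivative g (at (f x)) 1 * frechet_derivative f (at x) v)" for v
      by (rule C_k_mult[OF Suc.IH[OF C_k_SucD(2)[OF Suc.prems(1)] C_k_Suc_imp[OF Suc.prems(2)]]
            C_k_SucD(2)[OF Suc.prems(2)]])
  qed
qed

lemma C_k_real_SucI:
  assumes "\<And>x. (f has_real_derivative f' x) (at x)" and "C_k k f'"
  shows "C_k (Suc k) f"
  by (rule C_k_SucI[where D="\<lambda>x v. f' x * v"])
    (use assms in \<open>auto simp: has_field_derivative_def intro!: C_k_mult C_k_const\<close>)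

lemma C_k_norm_square: "C_k k (\<lambda>x::'a::euclidean_space. x \<bullet> x)"
proof (cases k)
  case 0
  then show ?thesis by (auto intro!: continuous_intros)
next
  case (Suc n)
  show ?thesis unfolding Suc
  proof (rule C_k_SucI)
    show "((\<lambda>x. x \<bullet> x) has_derivative (\<lambda>v. x \<bullet> v + v \<bullet> x)) (at x)" for x :: 'a
      by (auto intro!: derivative_eq_intros)
    show "C_k n (\<lambda>x::'a. x \<bullet> v + v \<bullet> x)" for v
      by (intro C_k_bounded_linear bounded_linear_add bounded_linear_inner_left bounded_linear_inner_right)
  qed
qed

lemmas C_k_intros = C_k_const C_k_add C_k_mult C_k_uminus C_k_norm_square

section \<open>A smooth bump function\<close>

definition exp_flat :: "nat \<Rightarrow> real \<Rightarrow> real"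
  where "exp_flat n x = (if x > 0 then (1 / x) ^ n * exp (- (1 / x)) else 0)"

lemma exp_flat_nonneg: "0 \<le> exp_flat n x"
  by (simp add: exp_flat_def)

lemma exp_flat_pos_iff: "0 < exp_flat n x \<longleftrightarrow> 0 < x"
  by (simp add: exp_flat_def)

lemma exp_flat_tendsto_0: "((exp_flat n) \<longlongrightarrow> 0) (at 0)"
proof -
  have "((\<lambda>y::real. y ^ n / exp y) \<longlongrightarrow> 0) at_top"
    by (rule tendsto_power_div_exp_0)
  then have "((\<lambda>x::real. (1 / x) ^ n * exp (- (1 / x))) \<longlongrightarrow> 0) (at_right 0)"
    using filterlim_compose[OF _ filterlim_inverse_at_top_right]
    by (fastforce simp: exp_minus divide_inverse)
  then have "((exp_flat n) \<longlongrightarrow> 0) (at_right 0)"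
    by (rule Lim_transform_eventually)
      (auto simp: exp_flat_def eventually_at_filter)
  moreover have "((exp_flat n) \<longlongrightarrow> 0) (at_left 0)"
    by (rule Lim_transform_eventually[OF tendsto_const])
      (auto simp: exp_flat_def eventually_at_filter)
  ultimately show ?thesis
    using filterlim_split_at by blast
qed

text \<open>The powers of 1/x are in \<open>exp_flat\<close> for the sake of this formula: the
  family is closed under differentiation up to linear combinations, so smoothness of exp(-1/x),
  extended by 0, becomes an induction.\<close>

lemma exp_flat_deriv:
  "(exp_flat n has_real_derivative exp_flat (n + 2) x + (- real n) * exp_flat (n + 1) x) (at x)"
proof -
  consider "x > 0" | "x < 0" | "x = 0" by linarith
  then show ?thesis
  proof cases
    case 1
    have "((\<lambda>x. (1 / x) ^ n * exp (- (1 / x))) has_real_derivative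
        (1 / x) ^ (n + 2) * exp (- (1 / x)) - real n * ((1 / x) ^ (n + 1) * exp (- (1 / x)))) (at x)"
    proof (cases n)
      case 0
      then show ?thesis using 1
        by (auto intro!: derivative_eq_intros simp: power2_eq_square)
    next
      case (Suc m)
      have "((\<lambda>x. (1 / x) ^ Suc m * exp (- (1 / x))) has_real_derivative
          real (Suc m) * (1 / x) ^ m * (- (1 / (x * x))) * exp (- (1 / x))
          + exp (- (1 / x)) * (1 / (x * x)) * (1 / x) ^ Suc m) (at x)"
        using 1 by (auto simp del: power_Suc intro!: derivative_eq_intros)
      then show ?thesis unfolding Suc
        by (rule DERIV_cong) (use 1 in \<open>simp add: field_simps\<close>)
    qed
    then have "(exp_flat n has_real_derivative
        (1 / x) ^ (n + 2) * exp (- (1 / x)) - real n * ((1 / x) ^ (n + 1) * exp (- (1 / x)))) (at x)"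
      by (rule has_field_derivative_transform_within_open[where S="{0<..}"])
        (use 1 in \<open>auto simp: exp_flat_def\<close>)
    then show ?thesis using 1 by (simp add: exp_flat_def)
  next
    case 2
    have "(exp_flat n has_real_derivative 0) (at x)"
      by (rule has_field_derivative_transform_within_open[OF DERIV_const, where S="{..<0}"])
        (use 2 in \<open>auto simp: exp_flat_def\<close>)
    then show ?thesis using 2 by (simp add: exp_flat_def)
  next
    case 3
    \<comment> \<open>The difference quotient at 0 is again a member of the family,
      \<open>exp_flat (Suc n)\<close>.\<close>
    have "((\<lambda>h. exp_flat n h / h) \<longlongrightarrow> 0) (at 0)"
      by (rule Lim_transform_eventually[OF exp_flat_tendsto_0[of "Suc n"]])
        (auto simp: exp_flat_def eventually_at_filter)
    then show ?thesis using 3 by (simp add: DERIV_def exp_flat_def)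
  qed
qed

lemma C_k_exp_flat: "C_k k (exp_flat n)"
proof (induction k arbitrary: n)
  case 0
  then show ?case
    using exp_flat_deriv by (auto intro!: DERIV_continuous continuous_at_imp_continuous_on)
next
  case (Suc k)
  show ?case
    by (rule C_k_real_SucI[OF exp_flat_deriv]) (intro C_k_intros Suc)
qed

text \<open>The squared norm keeps the function smooth at the origin. It is not normalised; where
  total mass 1 matters, it is divided by its integral.\<close>

definition bump :: "real \<Rightarrow> 'a::real_inner \<Rightarrow> real"
  where "bump \<epsilon> x = exp_flat 0 (\<epsilon>\<^sup>2 - x \<bullet> x)"

lemma C_k_bump: "C_k k (bump \<epsilon> :: 'a::euclidean_space \<Rightarrow> real)"
proof -
  have "C_k k (\<lambda>x::'a. exp_flat 0 (\<epsilon>\<^sup>2 + - (x \<bullet> x)))"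
    by (rule C_k_compose[OF C_k_exp_flat]) (intro C_k_intros)
  then show ?thesis by (simp add: bump_def[abs_def])
qed

lemma bump_nonneg: "0 \<le> bump \<epsilon> x"
  by (simp add: bump_def exp_flat_nonneg)

lemma bump_pos_iff:
  assumes "\<epsilon> > 0"
  shows "0 < bump \<epsilon> x \<longleftrightarrow> norm x < \<epsilon>"
proof -
  have "x \<bullet> x < \<epsilon>\<^sup>2 \<longleftrightarrow> norm x < \<epsilon>"
    unfolding dot_square_norm using assms
    by (metis abs_of_nonneg norm_ge_zero order_less_imp_le power2_less_imp_less power_strict_mono zero_less_numeral)
  then show ?thesis by (simp add: bump_def exp_flat_pos_iff)
qed

lemma bump_eq_0: "\<epsilon> > 0 \<Longrightarrow> \<epsilon> \<le> norm x \<Longrightarrow> bump \<epsilon> x = 0"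
  using bump_pos_iff[of \<epsilon> x] bump_nonneg[of \<epsilon> x] by linarith

lemma bump_continuous: "continuous_on UNIV (bump \<epsilon> :: 'a::euclidean_space \<Rightarrow> real)"
  using C_k_bump C_k_continuous by blast

section \<open>Differentiation under the integral sign\<close>

lemma GDERIV_has_derivative: "GDERIV f x :> D \<longleftrightarrow> (f has_derivative (\<lambda>h. h \<bullet> D)) (at x)"
  by (simp add: gderiv_def)

lemma GDERIV_continuous_on:
  assumes "\<And>x. GDERIV f x :> g x"
  shows "continuous_on A f"
  using assms unfolding GDERIV_has_derivative
  by (intro continuous_at_imp_continuous_on ballI has_derivative_continuous)

text \<open>Riesz representation of the derivative in the standard basis.\<close>

lemma has_derivative_imp_GDERIV:
  fixes f :: "'a::euclidean_space \<Rightarrow> real"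
  assumes "(f has_derivative D) (at x)"
  shows "GDERIV f x :> (\<Sum>b\<in>Basis. D b *\<^sub>R b)"
proof -
  interpret bounded_linear D
    using assms by (rule has_derivative_bounded_linear)
  have "D h = h \<bullet> (\<Sum>b\<in>Basis. D b *\<^sub>R b)" for h
    by (subst euclidean_representation[of h, symmetric])
      (simp add: sum scaleR inner_sum_right mult.commute)
  then have "D = (\<lambda>h. h \<bullet> (\<Sum>b\<in>Basis. D b *\<^sub>R b))" by (rule ext)
  then show ?thesis
    using assms by (simp add: GDERIV_has_derivative)
qed

lemma C_k_GDERIV:
  assumes "C_k (Suc k) f"
  shows "GDERIV f x :> grad f x" and "frechet_derivative f (at x) h = h \<bullet> grad f x"
    and "continuous_on UNIV (grad f)"
proof -
  have 1: "GDERIV f x :> (\<Sum>b\<in>Basis. frechet_derivative f (at x) b *\<^sub>R b)" for x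
    by (rule has_derivative_imp_GDERIV[OF C_k_SucD(1)[OF assms]])
  have 2: "grad f x = (\<Sum>b\<in>Basis. frechet_derivative f (at x) b *\<^sub>R b)" for x
    by (rule grad_eqI[OF 1])
  show 3: "GDERIV f x :> grad f x"
    using 1 2 by simp
  show "frechet_derivative f (at x) h = h \<bullet> grad f x"
    using frechet_derivative_at[OF 3[unfolded GDERIV_has_derivative]] by metis
  show "continuous_on UNIV (grad f)"
    unfolding 2[abs_def]
    by (intro continuous_intros C_k_continuous[OF C_k_SucD(2)[OF assms]])
qed

lemma GDERIV_along_segment:
  assumes "\<And>x. GDERIV f x :> g x"
  shows "((\<lambda>t. f (x + t *\<^sub>R h)) has_real_derivative h \<bullet> g (x + t *\<^sub>R h)) (at t)"
proof -
  have "((\<lambda>t. x + t *\<^sub>R h) has_derivative (\<lambda>s. s *\<^sub>R h)) (at t)"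
    by (auto intro!: derivative_eq_intros)
  then have "((\<lambda>t. f (x + t *\<^sub>R h)) has_derivative (\<lambda>s. (s *\<^sub>R h) \<bullet> g (x + t *\<^sub>R h))) (at t)"
    by (rule has_derivative_compose) (use assms in \<open>simp add: GDERIV_has_derivative\<close>)
  then show ?thesis
    unfolding has_field_derivative_def
    by (rule has_derivative_eq_rhs) (simp add: fun_eq_iff mult.commute)
qed

lemma GDERIV_mvt:
  assumes "\<And>x. GDERIV f x :> g x"
  obtains \<xi> :: real where "0 < \<xi>" "\<xi> < 1" "f (x + h) - f x = h \<bullet> g (x + \<xi> *\<^sub>R h)"
  using MVT2[of 0 1 "\<lambda>t. f (x + t *\<^sub>R h)" "\<lambda>t. h \<bullet> g (x + t *\<^sub>R h)"]
    GDERIV_along_segment[OF assms] by auto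

section \<open>Integrals against compactly supported measures\<close>

locale compact_measure = finite_measure M
  for M :: "'a::euclidean_space measure" +
  fixes K :: "'a set"
  assumes sets_borel: "sets M = sets borel"
    and compact_K: "compact K"
    and AE_K: "AE z in M. z \<in> K"
begin

lemma borel_measurable_continuous:
  "continuous_on UNIV u \<Longrightarrow> u \<in> borel_measurable M"
  using borel_measurable_continuous_onI sets_borel measurable_cong_sets by blast

lemma integrable_continuous:
  fixes u :: "'a \<Rightarrow> 'b::{banach, second_countable_topology}"
  assumes "continuous_on UNIV u"
  shows "integrable M u"
proof -
  have "compact (u ` K)"
    using compact_continuous_image[OF continuous_on_subset[OF assms] compact_K] by simp
  then obtain B where "\<And>z. z \<in> K \<Longrightarrow> norm (u z) \<le> B"
    by (metis bounded_iff compact_imp_bounded imageI)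
  with AE_K show ?thesis
    by (intro integrable_const_bound[of _ B] borel_measurable_continuous[OF assms]) auto
qed

text \<open>By the mean value theorem the remainder of the first-order expansion at z is controlled
  by the variation of the gradient between nearby points. Uniform continuity of \<open>g\<close> on
  the compact set \<open>cball x 1 \<times> K\<close> makes this small simultaneously for all z that
  matter, so no dominating function has to be supplied.\<close>

lemma GDERIV_integral:
  fixes u :: "'b::euclidean_space \<Rightarrow> 'a \<Rightarrow> real"
  assumes deriv: "\<And>x z. GDERIV (\<lambda>x. u x z) x :> g x z"
    and u: "\<And>x. continuous_on UNIV (u x)"
    and g: "continuous_on UNIV (\<lambda>(x, z). g x z)"
  shows "GDERIV (\<lambda>x. \<integral>z. u x z \<partial>M) x :> (\<integral>z. g x z \<partial>M)"
  unfolding GDERIV_has_derivative has_derivative_at_alt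
proof (intro conjI allI impI)
  show "bounded_linear (\<lambda>h. h \<bullet> (\<integral>z. g x z \<partial>M))"
    by (rule bounded_linear_inner_left)
next
  have g': "continuous_on UNIV (g x)" for x
  proof -
    have "continuous_on UNIV (\<lambda>z. (x, z))" by (intro continuous_intros)
    from continuous_on_compose2[OF g this] show ?thesis by simp
  qed
  fix e :: real assume "e > 0"
  \<comment> \<open>The total mass may be 0; adding 1 makes it a legitimate divisor.\<close>
  define m where "m = measure M (space M) + 1"
  have m: "m > 0" "measure M (space M) \<le> m"
    by (auto simp: m_def add_nonneg_pos)
  have "uniformly_continuous_on (cball x 1 \<times> K) (\<lambda>(x, z). g x z)"
    by (intro compact_uniformly_continuous continuous_on_subset[OF g] compact_Times compact_K) auto
  then obtain d where d: "d > 0" and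
    dg: "\<And>y z y' z'. y \<in> cball x 1 \<Longrightarrow> z \<in> K \<Longrightarrow> y' \<in> cball x 1 \<Longrightarrow> z' \<in> K \<Longrightarrow>
        dist (y', z') (y, z) < d \<Longrightarrow> dist (g y' z') (g y z) < e / m"
    unfolding uniformly_continuous_on_def using \<open>e > 0\<close> m(1) 
    by (metis (no_types, lifting) SigmaI case_prod_conv divide_pos_pos)
  show "\<exists>d>0. \<forall>y. norm (y - x) < d \<longrightarrow>
      norm ((\<integral>z. u y z \<partial>M) - (\<integral>z. u x z \<partial>M) - (y - x) \<bullet> (\<integral>z. g x z \<partial>M)) \<le> e * norm (y - x)"
  proof (intro exI[of _ "min d 1"] conjI allI impI)
    fix y assume y: "norm (y - x) < min d 1"
    have pt: "norm (u y z - u x z - (y - x) \<bullet> g x z) \<le> e / m * norm (y - x)" if z: "z \<in> K" for z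
    proof -
      obtain \<xi> where \<xi>: "0 < \<xi>" "\<xi> < 1" "u (x + (y - x)) z - u x z = (y - x) \<bullet> g (x + \<xi> *\<^sub>R (y - x)) z"
        using GDERIV_mvt[of "\<lambda>x. u x z" "\<lambda>x. g x z", OF deriv] by blast
      have *: "norm (\<xi> *\<^sub>R (y - x)) \<le> norm (y - x)"
        using \<xi> by (simp add: mult_left_le_one_le)
      then have "dist (g (x + \<xi> *\<^sub>R (y - x)) z) (g x z) < e / m"
        using y by (intro dg z) (auto simp: dist_norm)
      then have "norm (g (x + \<xi> *\<^sub>R (y - x)) z - g x z) \<le> e / m"
        by (simp add: dist_norm)
      moreover have "u y z - u x z - (y - x) \<bullet> g x z = (y - x) \<bullet> (g (x + \<xi> *\<^sub>R (y - x)) z - g x z)"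
        using \<xi>(3) by (simp add: inner_diff_right)
      moreover have "norm ((y - x) \<bullet> (g (x + \<xi> *\<^sub>R (y - x)) z - g x z))
          \<le> norm (y - x) * norm (g (x + \<xi> *\<^sub>R (y - x)) z - g x z)"
        unfolding real_norm_def by (rule Cauchy_Schwarz_ineq2)
      moreover have "norm (y - x) * norm (g (x + \<xi> *\<^sub>R (y - x)) z - g x z) \<le> norm (y - x) * (e / m)"
        by (intro mult_left_mono calculation(1) norm_ge_zero)
      ultimately show ?thesis
        by (simp only: mult.commute[of "e / m"])
    qed
    have int: "integrable M (\<lambda>z. u y z - u x z - (y - x) \<bullet> g x z)"
      by (intro integrable_continuous continuous_intros u g')
    have "(\<integral>z. u y z \<partial>M) - (\<integral>z. u x z \<partial>M) - (y - x) \<bullet> (\<integral>z. g x z \<partial>M)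
        = (\<integral>z. u y z - u x z - (y - x) \<bullet> g x z \<partial>M)"
      by (simp add: integrable_continuous u g')
    also have "norm \<dots> \<le> (\<integral>z. norm (u y z - u x z - (y - x) \<bullet> g x z) \<partial>M)"
      by (rule integral_norm_bound)
    also have "\<dots> \<le> (\<integral>z. e / m * norm (y - x) \<partial>M)"
      using AE_K by (intro integral_mono_AE integrable_norm int integrable_const) (auto elim!: eventually_mono dest: pt)
    also have "\<dots> = measure M (space M) / m * (e * norm (y - x))"
      by simp
    also have "\<dots> \<le> e * norm (y - x)"
      using m \<open>e > 0\<close> by (intro mult_left_le_one_le) auto
    finally show "norm ((\<integral>z. u y z \<partial>M) - (\<integral>z. u x z \<partial>M) - (y - x) \<bullet> (\<integral>z. g x z \<partial>M)) \<le> e * norm (y - x)" .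
  qed (use d in auto)
qed

end

lemma (in prob_space) norm_integral_diff_le:
  fixes u :: "'a \<Rightarrow> 'b::{banach, second_countable_topology}"
  assumes "integrable M u" "AE z in M. norm (u z - a) \<le> \<delta>"
  shows "norm ((\<integral>z. u z \<partial>M) - a) \<le> \<delta>"
proof -
  have "(\<integral>z. u z \<partial>M) - a = (\<integral>z. u z - a \<partial>M)"
    using assms(1) by (simp add: prob_space)
  also have "norm \<dots> \<le> (\<integral>z. norm (u z - a) \<partial>M)"
    by (rule integral_norm_bound)
  also have "\<dots> \<le> (\<integral>z. \<delta> \<partial>M)"
    using assms by (intro integral_mono_AE) auto
  finally show ?thesis by (simp add: prob_space)
qed

lemma lborel_integral_reflect:
  fixes u :: "'a::euclidean_space \<Rightarrow> 'b::{banach, second_countable_topology}"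
  assumes [measurable]: "u \<in> borel_measurable borel"
  shows "(\<integral>y. u (x - y) \<partial>lborel) = (\<integral>y. u y \<partial>lborel)"
proof -
  have "lborel = distr lborel borel (\<lambda>y::'a. x - y)"
    using lborel_affine[of "-1" x] by (simp add: density_1)
  then have "(\<integral>y. u y \<partial>lborel) = (\<integral>y. u y \<partial>distr lborel borel (\<lambda>y. x - y))"
    by simp
  also have "\<dots> = (\<integral>y. u (x - y) \<partial>lborel)"
    by (rule integral_distr) measurable
  finally show ?thesis by simp
qed

text \<open>Every derivative falls on \<open>\<rho>\<close>, so \<phi> only has to be continuous. A
  directional derivative of the convolution is the convolution with the corresponding derivative of
  \<open>\<rho>\<close>, which is again of every class; this is why the induction runs over all
  smooth \<open>\<rho>\<close> at once.\<close>

lemma C_k_convolution: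
  fixes \<rho> \<phi> :: "'a::euclidean_space \<Rightarrow> real"
  assumes "compact_measure M K" "continuous_on UNIV \<phi>" "\<And>k. C_k k \<rho>"
  shows "C_k k (\<lambda>x. \<integral>y. \<phi> y * \<rho> (x - y) \<partial>M)"
  using assms(3)
proof (induction k arbitrary: \<rho>)
  interpret compact_measure M K by fact
  have *: "GDERIV (\<lambda>x. \<integral>y. \<phi> y * \<rho> (x - y) \<partial>M) x :> (\<integral>y. \<phi> y *\<^sub>R grad \<rho> (x - y) \<partial>M)"
    if \<rho>: "\<And>k. C_k k \<rho>" for x and \<rho> :: "'a \<Rightarrow> real"
  proof (rule GDERIV_integral)
    show "GDERIV (\<lambda>x. \<phi> y * \<rho> (x - y)) x :> \<phi> y *\<^sub>R grad \<rho> (x - y)" for x y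
    proof -
      have "((\<lambda>x. x - y) has_derivative (\<lambda>h. h)) (at x)"
        by (auto intro!: derivative_eq_intros)
      then have "((\<lambda>x. \<rho> (x - y)) has_derivative (\<lambda>h. h \<bullet> grad \<rho> (x - y))) (at x)"
        by (rule has_derivative_compose) (use C_k_GDERIV(1)[OF \<rho>] in \<open>simp add: GDERIV_has_derivative\<close>)
      then show ?thesis
        unfolding GDERIV_has_derivative by (auto intro!: derivative_eq_intros)
    qed
    show "continuous_on UNIV (\<lambda>y. \<phi> y * \<rho> (x - y))" for x
      by (intro continuous_intros assms(2) continuous_on_compose2[OF C_k_continuous[OF \<rho>]]) auto
    show "continuous_on UNIV (\<lambda>(x, y). \<phi> y *\<^sub>R grad \<rho> (x - y))"
      unfolding case_prod_beta
      by (intro continuous_intros continuous_on_compose2[OF assms(2)]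
          continuous_on_compose2[OF C_k_GDERIV(3)[OF \<rho>]]) auto
  qed
  {
    case 0
    show ?case
      using GDERIV_continuous_on[OF *[OF 0]] by simp
  next
    case (Suc k)
    show ?case
    proof (rule C_k_SucI)
      show "((\<lambda>x. \<integral>y. \<phi> y * \<rho> (x - y) \<partial>M) has_derivative
          (\<lambda>h. \<integral>y. \<phi> y * frechet_derivative \<rho> (at (x - y)) h \<partial>M)) (at x)" for x
      proof (rule has_derivative_eq_rhs[OF *[OF Suc.prems, unfolded GDERIV_has_derivative] ext])
        fix h
        have "integrable M (\<lambda>y. \<phi> y *\<^sub>R grad \<rho> (x - y))"
          by (intro integrable_continuous continuous_intros assms(2) 
              continuous_on_compose2[OF C_k_GDERIV(3)[OF Suc.prems]]) auto
        then show "h \<bullet> (\<integral>y. \<phi> y *\<^sub>R grad \<rho> (x - y) \<partial>M) =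
            (\<integral>y. \<phi> y * frechet_derivative \<rho> (at (x - y)) h \<partial>M)"
          by (simp flip: integral_inner_right add: C_k_GDERIV(2)[OF Suc.prems])
      qed
      show "C_k k (\<lambda>x. \<integral>y. \<phi> y * frechet_derivative \<rho> (at (x - y)) v \<partial>M)" for v
        by (rule Suc.IH) (rule C_k_SucD(2)[OF Suc.prems])
    qed
  }
qed

section \<open>Mollification\<close>

lemma compact_measure_lborel_cball: "compact_measure (density lborel (indicator (cball (0::'a::euclidean_space) R))) (cball 0 R)"
proof (intro compact_measure.intro finite_measureI compact_measure_axioms.intro)
  show "emeasure (density lborel (indicator (cball (0::'a) R))) (space (density lborel (indicator (cball 0 R)))) \<noteq> \<infinity>"
    using emeasure_compact_finite[of "cball (0::'a) R"]
    by (subst emeasure_density) (auto simp: top.not_eq_extremum intro!: borel_measurable_indicator)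
  show "AE z in density lborel (indicator (cball (0::'a) R)). z \<in> cball 0 R"
    by (subst AE_density) (auto simp: indicator_eq_0_iff zero_less_iff_neq_zero intro!: borel_measurable_indicator)
qed auto

lemma uniformly_close_on_cball:
  fixes \<phi> :: "'a::euclidean_space \<Rightarrow> 'b::metric_space"
  assumes "continuous_on UNIV \<phi>" "\<delta> > 0"
  obtains \<epsilon> where "\<epsilon> > 0" "\<epsilon> \<le> 1"
    "\<And>x y. norm x \<le> R \<Longrightarrow> norm (y - x) < \<epsilon> \<Longrightarrow> dist (\<phi> y) (\<phi> x) \<le> \<delta>"
proof -
  have "uniformly_continuous_on (cball 0 (R + 1)) \<phi>"
    by (intro compact_uniformly_continuous continuous_on_subset[OF assms(1)]) auto
  then obtain d where d: "d > 0"
    "\<And>x y. x \<in> cball 0 (R + 1) \<Longrightarrow> y \<in> cball 0 (R + 1) \<Longrightarrow> dist y x < d \<Longrightarrow> dist (\<phi> y) (\<phi> x) < \<delta>"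
    unfolding uniformly_continuous_on_def using assms(2) by metis
  show ?thesis
  proof (rule that[of "min d 1"])
    fix x y :: 'a assume "norm x \<le> R" "norm (y - x) < min d 1"
    then show "dist (\<phi> y) (\<phi> x) \<le> \<delta>"
      using norm_triangle_sub[of y x] by (intro less_imp_le d) (auto simp: dist_norm)
  qed (use d in auto)
qed

text \<open>The approximation is a convolution, and its gradient is computed in two ways. With the
  derivatives on the kernel it is seen to be smooth; with the derivative on \<phi> its gradient is
  an average of \<open>g\<close> over a ball of radius \<epsilon>, hence close to \<open>g\<close>
  by uniform continuity on a slightly larger ball.\<close>

lemma C1_smooth_approximation:
  fixes \<phi> :: "'a::euclidean_space \<Rightarrow> real"
  assumes \<phi>: "\<And>x. GDERIV \<phi> x :> g x" and g: "continuous_on UNIV g" and \<delta>: "\<delta> > 0"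
  obtains \<phi>' where "\<And>k. C_k k \<phi>'" "bounded {x. \<phi>' x \<noteq> 0}"
    "\<And>x. norm x \<le> R \<Longrightarrow> \<bar>\<phi>' x - \<phi> x\<bar> \<le> \<delta>"
    "\<And>x. norm x \<le> R \<Longrightarrow> norm (grad \<phi>' x - g x) \<le> \<delta>"
proof -
  have \<phi>c: "continuous_on UNIV \<phi>" by (rule GDERIV_continuous_on[OF \<phi>])
  obtain \<epsilon>1 where e1: "\<epsilon>1 > 0" "\<epsilon>1 \<le> 1"
    "\<And>x y. norm x \<le> R \<Longrightarrow> norm (y - x) < \<epsilon>1 \<Longrightarrow> dist (\<phi> y) (\<phi> x) \<le> \<delta>"
    using uniformly_close_on_cball[OF \<phi>c \<delta>, of R] by blast
  obtain \<epsilon>2 where e2: "\<epsilon>2 > 0" "\<epsilon>2 \<le> 1"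
    "\<And>x y. norm x \<le> R \<Longrightarrow> norm (y - x) < \<epsilon>2 \<Longrightarrow> dist (g y) (g x) \<le> \<delta>"
    using uniformly_close_on_cball[OF g \<delta>, of R] by blast
  define \<epsilon> where "\<epsilon> = min \<epsilon>1 \<epsilon>2"
  have \<epsilon>: "\<epsilon> > 0" "\<epsilon> \<le> 1" using e1 e2 by (auto simp: \<epsilon>_def)
  define \<rho> :: "'a \<Rightarrow> real" where "\<rho> = bump \<epsilon>"
  have \<rho>_C: "C_k k \<rho>" for k by (simp add: \<rho>_def C_k_bump)
  have \<rho>_c: "continuous_on UNIV \<rho>" by (rule C_k_continuous[OF \<rho>_C])
  have \<rho>_0: "\<rho> x = 0" if "\<epsilon> \<le> norm x" for x
    using that \<epsilon> by (simp add: \<rho>_def bump_eq_0)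
  have \<rho>_nn: "\<rho> x \<ge> 0" for x by (simp add: \<rho>_def bump_nonneg)
  have [measurable]: "\<rho> \<in> borel_measurable borel" "\<phi> \<in> borel_measurable borel"
    using \<rho>_c \<phi>c by (auto intro: borel_measurable_continuous_onI)
  have \<rho>_int: "integrable lborel \<rho>"
  proof -
    have "\<rho> = (\<lambda>x. indicator (cball 0 \<epsilon>) x *\<^sub>R \<rho> x)"
      using \<rho>_0 by (auto simp: indicator_def fun_eq_iff)
    moreover have "integrable lborel (\<lambda>x. indicator (cball 0 \<epsilon>) x *\<^sub>R \<rho> x)"
      by (intro borel_integrable_compact continuous_on_subset[OF \<rho>_c]) auto
    ultimately show ?thesis by simp
  qed
  define c where "c = (\<integral>x. \<rho> x \<partial>lborel)"
  \<comment> \<open>If the integral vanished, the open ball on which the bump is positive would be a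
    Lebesgue null set.\<close>
  have "c \<noteq> 0"
  proof
    assume "c = 0"
    then have "AE x in lborel. \<rho> x = 0"
      using integral_nonneg_eq_0_iff_AE[OF \<rho>_int] \<rho>_nn by (auto simp: c_def)
    then have "AE x in lborel. x \<notin> ball (0::'a) \<epsilon>"
      by (auto elim!: eventually_mono simp: \<rho>_def simp flip: bump_pos_iff[OF \<epsilon>(1)])
    then have "emeasure lborel (ball (0::'a) \<epsilon>) = 0"
      by (subst (asm) AE_iff_measurable[of "ball (0::'a) \<epsilon>"]) auto
    moreover have "ball (0::'a) \<epsilon> \<noteq> {}" using \<epsilon> by auto
    ultimately show False
      using open_not_negligible[of "ball (0::'a) \<epsilon>"]
      by (auto simp: negligible_iff_null_sets null_sets_completion_iff null_sets_def
          intro: null_sets_completionI)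
  qed
  moreover have "c \<ge> 0" unfolding c_def using \<rho>_nn by simp
  ultimately have c: "c > 0" by simp
  define \<kappa> where "\<kappa> x = \<rho> x / c" for x
  have \<kappa>_C: "C_k k \<kappa>" for k
    using C_k_mult[OF \<rho>_C C_k_const, of k "inverse c"] by (simp add: \<kappa>_def[abs_def] divide_inverse)
  have \<kappa>_c: "continuous_on UNIV \<kappa>" by (rule C_k_continuous[OF \<kappa>_C])
  have \<kappa>_nn: "\<kappa> x \<ge> 0" for x using \<rho>_nn c by (simp add: \<kappa>_def)
  have \<kappa>_0: "\<kappa> x = 0" if "\<epsilon> \<le> norm x" for x
    using that by (simp add: \<kappa>_def \<rho>_0)
  have \<kappa>_pos: "norm x < \<epsilon>" if "0 < \<kappa> x" for x
    using \<kappa>_0[of x] that by force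
  have [measurable]: "\<kappa> \<in> borel_measurable borel"
    using \<kappa>_c by (auto intro: borel_measurable_continuous_onI)
  define N where "N = density lborel (\<lambda>x. ennreal (\<kappa> x))"
  have "prob_space N"
  proof
    have "emeasure N (space N) = (\<integral>\<^sup>+x. ennreal (\<kappa> x) \<partial>lborel)"
      by (simp add: N_def emeasure_density)
    also have "\<dots> = ennreal (\<integral>x. \<kappa> x \<partial>lborel)"
      using \<rho>_int \<kappa>_nn by (intro nn_integral_eq_integral) (auto simp: \<kappa>_def)
    also have "(\<integral>x. \<kappa> x \<partial>lborel) = 1"
      using c by (simp add: \<kappa>_def c_def)
    finally show "emeasure N (space N) = 1" by simp
  qed
  then interpret N: prob_space N .
  have N_AE: "AE z in N. norm z < \<epsilon>"
    unfolding N_def by (subst AE_density) (auto simp: \<kappa>_pos)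
  interpret N: compact_measure N "cball 0 \<epsilon>"
    using N_AE by unfold_locales (auto simp: N_def elim: eventually_mono)

  \<comment> \<open>Truncating \<open>\<phi>\<close> to a ball makes the convolution compactly supported and does not change it where the
    approximation is claimed.\<close>
  define B where "B = density lborel (indicator (cball (0::'a) (R + 2)))"
  have B_def': "B = density lborel (\<lambda>x. ennreal (indicat_real (cball 0 (R + 2)) x))"
    unfolding B_def ennreal_indicator ..
  interpret B: compact_measure B "cball 0 (R + 2)"
    unfolding B_def by (rule compact_measure_lborel_cball)
  define \<phi>' where "\<phi>' x = (\<integral>y. \<phi> y * \<kappa> (x - y) \<partial>B)" for x
  have C: "C_k k \<phi>'" for k
    unfolding \<phi>'_def[abs_def] by (rule C_k_convolution[OF B.compact_measure_axioms \<phi>c \<kappa>_C])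
  have bdd: "bounded {x. \<phi>' x \<noteq> 0}"
  proof (rule boundedI)
    fix x assume x: "x \<in> {x. \<phi>' x \<noteq> 0}"
    have "\<exists>y\<in>cball 0 (R + 2). \<phi> y * \<kappa> (x - y) \<noteq> 0"
    proof (rule ccontr)
      assume *: "\<not> ?thesis"
      have "AE y in B. \<phi> y * \<kappa> (x - y) = 0"
        using B.AE_K by (rule eventually_mono) (use * in blast)
      then have "\<phi>' x = 0"
        unfolding \<phi>'_def by (rule integral_eq_zero_AE)
      with x show False by simp
    qed
    then obtain y where y: "norm y \<le> R + 2" "\<kappa> (x - y) \<noteq> 0" by auto
    then have "norm (x - y) < 1" using \<kappa>_0[of "x - y"] \<epsilon> by force
    then show "norm x \<le> R + 3"
      using y norm_triangle_sub[of x y] by linarith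
  qed
  \<comment> \<open>As \<epsilon> \<le> 1, the kernel centred at such an x lives inside the ball of
    radius R + 2, where nothing was truncated. The margin between R and R + 1 makes the identity
    hold on an open neighbourhood of the ball of radius R, so it passes to gradients there.\<close>
  have eq: "\<phi>' x = (\<integral>y. \<phi> (x - y) \<partial>N)" if x: "norm x < R + 1" for x
  proof -
    have *: "\<kappa> (x - y) = 0" if "y \<notin> cball 0 (R + 2)" for y
      using that x \<epsilon> norm_triangle_sub[of y x] by (intro \<kappa>_0) (auto simp: norm_minus_commute)
    have "\<phi>' x = (\<integral>y. indicator (cball 0 (R + 2)) y * (\<phi> y * \<kappa> (x - y)) \<partial>lborel)"
      unfolding \<phi>'_def B_def'
      by (subst integral_real_density) (auto intro!: borel_measurable_indicator)
    also have "\<dots> = (\<integral>y. \<phi> y * \<kappa> (x - y) \<partial>lborel)"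
      using * by (intro Bochner_Integration.integral_cong) (auto simp: indicator_def)
    also have "\<dots> = (\<integral>y. \<phi> (x - y) * \<kappa> (x - (x - y)) \<partial>lborel)"
      by (rule lborel_integral_reflect[symmetric]) measurable
    also have "\<dots> = (\<integral>y. \<kappa> y * \<phi> (x - y) \<partial>lborel)"
      by (simp add: mult.commute)
    also have "\<dots> = (\<integral>y. \<phi> (x - y) \<partial>N)"
      unfolding N_def by (subst integral_real_density) (auto simp: \<kappa>_nn)
    finally show ?thesis .
  qed
  have shift_c: "continuous_on UNIV (\<lambda>y. \<phi> (x - y))" "continuous_on UNIV (\<lambda>y. g (x - y))" for x
    by (auto intro!: continuous_on_compose2[OF \<phi>c] continuous_on_compose2[OF g] continuous_intros)
  have deriv: "GDERIV (\<lambda>x. \<integral>y. \<phi> (x - y) \<partial>N) x :> (\<integral>y. g (x - y) \<partial>N)" for x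
  proof (rule N.GDERIV_integral)
    show "GDERIV (\<lambda>x. \<phi> (x - y)) x :> g (x - y)" for x y
    proof -
      have "((\<lambda>x. x - y) has_derivative (\<lambda>h. h)) (at x)"
        by (auto intro!: derivative_eq_intros)
      then show ?thesis
        unfolding GDERIV_has_derivative
        by (rule has_derivative_compose) (use \<phi> in \<open>simp add: GDERIV_has_derivative\<close>)
    qed
    show "continuous_on UNIV (\<lambda>(x, y). g (x - y))"
      unfolding case_prod_beta by (intro continuous_on_compose2[OF g] continuous_intros) auto
  qed (rule shift_c)
  have grad: "grad \<phi>' x = (\<integral>y. g (x - y) \<partial>N)" if x: "norm x \<le> R" for x
  proof (rule grad_eqI)
    show "GDERIV \<phi>' x :> (\<integral>y. g (x - y) \<partial>N)"
      unfolding GDERIV_has_derivative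
      by (rule has_derivative_transform_within_open[OF deriv[unfolded GDERIV_has_derivative], of "ball 0 (R + 1)"])
        (use x in \<open>auto simp: eq\<close>)
  qed
  show ?thesis
  proof (rule that[OF C bdd])
    fix x :: 'a assume x: "norm x \<le> R"
    have "AE y in N. norm (\<phi> (x - y) - \<phi> x) \<le> \<delta>"
      using N_AE by (rule eventually_mono) (use e1(3)[OF x] in \<open>auto simp: \<epsilon>_def dist_norm\<close>)
    then have "norm ((\<integral>y. \<phi> (x - y) \<partial>N) - \<phi> x) \<le> \<delta>"
      by (intro N.norm_integral_diff_le N.integrable_continuous shift_c)
    then show "\<bar>\<phi>' x - \<phi> x\<bar> \<le> \<delta>" using x by (simp add: eq)
    have "AE y in N. norm (g (x - y) - g x) \<le> \<delta>"
      using N_AE by (rule eventually_mono) (use e2(3)[OF x] in \<open>auto simp: \<epsilon>_def dist_norm\<close>)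
    then have "norm ((\<integral>y. g (x - y) \<partial>N) - g x) \<le> \<delta>"
      by (intro N.norm_integral_diff_le N.integrable_continuous shift_c)
    then show "norm (grad \<phi>' x - g x) \<le> \<delta>" using x by (simp add: grad)
  qed
qed

section \<open>Curves continuous in the \<open>\<infinity>\<close>-Wasserstein distance\<close>

lemma closed_supp: "closed (supp M)"
proof -
  have "- supp M = \<Union>{U. open U \<and> emeasure M U = 0}"
    by (auto simp: supp_def zero_less_iff_neq_zero)
  also have "open \<dots>" by blast
  finally show ?thesis by (simp add: open_closed)
qed

text \<open>The complement of the support is a union of open null sets. By second countability
  countably many of them already cover it (Lindelof), so it is a null set itself.\<close>

lemma AE_supp:
  fixes M :: "'a::second_countable_topology measure"
  assumes "sets M = sets borel"
  shows "AE z in M. z \<in> supp M"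
proof -
  obtain F where F: "F \<subseteq> {U. open U \<and> emeasure M U = 0}" "countable F"
    "\<Union>F = \<Union>{U. open U \<and> emeasure M U = 0}"
    using Lindelof[of "{U. open U \<and> emeasure M U = 0}"] by blast
  have "U \<in> null_sets M" if "U \<in> F" for U
    using F(1) assms that by (auto intro!: null_setsI)
  then have "\<Union>F \<in> null_sets M"
    using null_sets_UN'[OF F(2), of "\<lambda>x. x" M] by simp
  moreover have "- supp M = \<Union>F"
    unfolding F(3) by (auto simp: supp_def zero_less_iff_neq_zero)
  ultimately show ?thesis
    by (intro AE_I'[of "\<Union>F"]) auto
qed

lemma prob_compactD:
  assumes "M \<in> prob_compact"
  shows "prob_space M" "sets M = sets borel" "compact (supp M)"
  using assms by (auto simp: prob_compact_def)

lemma prob_compact_compact_measure: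
  fixes M :: "'a::euclidean_space measure"
  assumes "M \<in> prob_compact"
  shows "compact_measure M (supp M)"
  using prob_compactD[OF assms] AE_supp
  by (intro compact_measure.intro compact_measure_axioms.intro prob_space.finite_measure) auto

lemma compact_measure_pair:
  fixes M :: "'a::euclidean_space measure" and N :: "'b::euclidean_space measure"
  assumes "compact_measure M K" "compact_measure N L"
  shows "compact_measure (M \<Otimes>\<^sub>M N) (K \<times> L)"
proof -
  interpret M: compact_measure M K by fact
  interpret N: compact_measure N L by fact
  interpret P: pair_sigma_finite M N ..
  have s: "sets (M \<Otimes>\<^sub>M N) = sets borel"
    using sets_pair_measure_cong[OF M.sets_borel N.sets_borel] unfolding borel_prod .
  have "closed (K \<times> L)"
    using M.compact_K N.compact_K by (intro closed_Times compact_imp_closed)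
  then have "{x \<in> space (M \<Otimes>\<^sub>M N). x \<in> K \<times> L} \<in> sets (M \<Otimes>\<^sub>M N)"
    using s sets_eq_imp_space_eq[OF s] by simp
  moreover have "AE x in M. AE y in N. (x, y) \<in> K \<times> L"
    using M.AE_K N.AE_K by auto
  ultimately have "AE p in M \<Otimes>\<^sub>M N. p \<in> K \<times> L"
    by (rule P.AE_pair_measure)
  then show ?thesis
    using M.compact_K N.compact_K s
    by (intro compact_measure.intro compact_measure_axioms.intro compact_Times finite_measure_pair_measure)
      (auto intro: M.finite_measure_axioms N.finite_measure_axioms)
qed

lemma Fubini_continuous:
  fixes M :: "'a::euclidean_space measure" and N :: "'b::euclidean_space measure"
    and u :: "'a \<Rightarrow> 'b \<Rightarrow> 'c::{banach, second_countable_topology}"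
  assumes "compact_measure M K" "compact_measure N L" "continuous_on UNIV (\<lambda>(x, y). u x y)"
  shows "(\<integral>x. \<integral>y. u x y \<partial>N \<partial>M) = (\<integral>y. \<integral>x. u x y \<partial>M \<partial>N)"
proof -
  interpret M: compact_measure M K by fact
  interpret N: compact_measure N L by fact
  interpret P: pair_sigma_finite M N ..
  interpret P: compact_measure "M \<Otimes>\<^sub>M N" "K \<times> L"
    by (rule compact_measure_pair) fact+
  show ?thesis
    using P.Fubini_integral[OF P.integrable_continuous[OF assms(3)]] by simp
qed

section \<open>Continuity of integrals along the curve\<close>

locale Winf_curve =
  fixes f :: "real \<Rightarrow> 'a::euclidean_space measure"
  assumes Winf_continuous: "Winf_continuous f"
begin

lemma prob_compact: "0 \<le> t \<Longrightarrow> f t \<in> prob_compact"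
  using Winf_continuous by (simp add: Winf_continuous_def)

lemmas prob_space = prob_compact[THEN prob_compactD(1)]
  and sets_borel = prob_compact[THEN prob_compactD(2)]
  and compact_measure = prob_compact[THEN prob_compact_compact_measure]

lemmas integrable_continuous = compact_measure[THEN compact_measure.integrable_continuous]

text \<open>The form in which continuity of the curve is exploited: a coupling under which almost
  all pairs are \<delta>-close, with second components in the compact support of \<open>f t\<close>.
  Almost all points of \<open>f s\<close> then stay near one fixed compact set.\<close>

lemma close_coupling:
  assumes "0 \<le> t" "\<delta> > 0"
  obtains d where "d > 0" "\<And>s. 0 \<le> s \<Longrightarrow> \<bar>s - t\<bar> < d \<Longrightarrow>
    \<exists>P \<in> couplings (f s) (f t). AE p in P. norm (fst p - snd p) < \<delta> \<and> snd p \<in> supp (f t)"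
proof -
  have "((\<lambda>s. Winf (f s) (f t)) \<longlongrightarrow> 0) (at t within {0..})"
    using Winf_continuous assms by (simp add: Winf_continuous_def)
  then have "\<forall>\<^sub>F s in at t within {0..}. Winf (f s) (f t) < ennreal \<delta>"
    by (rule order_tendstoD) (use assms in simp)
  then obtain d where d: "d > 0"
    "\<And>s. s \<in> {0..} \<Longrightarrow> s \<noteq> t \<Longrightarrow> dist s t < d \<Longrightarrow> Winf (f s) (f t) < ennreal \<delta>"
    unfolding eventually_at by blast
  show ?thesis
  proof (rule that[OF d(1)])
    fix s assume s: "0 \<le> s" "\<bar>s - t\<bar> < d"
    have AE_t: "AE z in f t. z \<in> supp (f t)"
      by (rule AE_supp[OF sets_borel[OF assms(1)]])
    show "\<exists>P \<in> couplings (f s) (f t). AE p in P. norm (fst p - snd p) < \<delta> \<and> snd p \<in> supp (f t)"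
    proof (cases "s = t")
      case True
      have m: "(\<lambda>z. (z, z)) \<in> f t \<rightarrow>\<^sub>M borel"
        using sets_borel[OF assms(1)] by (simp add: borel_prod[symmetric] cong: measurable_cong_sets)
      \<comment> \<open>The limit defining continuity ignores the point t itself, so s = t is served
        separately by the diagonal coupling.\<close>
      define P where "P = distr (f t) borel (\<lambda>z. (z, z))"
      have [simp]: "sets P = sets borel" by (simp add: P_def)
      have fs: "fst \<in> borel \<rightarrow>\<^sub>M (borel :: 'a measure)" "snd \<in> borel \<rightarrow>\<^sub>M (borel :: 'a measure)"
        by (auto intro!: borel_measurable_continuous_onI continuous_intros)
      have "distr P borel fst = f t" "distr P borel snd = f t"
        using distr_distr[OF fs(1) m] distr_distr[OF fs(2) m] distr_id2[OF sets_borel[OF assms(1), symmetric]]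
        by (simp_all add: P_def comp_def)
      then have "P \<in> couplings (f s) (f t)"
        using True prob_space.prob_space_distr[OF prob_space[OF assms(1)] m]
        by (simp add: couplings_def) (simp add: P_def)
      moreover have "AE p in P. norm (fst p - snd p) < \<delta> \<and> snd p \<in> supp (f t)"
        unfolding P_def
      proof (subst AE_distr_iff[OF m])
        have "{p. norm (fst p - snd p) < \<delta>} \<inter> {p. snd p \<in> supp (f t)} \<in> sets (borel :: ('a \<times> 'a) measure)"
        proof (rule sets.Int)
          show "{p. norm (fst p - snd p) < \<delta>} \<in> sets (borel :: ('a \<times> 'a) measure)"
            by (intro borel_open open_Collect_less continuous_intros)
          have "closed (snd -` supp (f t) :: ('a \<times> 'a) set)"
            by (intro closed_vimage closed_supp continuous_intros)
          then show "{p. snd p \<in> supp (f t)} \<in> sets (borel :: ('a \<times> 'a) measure)"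
            by (simp add: vimage_def)
        qed
        then show "{x \<in> space borel. norm (fst x - snd x) < \<delta> \<and> snd x \<in> supp (f t)}
            \<in> sets (borel :: ('a \<times> 'a) measure)"
          by (simp add: Int_def)
      qed (use AE_t assms in \<open>auto elim: eventually_mono\<close>)
      ultimately show ?thesis by blast
    next
      case False
      then have "Winf (f s) (f t) < ennreal \<delta>"
        using d(2) s by (auto simp: dist_real_def)
      then obtain P where P: "P \<in> couplings (f s) (f t)"
        "(SUP (z, z')\<in>supp P. ennreal (norm (z - z'))) < ennreal \<delta>"
        unfolding Winf_def INF_less_iff by blast
      have sP: "sets P = sets borel" using P(1) by (simp add: couplings_def)
      have "norm (fst p - snd p) < \<delta>" if "p \<in> supp P" for p
      proof -
        have "ennreal (norm (fst p - snd p)) \<le> (SUP (z, z')\<in>supp P. ennreal (norm (z - z')))"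
          by (rule SUP_upper2[OF that]) (simp add: case_prod_beta)
        with P(2) have "ennreal (norm (fst p - snd p)) < ennreal \<delta>" by (rule le_less_trans[rotated])
        then show ?thesis by (simp add: ennreal_less_iff)
      qed
      moreover have "AE p in P. p \<in> supp P" by (rule AE_supp[OF sP])
      moreover have "AE p in P. snd p \<in> supp (f t)"
      proof -
        have m: "snd \<in> P \<rightarrow>\<^sub>M borel"
          using sP by (simp add: borel_prod[symmetric] cong: measurable_cong_sets)
        have "f t = distr P borel snd"
          using P(1) by (simp add: couplings_def)
        with AE_t have "AE z in distr P borel snd. z \<in> supp (f t)"
          by metis
        then show ?thesis
          by (subst (asm) AE_distr_iff[OF m]) (auto intro: borel_closed closed_supp)
      qed
      ultimately show ?thesis using P(1) by (intro bexI[of _ P]) auto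
    qed
  qed
qed

text \<open>Lets two integrals against different measures be subtracted under a single
  coupling.\<close>

lemma couplings_integral:
  fixes u :: "'a \<Rightarrow> 'b::{banach, second_countable_topology}"
  assumes P: "P \<in> couplings M N" and "M \<in> prob_compact" "N \<in> prob_compact"
    and u: "continuous_on UNIV u"
  shows "integrable P (\<lambda>p. u (fst p))" "(\<integral>p. u (fst p) \<partial>P) = (\<integral>z. u z \<partial>M)"
    and "integrable P (\<lambda>p. u (snd p))" "(\<integral>p. u (snd p) \<partial>P) = (\<integral>z. u z \<partial>N)"
proof -
  have sP: "sets P = sets borel" using P by (simp add: couplings_def)
  have m: "fst \<in> P \<rightarrow>\<^sub>M borel" "snd \<in> P \<rightarrow>\<^sub>M borel"
    using sP by (simp_all add: borel_prod[symmetric] cong: measurable_cong_sets)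
  have MN: "M = distr P borel fst" "N = distr P borel snd"
    using P by (auto simp: couplings_def)
  have um: "u \<in> borel_measurable borel" by (rule borel_measurable_continuous_onI[OF u])
  have "integrable M u" "integrable N u"
    using assms by (auto intro: compact_measure.integrable_continuous[OF prob_compact_compact_measure])
  then show "integrable P (\<lambda>p. u (fst p))" "integrable P (\<lambda>p. u (snd p))"
    unfolding MN by (auto simp: integrable_distr_eq[OF m(1) um] integrable_distr_eq[OF m(2) um])
  show "(\<integral>p. u (fst p) \<partial>P) = (\<integral>z. u z \<partial>M)" "(\<integral>p. u (snd p) \<partial>P) = (\<integral>z. u z \<partial>N)"
    unfolding MN by (auto simp: integral_distr[OF m(1) um] integral_distr[OF m(2) um])
qed

text \<open>Under a coupling with \<delta>-close pairs the difference of the two integrals is one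
  integral of a difference of values of \<open>u\<close> at nearby points of a compact set, where
  \<open>u\<close> is uniformly continuous. The parameter x is there for fields such as the mean
  force, which have to be jointly continuous in time and position.\<close>

lemma continuous_on_parametric_integral:
  fixes u :: "real \<Rightarrow> 'x::euclidean_space \<Rightarrow> 'a \<Rightarrow> 'b::{banach, second_countable_topology}"
  assumes u: "continuous_on ({0..} \<times> UNIV) (\<lambda>(t, x, z). u t x z)"
  shows "continuous_on ({0..} \<times> UNIV) (\<lambda>(t, x). \<integral>z. u t x z \<partial>f t)"
proof -
  have uz: "continuous_on UNIV (u t x)" if "0 \<le> t" for t x
  proof -
    have "continuous_on UNIV (\<lambda>z. (t, x, z))" by (intro continuous_intros)
    from continuous_on_compose2[OF u this] that show ?thesis by auto
  qed
  have "\<exists>d>0. \<forall>s y. 0 \<le> s \<longrightarrow> dist (s, y) (t, x) < d \<longrightarrow>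
      dist (\<integral>z. u s y z \<partial>f s) (\<integral>z. u t x z \<partial>f t) \<le> e" if t: "0 \<le> t" and e: "e > 0" for t x e
  proof -
    obtain R where R: "\<And>z. z \<in> supp (f t) \<Longrightarrow> norm z \<le> R"
      using compact_imp_bounded[OF prob_compactD(3)[OF prob_compact[OF t]]] unfolding bounded_iff by blast
    have "uniformly_continuous_on ({0..t+1} \<times> cball x 1 \<times> cball 0 (R + 1)) (\<lambda>(t, x, z). u t x z)"
      by (intro compact_uniformly_continuous continuous_on_subset[OF u] compact_Times) auto
    then obtain \<eta> where \<eta>: "\<eta> > 0" and cont:
      "\<And>p q. p \<in> {0..t+1} \<times> cball x 1 \<times> cball 0 (R + 1) \<Longrightarrow> q \<in> {0..t+1} \<times> cball x 1 \<times> cball 0 (R + 1) \<Longrightarrow>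
        dist q p < \<eta> \<Longrightarrow> dist ((\<lambda>(t, x, z). u t x z) q) ((\<lambda>(t, x, z). u t x z) p) < e"
      unfolding uniformly_continuous_on_def using e by metis
    \<comment> \<open>One third for each of time, parameter and phase-space point; the bound 1 keeps
      all three inside the compact set.\<close>
    define \<delta> where "\<delta> = min 1 (\<eta> / 3)"
    have \<delta>: "\<delta> > 0" "\<delta> \<le> 1" "3 * \<delta> \<le> \<eta>" using \<eta> by (auto simp: \<delta>_def)
    obtain d where d: "d > 0" "\<And>s. 0 \<le> s \<Longrightarrow> \<bar>s - t\<bar> < d \<Longrightarrow>
      \<exists>P \<in> couplings (f s) (f t). AE p in P. norm (fst p - snd p) < \<delta> \<and> snd p \<in> supp (f t)"
      using close_coupling[OF t \<delta>(1)] by blast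
    show ?thesis
    proof (intro exI[of _ "min d \<delta>"] conjI allI impI)
      fix s y assume s: "0 \<le> s" and close: "dist (s, y) (t, x) < min d \<delta>"
      have sd: "\<bar>s - t\<bar> < d" "\<bar>s - t\<bar> < \<delta>" and yd: "dist y x < \<delta>"
        using dist_fst_le[of "(s, y)" "(t, x)"] dist_snd_le[of "(s, y)" "(t, x)"] close
        by (auto simp: dist_real_def)
      obtain P where P: "P \<in> couplings (f s) (f t)"
        and AE: "AE p in P. norm (fst p - snd p) < \<delta> \<and> snd p \<in> supp (f t)"
        using d(2)[OF s sd(1)] by blast
      interpret P: prob_space P using P by (simp add: couplings_def)
      note 1 = couplings_integral[OF P prob_compact[OF s] prob_compact[OF t]]
      have "AE p in P. norm ((u s y (fst p) - u t x (snd p)) - 0) \<le> e"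
        using AE
      proof (rule eventually_mono)
        fix p assume p: "norm (fst p - snd p) < \<delta> \<and> snd p \<in> supp (f t)"
        have "norm (fst p) \<le> R + 1"
          using R[of "snd p"] p \<delta> norm_triangle_sub[of "fst p" "snd p"] by linarith
        moreover have "norm (snd p) \<le> R + 1"
          using R[of "snd p"] p by simp
        moreover have "dist (s, y, fst p) (t, x, snd p) < \<eta>"
        proof -
          have "dist (s, y, fst p) (t, x, snd p) \<le> dist s t + dist (y, fst p) (x, snd p)"
            unfolding dist_Pair_Pair[of s] by (intro sqrt_sum_squares_le_sum zero_le_dist)
          also have "dist (y, fst p) (x, snd p) \<le> dist y x + dist (fst p) (snd p)"
            unfolding dist_Pair_Pair by (intro sqrt_sum_squares_le_sum zero_le_dist)
          finally show ?thesis
            using p sd yd \<delta> by (simp add: dist_norm)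
        qed
        ultimately have "dist (u s y (fst p)) (u t x (snd p)) < e"
          using cont[of "(t, x, snd p)" "(s, y, fst p)"] s t sd yd \<delta>
          by (auto simp: dist_commute)
        then show "norm ((u s y (fst p) - u t x (snd p)) - 0) \<le> e"
          by (simp add: dist_norm)
      qed
      then have "norm ((\<integral>p. u s y (fst p) - u t x (snd p) \<partial>P) - 0) \<le> e"
        by (rule P.norm_integral_diff_le[rotated])
          (intro Bochner_Integration.integrable_diff 1 uz s t)
      then show "dist (\<integral>z. u s y z \<partial>f s) (\<integral>z. u t x z \<partial>f t) \<le> e"
        using 1[OF uz[OF s]] 1[OF uz[OF t]] by (simp add: dist_norm)
    qed (use d \<delta> in auto)
  qed note * = this
  show ?thesis
    unfolding continuous_on_iff
  proof (intro ballI allI impI)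
    fix p :: "real \<times> 'x" and e :: real
    assume "p \<in> {0..} \<times> UNIV" "e > 0"
    then obtain d where "d > 0" "\<forall>s y. 0 \<le> s \<longrightarrow> dist (s, y) (fst p, snd p) < d \<longrightarrow>
      dist (\<integral>z. u s y z \<partial>f s) (\<integral>z. u (fst p) (snd p) z \<partial>f (fst p)) \<le> e / 2"
      using *[of "fst p" "e / 2" "snd p"] by auto
    then show "\<exists>d>0. \<forall>q\<in>{0..} \<times> UNIV. dist q p < d \<longrightarrow>
        dist (case q of (t, x) \<Rightarrow> \<integral>z. u t x z \<partial>f t) (case p of (t, x) \<Rightarrow> \<integral>z. u t x z \<partial>f t) < e"
      using \<open>e > 0\<close> by (intro exI[of _ d]) (fastforce simp: case_prod_beta)
  qed
qed

lemma continuous_on_integral: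
  fixes u :: "real \<Rightarrow> 'a \<Rightarrow> 'b::{banach, second_countable_topology}"
  assumes u: "continuous_on ({0..} \<times> UNIV) (\<lambda>(t, z). u t z)"
  shows "continuous_on {0..} (\<lambda>t. \<integral>z. u t z \<partial>f t)"
proof -
  have "continuous_on ({0..} \<times> UNIV) (\<lambda>(t, x::real, z). u t z)"
    unfolding case_prod_beta
    by (rule continuous_on_compose2[OF u, of _ "\<lambda>p. (fst p, snd (snd p))", simplified])
      (auto intro!: continuous_intros)
  from continuous_on_parametric_integral[OF this]
  have c: "continuous_on ({0..} \<times> UNIV) (\<lambda>(t, x::real). \<integral>z. u t z \<partial>f t)" .
  have "continuous_on {0..} (\<lambda>t::real. (t, 0::real))" by (intro continuous_intros)
  from continuous_on_compose2[OF c this] show ?thesis by auto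
qed

text \<open>The \<infinity>-distance controls supports: for s close to t, almost all points of
  \<open>f s\<close> lie within distance 1 of the support of \<open>f t\<close>. Compactness of the
  time interval reduces this to finitely many t.\<close>

lemma uniformly_bounded_support:
  obtains R where "R > 0" "\<And>t. t \<in> {0..T} \<Longrightarrow> AE z in f t. norm z \<le> R"
proof -
  have "\<exists>d R. d > 0 \<and> (\<forall>s. 0 \<le> s \<longrightarrow> \<bar>s - t\<bar> < d \<longrightarrow> (AE z in f s. norm z \<le> R))" if t: "0 \<le> t" for t
  proof -
    obtain R where R: "\<And>z. z \<in> supp (f t) \<Longrightarrow> norm z \<le> R"
      using compact_imp_bounded[OF prob_compactD(3)[OF prob_compact[OF t]]] unfolding bounded_iff by blast
    obtain d where d: "d > 0" "\<And>s. 0 \<le> s \<Longrightarrow> \<bar>s - t\<bar> < d \<Longrightarrow>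
      \<exists>P \<in> couplings (f s) (f t). AE p in P. norm (fst p - snd p) < 1 \<and> snd p \<in> supp (f t)"
      using close_coupling[OF t, of 1] by auto
    show ?thesis
    proof (intro exI conjI allI impI)
      fix s assume s: "0 \<le> s" "\<bar>s - t\<bar> < d"
      then obtain P where P: "P \<in> couplings (f s) (f t)"
        and AE: "AE p in P. norm (fst p - snd p) < 1 \<and> snd p \<in> supp (f t)"
        using d(2) by blast
      have m: "fst \<in> P \<rightarrow>\<^sub>M borel"
        using P by (simp add: couplings_def borel_prod[symmetric] cong: measurable_cong_sets)
      have "AE p in P. norm (fst p) \<le> R + 1"
        using AE
      proof (rule eventually_mono)
        fix p assume p: "norm (fst p - snd p) < 1 \<and> snd p \<in> supp (f t)"
        then show "norm (fst p) \<le> R + 1"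
          using R[of "snd p"] norm_triangle_sub[of "fst p" "snd p"] by linarith
      qed
      then have "AE z in distr P borel fst. norm z \<le> R + 1"
        by (subst AE_distr_iff[OF m]) auto
      moreover have "f s = distr P borel fst"
        using P by (simp add: couplings_def)
      ultimately show "AE z in f s. norm z \<le> R + 1"
        by (simp only:)
    qed (rule d)
  qed
  then obtain d R where dR: "\<And>t. 0 \<le> t \<Longrightarrow> d t > 0"
    "\<And>t s. 0 \<le> t \<Longrightarrow> 0 \<le> s \<Longrightarrow> \<bar>s - t\<bar> < d t \<Longrightarrow> AE z in f s. norm z \<le> (R t :: real)"
    by metis
  obtain C where C: "C \<subseteq> {0..T}" "finite C" "{0..T} \<subseteq> (\<Union>t\<in>C. ball t (d t))"
  proof (rule compactE_image[of "{0..T}" "{0..T}" "\<lambda>t. ball t (d t)"])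
    show "{0..T} \<subseteq> (\<Union>t\<in>{0..T}. ball t (d t))"
    proof
      fix t assume "t \<in> {0..T}"
      then show "t \<in> (\<Union>t\<in>{0..T}. ball t (d t))" using dR(1)[of t] by (intro UN_I[of t]) auto
    qed
  qed auto
  show ?thesis
  proof (rule that[of "1 + (\<Sum>t\<in>C. \<bar>R t\<bar>)"])
    fix t assume t: "t \<in> {0..T}"
    then obtain c where c: "c \<in> C" "\<bar>t - c\<bar> < d c"
      using C(3) by (force simp: dist_real_def)
    have "R c \<le> \<bar>R c\<bar>" by simp
    also have "\<dots> \<le> (\<Sum>t\<in>C. \<bar>R t\<bar>)"
      by (rule member_le_sum[OF c(1)]) (use C in auto)
    finally have "R c \<le> 1 + (\<Sum>t\<in>C. \<bar>R t\<bar>)" by simp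
    moreover have "AE z in f t. norm z \<le> R c"
      using c C(1) t by (intro dR(2)[of c]) auto
    ultimately show "AE z in f t. norm z \<le> 1 + (\<Sum>t\<in>C. \<bar>R t\<bar>)"
      by (auto elim!: eventually_mono)
  qed (simp add: add_pos_nonneg sum_nonneg)
qed

end

section \<open>From the weak formulation to derivatives of observables\<close>

lemma GDERIV_Pair_partial:
  assumes "GDERIV \<phi> (r, v) :> D"
  shows "GDERIV (\<lambda>x. \<phi> (x, v)) r :> fst D" "GDERIV (\<lambda>w. \<phi> (r, w)) v :> snd D"
proof -
  have "((\<lambda>x. (x, v)) has_derivative (\<lambda>h. (h, 0))) (at r)"
    "((\<lambda>w. (r, w)) has_derivative (\<lambda>h. (0, h))) (at v)"
    by (auto intro!: derivative_eq_intros)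
  from this[THEN has_derivative_compose] assms
  have "((\<lambda>x. \<phi> (x, v)) has_derivative (\<lambda>h. (h, 0) \<bullet> D)) (at r)"
    "((\<lambda>w. \<phi> (r, w)) has_derivative (\<lambda>h. (0, h) \<bullet> D)) (at v)"
    unfolding GDERIV_has_derivative by blast+
  then show "GDERIV (\<lambda>x. \<phi> (x, v)) r :> fst D" "GDERIV (\<lambda>w. \<phi> (r, w)) v :> snd D"
    by (simp_all add: GDERIV_has_derivative inner_prod_def)
qed

lemma GDERIV_scale:
  "GDERIV f x :> D \<Longrightarrow> GDERIV (\<lambda>x. c * f x) x :> c *\<^sub>R D"
  unfolding GDERIV_has_derivative by (auto intro!: derivative_eq_intros)

text \<open>Products of a function of time and a function on phase space are the only test functions
  inserted into the weak formulation.\<close>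

lemma test_function_product:
  fixes \<phi> :: "'a::euclidean_space \<times> 'a \<Rightarrow> real"
  assumes "\<And>k. C_k k \<eta>" "bounded {t. \<eta> t \<noteq> 0}" "\<And>k. C_k k \<phi>" "bounded {z. \<phi> z \<noteq> 0}"
  shows "test_function (\<lambda>p. \<eta> (fst p) * \<phi> (snd p))"
  unfolding test_function_def
proof
  show "\<forall>k. C_k k (\<lambda>p. \<eta> (fst p) * \<phi> (snd p))"
    by (intro allI C_k_mult C_k_compose_linear[OF bounded_linear_fst] C_k_compose_linear[OF bounded_linear_snd] assms)
  have "{p. \<eta> (fst p) * \<phi> (snd p) \<noteq> 0} \<subseteq> {t. \<eta> t \<noteq> 0} \<times> {z. \<phi> z \<noteq> 0}" by auto
  then show "compact (closure {p. \<eta> (fst p) * \<phi> (snd p) \<noteq> 0})"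
    unfolding compact_closure by (rule bounded_subset[OF bounded_Times[OF assms(2,4)]])
qed

text \<open>Passes from the half-line integrals of the weak formulation to integrals over compact
  intervals, for which the fundamental theorem of calculus is used.\<close>

lemma set_integral_eventually_0:
  fixes h :: "real \<Rightarrow> real"
  assumes "continuous_on {0..} h" "\<And>t. S \<le> t \<Longrightarrow> h t = 0"
  shows "set_integrable lborel {0..} h" "(LBINT t:{0..}. h t) = integral {0..S} h"
proof -
  have i: "set_integrable lborel {0..S} h"
    using assms(1) by (intro borel_integrable_atLeastAtMost') (auto intro: continuous_on_subset)
  have eq: "(\<lambda>t. indicator {0..} t *\<^sub>R h t) = (\<lambda>t. indicator {0..S} t *\<^sub>R h t)"
    using assms(2) by (auto simp: indicator_def fun_eq_iff)
  show "set_integrable lborel {0..} h"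
    using i unfolding set_integrable_def eq .
  show "(LBINT t:{0..}. h t) = integral {0..S} h"
    using set_borel_integral_eq_integral(2)[OF i] unfolding set_lebesgue_integral_def eq .
qed

text \<open>At positive times the derivative is minus a bump around \<open>T\<close>; the bump around \<open>- T\<close> only makes the
  support compact.\<close>

lemma smooth_plateau:
  fixes T \<epsilon> :: real
  assumes "0 < \<epsilon>" "\<epsilon> < T"
  obtains \<eta> where "\<And>k. C_k k \<eta>"
    "\<And>t. (\<eta> has_real_derivative bump \<epsilon> (t + T) - bump \<epsilon> (t - T)) (at t)"
    "\<And>t. T + \<epsilon> \<le> \<bar>t\<bar> \<Longrightarrow> \<eta> t = 0"
proof -
  obtain G :: "real \<Rightarrow> real" where "\<And>x. (G has_vector_derivative bump \<epsilon> x) (at x)"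
    using einterval_antiderivative[of "-\<infinity>" "\<infinity>" "bump \<epsilon> :: real \<Rightarrow> real"]
      continuous_on_interior[OF bump_continuous[of \<epsilon>]] by auto
  then have G: "(G has_real_derivative bump \<epsilon> x) (at x)" for x
    by (simp add: has_real_derivative_iff_has_vector_derivative)
  have G_C: "C_k k G" for k
    by (rule C_k_Suc_imp[OF C_k_real_SucI[OF G C_k_bump]])
  have "(G has_real_derivative 0) (at x within A)" if "\<epsilon> \<le> norm x" for x A
    using has_field_derivative_at_within[OF G[of x]] that assms(1) by (simp add: bump_eq_0)
  then have "\<exists>c. \<forall>x\<in>{\<epsilon>..}. G x = c" "\<exists>c. \<forall>x\<in>{..-\<epsilon>}. G x = c"
    using assms(1) by (auto intro!: has_field_derivative_zero_constant)
  then obtain c c' where c: "\<And>x. \<epsilon> \<le> x \<Longrightarrow> G x = c" "\<And>x. x \<le> - \<epsilon> \<Longrightarrow> G x = c'"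
    by auto
  \<comment> \<open>An antiderivative of the bump is constant on either side of it. For
    \<bar>t\<bar> \<ge> T + \<epsilon> both shifted arguments lie on the same side, so the two
    constants cancel.\<close>
  show ?thesis
  proof (rule that[of "\<lambda>t. G (t + T) - G (t - T)"])
    have "C_k k (\<lambda>t. t + T)" "C_k k (\<lambda>t. t - T)" for k
      using C_k_add[OF C_k_bounded_linear[OF bounded_linear_ident] C_k_const, of k T]
        C_k_add[OF C_k_bounded_linear[OF bounded_linear_ident] C_k_const, of k "-T"] by simp_all
    from C_k_add[OF C_k_compose[OF G_C this(1)] C_k_uminus[OF C_k_compose[OF G_C this(2)]]]
    show "C_k k (\<lambda>t. G (t + T) - G (t - T))" for k by simp
    show "((\<lambda>t. G (t + T) - G (t - T)) has_real_derivative bump \<epsilon> (t + T) - bump \<epsilon> (t - T)) (at t)" for t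
      by (auto intro!: derivative_eq_intros DERIV_chain2[OF G])
    show "G (t + T) - G (t - T) = 0" if "T + \<epsilon> \<le> \<bar>t\<bar>" for t
    proof (cases "t \<ge> 0")
      case True then show ?thesis using that assms by (simp add: c)
    next
      case False then show ?thesis using that assms by (simp add: c)
    qed
  qed
qed

text \<open>A du Bois-Reymond argument. Subtracting from \<open>m\<close> the antiderivative of
  \<beta> with the same value at 0 leaves a function D with weak derivative 0. Since \<eta> may be
  nonzero at time 0, the weak identity also sees the initial value; this is why D vanishes instead
  of being merely constant. To isolate D at T, \<eta> is chosen with \<eta>' equal to minus a bump
  around T on the half-line.\<close>

lemma weak_derivative_imp_integral:
  fixes m \<beta> :: "real \<Rightarrow> real"
  assumes m: "continuous_on {0..} m" and \<beta>: "continuous_on {0..} \<beta>"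
    and weak: "\<And>\<eta> \<eta>' S. (\<And>k. C_k k \<eta>) \<Longrightarrow> (\<And>t. (\<eta> has_real_derivative \<eta>' t) (at t)) \<Longrightarrow>
      continuous_on UNIV \<eta>' \<Longrightarrow> S > 0 \<Longrightarrow> (\<And>t. S \<le> \<bar>t\<bar> \<Longrightarrow> \<eta> t = 0) \<Longrightarrow> (\<And>t. S \<le> \<bar>t\<bar> \<Longrightarrow> \<eta>' t = 0) \<Longrightarrow>
      integral {0..S} (\<lambda>t. \<eta>' t * m t + \<eta> t * \<beta> t) = - \<eta> 0 * m 0"
    and T: "0 \<le> T"
  shows "m T - m 0 = integral {0..T} \<beta>"
proof (cases "T = 0")
  case False
  with T have T: "T > 0" by simp
  define B where "B t = m 0 + integral {0..t} \<beta>" for t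
  have B': "(B has_vector_derivative \<beta> t) (at t within {0..S})" if "t \<in> {0..S}" for t S
    unfolding B_def
    using integral_has_vector_derivative[of 0 S \<beta> t] continuous_on_subset[OF \<beta>] that
    by (auto intro!: derivative_eq_intros)
  have B_cont: "continuous_on {0..S} B" for S
    using B' by (meson continuous_on_vector_derivative)
  define D where "D t = m t - B t" for t
  have D_cont: "continuous_on {0..S} D" for S
    unfolding D_def by (intro continuous_intros B_cont continuous_on_subset[OF m]) auto
  have D_weak: "integral {0..S} (\<lambda>t. \<eta>' t * D t) = 0"
    if \<eta>: "\<And>k. C_k k \<eta>" "\<And>t. (\<eta> has_real_derivative \<eta>' t) (at t)" "continuous_on UNIV \<eta>'"
      "S > 0" "\<And>t. S \<le> \<bar>t\<bar> \<Longrightarrow> \<eta> t = 0" "\<And>t. S \<le> \<bar>t\<bar> \<Longrightarrow> \<eta>' t = 0" for \<eta> \<eta>' S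
  proof -
    have \<eta>c: "continuous_on A \<eta>" "continuous_on A \<eta>'" for A
      using C_k_continuous[OF \<eta>(1)] \<eta>(3) continuous_on_subset by blast+
    have mc: "continuous_on {0..S} m" "continuous_on {0..S} \<beta>"
      using continuous_on_subset[OF m] continuous_on_subset[OF \<beta>] by auto
    have "((\<lambda>t. \<eta>' t * B t + \<eta> t * \<beta> t) has_integral \<eta> S * B S - \<eta> 0 * B 0) {0..S}"
    proof (rule fundamental_theorem_of_calculus)
      fix t assume t: "t \<in> {0..S}"
      have "(\<eta> has_vector_derivative \<eta>' t) (at t within {0..S})"
        using \<eta>(2) has_field_derivative_at_within has_real_derivative_iff_has_vector_derivative by blast
      from has_vector_derivative_mult[OF this B'[OF t]]
      show "((\<lambda>t. \<eta> t * B t) has_vector_derivative \<eta>' t * B t + \<eta> t * \<beta> t) (at t within {0..S})"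
        by (simp add: add.commute)
    qed (use \<eta>(4) in simp)
    then have "integral {0..S} (\<lambda>t. \<eta>' t * B t + \<eta> t * \<beta> t) = - \<eta> 0 * m 0"
      using \<eta>(4,5) by (simp add: integral_unique B_def)
    moreover have "integral {0..S} (\<lambda>t. \<eta>' t * m t + \<eta> t * \<beta> t) = - \<eta> 0 * m 0"
      by (rule weak) (fact \<eta>)+
    moreover have "integral {0..S} (\<lambda>t. (\<eta>' t * m t + \<eta> t * \<beta> t) - (\<eta>' t * B t + \<eta> t * \<beta> t))
        = integral {0..S} (\<lambda>t. \<eta>' t * m t + \<eta> t * \<beta> t) - integral {0..S} (\<lambda>t. \<eta>' t * B t + \<eta> t * \<beta> t)"
      by (intro Henstock_Kurzweil_Integration.integral_diff integrable_continuous_interval continuous_intros \<eta>c mc B_cont)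
    moreover have "(\<lambda>t. (\<eta>' t * m t + \<eta> t * \<beta> t) - (\<eta>' t * B t + \<eta> t * \<beta> t)) = (\<lambda>t. \<eta>' t * D t)"
      by (auto simp: D_def algebra_simps)
    ultimately show ?thesis by simp
  qed
  have "D T = 0"
  proof (rule ccontr)
    assume nz: "D T \<noteq> 0"
    \<comment> \<open>Multiplying by the constant \<open>D T\<close> makes the function positive
      near T, so both signs of \<open>D T\<close> are treated at once.\<close>
    have "continuous_on {0..2*T} (\<lambda>t. D t * D T)" by (intro continuous_intros D_cont)
    then have "continuous (at T within {0..2*T}) (\<lambda>t. D t * D T)"
      using T by (simp add: continuous_on_eq_continuous_within)
    then have "\<forall>\<^sub>F t in at T within {0..2*T}. 0 < D t * D T"
      unfolding continuous_within by (rule order_tendstoD) (use nz in \<open>simp add: power2_eq_square[symmetric]\<close>)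
    then obtain d where d: "d > 0" "\<And>t. t \<in> {0..2*T} \<Longrightarrow> t \<noteq> T \<Longrightarrow> dist t T < d \<Longrightarrow> 0 < D t * D T"
      unfolding eventually_at by blast
    \<comment> \<open>At most d, so that D keeps its sign on the bump; below T, so that the bump
      around -T is invisible at times t \<ge> 0 and T + \<epsilon> stays below 2 T.\<close>
    define \<epsilon> where "\<epsilon> = min d (T / 2)"
    have \<epsilon>: "0 < \<epsilon>" "\<epsilon> < T" "\<epsilon> \<le> d" using d T by (auto simp: \<epsilon>_def)
    obtain \<eta> where \<eta>: "\<And>k. C_k k \<eta>"
      "\<And>t. (\<eta> has_real_derivative bump \<epsilon> (t + T) - bump \<epsilon> (t - T)) (at t)"
      "\<And>t. T + \<epsilon> \<le> \<bar>t\<bar> \<Longrightarrow> \<eta> t = 0"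
      using smooth_plateau[OF \<epsilon>(1,2)] by blast
    have bc: "continuous_on A (\<lambda>t. bump \<epsilon> (t - T))" "continuous_on A (\<lambda>t. bump \<epsilon> (t + T))" for A
      by (auto intro!: continuous_on_compose2[OF bump_continuous] continuous_intros)
    have "integral {0..T+\<epsilon>} (\<lambda>t. (bump \<epsilon> (t + T) - bump \<epsilon> (t - T)) * D t) = 0"
      by (rule D_weak[OF \<eta>(1,2)])
         (use \<epsilon> T in \<open>auto intro!: continuous_intros bc \<eta>(3) simp: bump_eq_0\<close>)
    moreover have "integral {0..T+\<epsilon>} (\<lambda>t. (bump \<epsilon> (t + T) - bump \<epsilon> (t - T)) * D t)
        = integral {0..T+\<epsilon>} (\<lambda>t. - (bump \<epsilon> (t - T) * D t))"
      by (intro Henstock_Kurzweil_Integration.integral_cong) (use \<epsilon> in \<open>simp add: bump_eq_0\<close>)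
    ultimately have "integral {0..T+\<epsilon>} (\<lambda>t. bump \<epsilon> (t - T) * D t) * D T = 0"
      by simp
    then have "integral {0..T+\<epsilon>} (\<lambda>t. bump \<epsilon> (t - T) * D t * D T) = 0"
      by simp
    moreover have "bump \<epsilon> (t - T) * D t * D T \<ge> 0" if "t \<in> {0..T+\<epsilon>}" for t
    proof (cases "\<bar>t - T\<bar> < \<epsilon>")
      case True
      then have "D t * D T \<ge> 0"
        using d(2)[of t] that \<epsilon> by (cases "t = T") (auto simp: dist_real_def)
      then show ?thesis using bump_nonneg[of \<epsilon> "t - T"] by (simp add: mult.assoc)
    next
      case False
      then show ?thesis using \<epsilon> by (simp add: bump_eq_0)
    qed
    ultimately have "\<forall>t\<in>{0..T+\<epsilon>}. bump \<epsilon> (t - T) * D t * D T = 0"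
      by (subst (asm) integral_eq_0_iff) (use \<epsilon> T in \<open>auto intro!: continuous_intros bc D_cont\<close>)
    then have "bump \<epsilon> (T - T) * D T * D T = 0"
      using T \<epsilon> by (auto dest!: bspec[of _ _ T])
    moreover have "bump \<epsilon> (T - T) > 0"
      by (subst bump_pos_iff) (use \<epsilon> in auto)
    ultimately show False using nz by simp
  qed
  then show ?thesis by (simp add: D_def B_def)
qed simp

section \<open>Observables along a solution\<close>

locale mean_field =
  fixes V :: "'a::euclidean_space \<Rightarrow> real" and \<psi> :: "real \<Rightarrow> real"
    and f0 :: "('a \<times> 'a) measure" and f :: "real \<Rightarrow> ('a \<times> 'a) measure"
  assumes V_C1: "C_k 1 V"
    and gradV_antisym: "grad V (- x) = - grad V x"
    and \<psi>_continuous: "continuous_on {0..} \<psi>"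
    and solution: "mean_field_solution V \<psi> f0 f"
begin

sublocale Winf_curve f
  using solution by unfold_locales (simp add: mean_field_solution_def)

lemma initial: "f 0 = f0"
  using solution by (simp add: mean_field_solution_def)

lemma V_GDERIV: "GDERIV V x :> grad V x"
  using C_k_GDERIV(1)[of 0] V_C1 by simp

lemma gradV_continuous: "continuous_on UNIV (grad V)"
  using C_k_GDERIV(3)[of 0] V_C1 by simp

lemma V_continuous: "continuous_on UNIV V"
  by (rule GDERIV_continuous_on[OF V_GDERIV])

lemmas V_continuous_on [continuous_intros] = continuous_on_compose2[OF V_continuous _ subset_UNIV]
lemmas gradV_continuous_on [continuous_intros] = continuous_on_compose2[OF gradV_continuous _ subset_UNIV]

lemma \<psi>_norm_continuous_on [continuous_intros]:
  "continuous_on A g \<Longrightarrow> continuous_on A (\<lambda>x. \<psi> (norm (g x)))"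
  by (rule continuous_on_compose2[OF \<psi>_continuous]) (auto intro!: continuous_intros)

definition v_mean :: 'a where "v_mean = mean_velocity f0"

definition force :: "real \<Rightarrow> 'a \<times> 'a \<Rightarrow> 'a" where
  "force t z = (\<integral>z'. \<psi> (norm (fst z - fst z')) *\<^sub>R (snd z - snd z') - grad V (fst z' - fst z) \<partial>f t)"

text \<open>The vector field of the characteristics. \<open>force\<close> is the bracket on the
  right-hand side of the weak formulation; moving it to the left produces the minus sign.\<close>

definition drift :: "real \<Rightarrow> 'a \<times> 'a \<Rightarrow> 'a \<times> 'a" where
  "drift t z = (snd z - v_mean, - force t z)"

lemma force_continuous: "continuous_on ({0..} \<times> UNIV) (\<lambda>(t, z). force t z)"
  unfolding force_def
  by (rule continuous_on_parametric_integral) (auto simp: case_prod_unfold intro!: continuous_intros)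

lemma drift_continuous: "continuous_on ({0..} \<times> UNIV) (\<lambda>(t, z). drift t z)"
  using force_continuous unfolding drift_def case_prod_beta by (intro continuous_intros)

lemma force_continuous_snd: "0 \<le> t \<Longrightarrow> continuous_on A (force t)"
  by (rule continuous_on_compose2[OF force_continuous, of A "\<lambda>z. (t, z)", simplified])
    (auto intro!: continuous_on_Pair)

lemma drift_continuous_snd: "0 \<le> t \<Longrightarrow> continuous_on A (drift t)"
  unfolding drift_def by (intro continuous_intros force_continuous_snd)

lemma drift_integral_continuous:
  assumes "continuous_on UNIV g"
  shows "continuous_on {0..} (\<lambda>t. \<integral>z. drift t z \<bullet> g z \<partial>f t)"
proof (rule continuous_on_integral)
  show "continuous_on ({0..} \<times> UNIV) (\<lambda>(t, z). drift t z \<bullet> g z)"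
    using drift_continuous unfolding case_prod_beta
    by (intro continuous_intros continuous_on_compose2[OF assms]) auto
qed

text \<open>\<eta> factors out of every phase-space integral, so a product test function yields
  exactly the weak identity in time that \<open>weak_derivative_imp_integral\<close> asks for. The
  transport part \<open>\<beta>1\<close> and the force part \<open>\<beta>2\<close> are cut off at S
  separately and joined afterwards.\<close>

lemma weak_form:
  assumes \<eta>: "\<And>k. C_k k \<eta>" "\<And>t. (\<eta> has_real_derivative \<eta>' t) (at t)" "continuous_on UNIV \<eta>'"
    "S > 0" "\<And>t. S \<le> \<bar>t\<bar> \<Longrightarrow> \<eta> t = 0" "\<And>t. S \<le> \<bar>t\<bar> \<Longrightarrow> \<eta>' t = 0"
    and \<phi>: "\<And>k. C_k k \<phi>" "bounded {z. \<phi> z \<noteq> 0}"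
  shows "integral {0..S} (\<lambda>t. \<eta>' t * (\<integral>z. \<phi> z \<partial>f t) + \<eta> t * (\<integral>z. drift t z \<bullet> grad \<phi> z \<partial>f t))
    = - \<eta> 0 * (\<integral>z. \<phi> z \<partial>f 0)"
proof -
  let ?g = "grad \<phi>"
  let ?h = "\<lambda>p. \<eta> (fst p) * \<phi> (snd p)"
  note g = C_k_GDERIV(1)[OF \<phi>(1)] and gc = C_k_GDERIV(3)[OF \<phi>(1)]
  have \<phi>c: "continuous_on UNIV \<phi>" by (rule C_k_continuous[OF \<phi>(1)])
  have \<eta>c: "continuous_on A \<eta>" "continuous_on A \<eta>'" for A
    using C_k_continuous[OF \<eta>(1)] \<eta>(3) continuous_on_subset by blast+
  have gc': "continuous_on A (\<lambda>x. fst (?g (k x)))" "continuous_on A (\<lambda>x. snd (?g (k x)))"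
    "continuous_on A (\<lambda>x. \<phi> (k x))"
    if "continuous_on A k" for A k
    using that by (auto intro!: continuous_intros continuous_on_compose2[OF gc] continuous_on_compose2[OF \<phi>c])
  define m where "m t = (\<integral>z. \<phi> z \<partial>f t)" for t
  define \<beta>1 where "\<beta>1 t = (\<integral>z. (snd z - v_mean) \<bullet> fst (?g z) \<partial>f t)" for t
  define \<beta>2 where "\<beta>2 t = (\<integral>z. force t z \<bullet> snd (?g z) \<partial>f t)" for t
  have cont: "continuous_on {0..} m" "continuous_on {0..} \<beta>1" "continuous_on {0..} \<beta>2"
    unfolding m_def \<beta>1_def \<beta>2_def using force_continuous
    by (auto intro!: continuous_on_integral continuous_intros gc' simp: case_prod_unfold)
  have \<beta>: "(\<integral>z. drift t z \<bullet> ?g z \<partial>f t) = \<beta>1 t - \<beta>2 t" if "0 \<le> t" for t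
    unfolding \<beta>1_def \<beta>2_def
    by (subst Bochner_Integration.integral_diff[symmetric])
      (auto simp: drift_def inner_prod_def that intro!: integrable_continuous continuous_intros gc' force_continuous_snd)
  have "test_function ?h"
  proof (rule test_function_product[OF \<eta>(1) _ \<phi>])
    show "bounded {t. \<eta> t \<noteq> 0}"
      by (rule boundedI[of _ S]) (use \<eta>(5) in \<open>force simp: not_le[symmetric]\<close>)
  qed
  then have "(LBINT t:{0..}. \<integral>(r, v).
          deriv (\<lambda>s. ?h (s, r, v)) t +
          inner (v - mean_velocity f0) (grad (\<lambda>x. ?h (t, x, v)) r) \<partial>f t)
        + (\<integral>(r, v). ?h (0, r, v) \<partial>f0)
      = (LBINT t:{0..}. \<integral>(r, v).
          inner (\<integral>(r', v'). \<psi> (norm (r - r')) *\<^sub>R (v - v') - grad V (r' - r) \<partial>f t)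
                (grad (\<lambda>w. ?h (t, r, w)) v) \<partial>f t)" (is "?A + ?B = ?C")
    using solution unfolding mean_field_solution_def by blast
  moreover have "?A = (LBINT t:{0..}. \<eta>' t * m t + \<eta> t * \<beta>1 t)"
  proof (intro set_lebesgue_integral_cong ballI allI impI)
    fix t :: real assume t: "t \<in> {0..}"
    have d: "deriv (\<lambda>s. ?h (s, r, v)) t = \<eta>' t * \<phi> (r, v)" for r v
      by (rule DERIV_imp_deriv) (auto intro!: derivative_eq_intros \<eta>(2))
    have G: "grad (\<lambda>x. ?h (t, x, v)) r = \<eta> t *\<^sub>R fst (?g (r, v))" for r v
      by (rule grad_eqI) (simp add: GDERIV_scale GDERIV_Pair_partial(1)[OF g])
    have "(\<integral>z. \<eta>' t * \<phi> z + \<eta> t * ((snd z - v_mean) \<bullet> fst (?g z)) \<partial>f t)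
        = \<eta>' t * m t + \<eta> t * \<beta>1 t"
      unfolding m_def \<beta>1_def using t
      by (subst Bochner_Integration.integral_add)
        (auto intro!: integrable_continuous continuous_intros gc')
    then show "(\<integral>(r, v). deriv (\<lambda>s. ?h (s, r, v)) t +
          inner (v - mean_velocity f0) (grad (\<lambda>x. ?h (t, x, v)) r) \<partial>f t) = \<eta>' t * m t + \<eta> t * \<beta>1 t"
      unfolding d G by (simp add: case_prod_unfold v_mean_def)
  qed simp
  moreover have "?C = (LBINT t:{0..}. \<eta> t * \<beta>2 t)"
  proof (intro set_lebesgue_integral_cong ballI allI impI)
    fix t :: real assume t: "t \<in> {0..}"
    have G: "grad (\<lambda>w. ?h (t, r, w)) v = \<eta> t *\<^sub>R snd (?g (r, v))" for r v
      by (rule grad_eqI) (simp add: GDERIV_scale GDERIV_Pair_partial(2)[OF g])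
    show "(\<integral>(r, v). inner (\<integral>(r', v'). \<psi> (norm (r - r')) *\<^sub>R (v - v') - grad V (r' - r) \<partial>f t)
                (grad (\<lambda>w. ?h (t, r, w)) v) \<partial>f t) = \<eta> t * \<beta>2 t"
      unfolding G \<beta>2_def force_def by (simp add: case_prod_unfold)
  qed simp
  moreover have "?B = \<eta> 0 * m 0"
    by (simp add: m_def initial case_prod_unfold)
  moreover have "(LBINT t:{0..}. \<eta>' t * m t + \<eta> t * \<beta>1 t) = integral {0..S} (\<lambda>t. \<eta>' t * m t + \<eta> t * \<beta>1 t)"
    by (rule set_integral_eventually_0) (auto intro!: continuous_intros \<eta>c cont simp: \<eta>(5,6))
  moreover have "(LBINT t:{0..}. \<eta> t * \<beta>2 t) = integral {0..S} (\<lambda>t. \<eta> t * \<beta>2 t)"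
    by (rule set_integral_eventually_0) (auto intro!: continuous_intros \<eta>c cont simp: \<eta>(5,6))
  moreover have "integral {0..S} (\<lambda>t. (\<eta>' t * m t + \<eta> t * \<beta>1 t) - \<eta> t * \<beta>2 t)
      = integral {0..S} (\<lambda>t. \<eta>' t * m t + \<eta> t * \<beta>1 t) - integral {0..S} (\<lambda>t. \<eta> t * \<beta>2 t)"
    by (intro Henstock_Kurzweil_Integration.integral_diff integrable_continuous_interval continuous_intros \<eta>c
        continuous_on_subset[OF cont(1)] continuous_on_subset[OF cont(2)] continuous_on_subset[OF cont(3)]) auto
  moreover have "integral {0..S} (\<lambda>t. \<eta>' t * m t + \<eta> t * (\<integral>z. drift t z \<bullet> ?g z \<partial>f t))
      = integral {0..S} (\<lambda>t. (\<eta>' t * m t + \<eta> t * \<beta>1 t) - \<eta> t * \<beta>2 t)"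
    by (intro Henstock_Kurzweil_Integration.integral_cong) (simp add: \<beta> algebra_simps)
  ultimately show ?thesis
    by (simp add: m_def)
qed

lemma smooth_observable_integral:
  assumes \<phi>: "\<And>k. C_k k \<phi>" "bounded {z. \<phi> z \<noteq> 0}" and "0 \<le> T"
  shows "(\<integral>z. \<phi> z \<partial>f T) - (\<integral>z. \<phi> z \<partial>f 0) = integral {0..T} (\<lambda>t. \<integral>z. drift t z \<bullet> grad \<phi> z \<partial>f t)"
proof (rule weak_derivative_imp_integral[OF _ drift_integral_continuous[OF C_k_GDERIV(3)[OF \<phi>(1)]] _ \<open>0 \<le> T\<close>])
  show "continuous_on {0..} (\<lambda>t. \<integral>z. \<phi> z \<partial>f t)"
    by (rule continuous_on_integral)
      (auto simp: case_prod_unfold intro!: continuous_intros continuous_on_compose2[OF C_k_continuous[OF \<phi>(1)]])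
qed (rule weak_form[OF _ _ _ _ _ _ \<phi>])

text \<open>Up to time T all the measures live in one ball, on which the drift is bounded by some B.
  Replacing \<phi> by a smooth, compactly supported function that is \<delta>-close to it there,
  together with the gradient, costs \<delta> at each of the two endpoints and at most T * B *
  \<delta> in the time integral.\<close>

lemma observable_integral:
  assumes g: "\<And>z. GDERIV \<phi> z :> g z" and gc: "continuous_on UNIV g" and T: "0 \<le> T"
  shows "(\<integral>z. \<phi> z \<partial>f T) - (\<integral>z. \<phi> z \<partial>f 0) = integral {0..T} (\<lambda>t. \<integral>z. drift t z \<bullet> g z \<partial>f t)"
proof -
  have \<phi>c: "continuous_on UNIV \<phi>" by (rule GDERIV_continuous_on[OF g])
  obtain R where R: "R > 0" "\<And>t. t \<in> {0..T} \<Longrightarrow> AE z in f t. norm z \<le> R"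
    using uniformly_bounded_support by blast
  have "compact ((\<lambda>(t, z). drift t z) ` ({0..T} \<times> cball 0 R))"
    by (intro compact_continuous_image continuous_on_subset[OF drift_continuous] compact_Times) auto
  then obtain B where B: "\<And>t z. t \<in> {0..T} \<Longrightarrow> norm z \<le> R \<Longrightarrow> norm (drift t z) \<le> B"
    using bounded_iff[THEN iffD1, OF compact_imp_bounded] by fastforce
  have "norm (drift 0 0) \<le> B" using R T by (intro B) auto
  then have "0 \<le> B" using norm_ge_zero order_trans by blast
  let ?X = "(\<integral>z. \<phi> z \<partial>f T) - (\<integral>z. \<phi> z \<partial>f 0) - integral {0..T} (\<lambda>t. \<integral>z. drift t z \<bullet> g z \<partial>f t)"
  have bound: "\<bar>?X\<bar> \<le> (2 + T * B) * \<delta>" if \<delta>: "\<delta> > 0" for \<delta>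
  proof -
    obtain \<phi>' where \<phi>': "\<And>k. C_k k \<phi>'" "bounded {x. \<phi>' x \<noteq> 0}"
      and close: "\<And>x. norm x \<le> R \<Longrightarrow> \<bar>\<phi>' x - \<phi> x\<bar> \<le> \<delta>"
        "\<And>x. norm x \<le> R \<Longrightarrow> norm (grad \<phi>' x - g x) \<le> \<delta>"
      using C1_smooth_approximation[OF g gc \<delta>] by blast
    note \<phi>'c = C_k_continuous[OF \<phi>'(1)] and g'c = C_k_GDERIV(3)[OF \<phi>'(1)]
    have 1: "\<bar>(\<integral>z. \<phi>' z \<partial>f t) - (\<integral>z. \<phi> z \<partial>f t)\<bar> \<le> \<delta>" if t: "t \<in> {0..T}" for t
    proof -
      interpret p: prob_space "f t" using t by (simp add: prob_space)
      have "norm ((\<integral>z. \<phi>' z - \<phi> z \<partial>f t) - 0) \<le> \<delta>"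
        using t by (intro p.norm_integral_diff_le integrable_continuous continuous_intros \<phi>'c \<phi>c
            eventually_mono[OF R(2)[OF t]]) (auto intro: close)
      then show ?thesis using t by (simp add: integrable_continuous \<phi>'c \<phi>c)
    qed
    have 2: "norm ((\<integral>z. drift t z \<bullet> grad \<phi>' z \<partial>f t) - (\<integral>z. drift t z \<bullet> g z \<partial>f t)) \<le> B * \<delta>" if t: "t \<in> {0..T}" for t
    proof -
      interpret p: prob_space "f t" using t by (simp add: prob_space)
      have "norm ((\<integral>z. drift t z \<bullet> (grad \<phi>' z - g z) \<partial>f t) - 0) \<le> B * \<delta>"
      proof (intro p.norm_integral_diff_le integrable_continuous continuous_intros g'c gc drift_continuous_snd
            eventually_mono[OF R(2)[OF t]])
        fix z :: "'a \<times> 'a" assume z: "norm z \<le> R"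
        have "\<bar>drift t z \<bullet> (grad \<phi>' z - g z)\<bar> \<le> norm (drift t z) * norm (grad \<phi>' z - g z)"
          by (rule Cauchy_Schwarz_ineq2)
        also have "\<dots> \<le> B * \<delta>"
          using B[OF t z] close(2)[OF z] \<open>0 \<le> B\<close> by (intro mult_mono) auto
        finally show "norm (drift t z \<bullet> (grad \<phi>' z - g z) - 0) \<le> B * \<delta>" by simp
      qed (use t in auto)
      then show ?thesis using t
        by (simp add: inner_diff_right integrable_continuous continuous_on_inner drift_continuous_snd g'c gc)
    qed
    note c' = continuous_on_subset[OF drift_integral_continuous[OF g'c], of "{0..T}"]
      continuous_on_subset[OF drift_integral_continuous[OF gc], of "{0..T}"]
    have I1: "norm (integral {0..T} (\<lambda>t. (\<integral>z. drift t z \<bullet> grad \<phi>' z \<partial>f t) - (\<integral>z. drift t z \<bullet> g z \<partial>f t)))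
        \<le> B * \<delta> * (T - 0)"
      by (rule integral_bound) (use T 2 in \<open>auto intro!: continuous_intros c'\<close>)
    have I2: "integral {0..T} (\<lambda>t. (\<integral>z. drift t z \<bullet> grad \<phi>' z \<partial>f t) - (\<integral>z. drift t z \<bullet> g z \<partial>f t))
      = integral {0..T} (\<lambda>t. \<integral>z. drift t z \<bullet> grad \<phi>' z \<partial>f t) - integral {0..T} (\<lambda>t. \<integral>z. drift t z \<bullet> g z \<partial>f t)"
      by (intro Henstock_Kurzweil_Integration.integral_diff integrable_continuous_interval c') auto
    have I3: "(\<integral>z. \<phi>' z \<partial>f T) - (\<integral>z. \<phi>' z \<partial>f 0) = integral {0..T} (\<lambda>t. \<integral>z. drift t z \<bullet> grad \<phi>' z \<partial>f t)"
      by (rule smooth_observable_integral[OF \<phi>' T])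
    have arith: "\<bar>A - B' - C\<bar> \<le> (2 + T * B) * \<delta>"
      if "norm (C' - C) \<le> B * \<delta> * (T - 0)" "\<bar>A' - A\<bar> \<le> \<delta>" "\<bar>B'' - B'\<bar> \<le> \<delta>" "A' - B'' = C'"
      for A A' B' B'' C C' :: real
    proof -
      have "(2 + T * B) * \<delta> = 2 * \<delta> + B * \<delta> * (T - 0)" by (simp add: algebra_simps)
      with that show ?thesis unfolding real_norm_def by linarith
    qed
    show ?thesis
      by (rule arith[OF I1[unfolded I2] 1 1 I3]) (use T in auto)
  qed
  have "?X = 0"
  proof (rule ccontr)
    assume "?X \<noteq> 0"
    \<comment> \<open>With \<delta> = \<bar>X\<bar> / (2 c), where X is the discrepancy, the bound
      would read \<bar>X\<bar> \<le> \<bar>X\<bar> / 2.\<close>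
    define c where "c = 2 + T * B"
    have "c > 0" using T \<open>0 \<le> B\<close> by (simp add: c_def add_pos_nonneg)
    then have "\<bar>?X\<bar> \<le> c * (\<bar>?X\<bar> / (2 * c))"
      using bound[of "\<bar>?X\<bar> / (2 * c)"] \<open>?X \<noteq> 0\<close> by (simp add: c_def)
    then show False using \<open>c > 0\<close> \<open>?X \<noteq> 0\<close> by simp
  qed
  then show ?thesis by simp
qed

lemma observable_derivative:
  assumes "\<And>z. GDERIV \<phi> z :> g z" "continuous_on UNIV g" "0 \<le> t"
  shows "((\<lambda>t. \<integral>z. \<phi> z \<partial>f t) has_real_derivative (\<integral>z. drift t z \<bullet> g z \<partial>f t)) (at t within {0..})"
proof -
  let ?\<beta> = "\<lambda>t. \<integral>z. drift t z \<bullet> g z \<partial>f t"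
  \<comment> \<open>The interval ends at t + 1 so that t is not its right endpoint; near t it then
    agrees with the half-line. At t = 0 the derivative is one-sided.\<close>
  have "((\<lambda>s. (\<integral>z. \<phi> z \<partial>f 0) + integral {0..s} ?\<beta>) has_vector_derivative 0 + ?\<beta> t) (at t within {0..t + 1})"
    using assms by (intro has_vector_derivative_add integral_has_vector_derivative has_vector_derivative_const
        continuous_on_subset[OF drift_integral_continuous]) auto
  moreover have "at t within {0..t + 1} = at t within {0..}"
    by (rule at_within_nhd[of _ "{..<t+1}"]) (use assms in auto)
  ultimately have "((\<lambda>s. (\<integral>z. \<phi> z \<partial>f 0) + integral {0..s} ?\<beta>) has_real_derivative ?\<beta> t) (at t within {0..})"
    by (simp add: has_real_derivative_iff_has_vector_derivative)
  then show ?thesis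
  proof (rule has_field_derivative_transform_within[OF _ zero_less_one])
    show "(\<integral>z. \<phi> z \<partial>f 0) + integral {0..s} ?\<beta> = (\<integral>z. \<phi> z \<partial>f s)" if "s \<in> {0..}" for s
      using observable_integral[OF assms(1,2), of s] that by simp
  qed (use assms in simp)
qed

end

section \<open>Energy dissipation\<close>

lemma mvt_half_line:
  fixes g :: "real \<Rightarrow> real"
  assumes "\<And>t. 0 \<le> t \<Longrightarrow> (g has_real_derivative g' t) (at t within {0..})" "0 \<le> a" "a < b"
  obtains \<xi> where "a < \<xi>" "\<xi> < b" "g b - g a = (b - a) * g' \<xi>"
proof -
  have "\<exists>x\<in>{a<..<b}. g b - g a = g' x * (b - a)"
  proof (rule mvt_simple[OF \<open>a < b\<close>])
    fix x assume "a \<le> x" "x \<le> b"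
    then show "(g has_derivative (*) (g' x)) (at x within {a..b})"
      using assms(1)[of x] assms(2) unfolding has_field_derivative_def
      by (intro has_derivative_subset[where t="{a..b}" and s="{0..}"]) auto
  qed
  then show ?thesis using that by (auto simp: mult.commute)
qed

text \<open>A Barbalat-type argument with only an upper bound on K'. E decreases and is bounded
  below, so late windows of length \<tau> see almost no drop of E; by the mean value theorem K is
  then small at some point \<xi> of the window. From \<xi> to the right end of the window K gains at
  most \<tau> times the bound on K', which suffices because K is nonnegative.\<close>

lemma dissipation_tendsto_0:
  fixes E K :: "real \<Rightarrow> real"
  assumes E: "\<And>t. 0 \<le> t \<Longrightarrow> (E has_real_derivative E' t) (at t within {0..})"
    and K: "\<And>t. 0 \<le> t \<Longrightarrow> (K has_real_derivative K' t) (at t within {0..})"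
    and dissipation: "\<And>t. 0 \<le> t \<Longrightarrow> E' t \<le> - c * K t" and c: "c > 0"
    and K_nonneg: "\<And>t. 0 \<le> t \<Longrightarrow> 0 \<le> K t"
    and K'_le: "\<And>t. 0 \<le> t \<Longrightarrow> K' t \<le> L"
    and E_ge: "\<And>t. 0 \<le> t \<Longrightarrow> B \<le> E t"
  shows "(K \<longlongrightarrow> 0) at_top"
proof (rule tendstoI)
  fix e :: real assume e: "e > 0"
  \<comment> \<open>L may be nonpositive; \<open>L'\<close> is a positive bound by which one can
    divide in \<open>\<tau>\<close>.\<close>
  define L' where "L' = max L 1"
  have L': "L' > 0" "\<And>t. 0 \<le> t \<Longrightarrow> K' t \<le> L'"
    using K'_le by (auto simp: L'_def le_max_iff_disj)
  define \<tau> where "\<tau> = e / (3 * L')"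
  have \<tau>: "\<tau> > 0" using e L' by (simp add: \<tau>_def)
  have anti: "E t \<le> E s" if st: "0 \<le> s" "s \<le> t" for s t
  proof (cases "s = t")
    case False
    with st have "s < t" by simp
    obtain \<xi> where \<xi>: "s < \<xi>" "\<xi> < t" "E t - E s = (t - s) * E' \<xi>"
      using mvt_half_line[OF E st(1) \<open>s < t\<close>] by blast
    have "0 \<le> c * K \<xi>" using K_nonneg[of \<xi>] c \<xi> st by simp
    then have "E' \<xi> \<le> 0" using dissipation[of \<xi>] \<xi> st by simp
    then have "(t - s) * E' \<xi> \<le> 0" using \<xi> by (intro mult_nonneg_nonpos) auto
    with \<xi> show ?thesis by simp
  qed simp
  have bdd: "bdd_below (E ` {0..})" using E_ge by (auto intro!: bdd_belowI[of _ B])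
  define l where "l = Inf (E ` {0..})"
  have l: "l \<le> E t" if "0 \<le> t" for t
    unfolding l_def using that bdd by (intro cInf_lower) auto
  \<comment> \<open>A drop of E by less than this over a window of length \<tau> forces K below e /
    3 somewhere in it.\<close>
  define \<delta> where "\<delta> = c * \<tau> * e / 3"
  have \<delta>: "\<delta> > 0" using c \<tau> e by (simp add: \<delta>_def)
  have "\<exists>x\<in>E ` {0..}. x < l + \<delta>"
    unfolding l_def using bdd \<delta> by (intro cInf_lessD) (auto simp: l_def)
  then obtain t0 where t0: "0 \<le> t0" "E t0 < l + \<delta>" by auto
  have "dist (K t) 0 < e" if t: "t \<ge> t0 + \<tau>" for t
  proof -
    have t': "0 \<le> t - \<tau>" "t - \<tau> < t" "0 \<le> t" using t t0 \<tau> by auto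
    obtain \<xi> where \<xi>: "t - \<tau> < \<xi>" "\<xi> < t" "E t - E (t - \<tau>) = (t - (t - \<tau>)) * E' \<xi>"
      using mvt_half_line[OF E t'(1,2)] by blast
    have "c * K \<xi> \<le> - E' \<xi>" using dissipation[of \<xi>] \<xi> t' by auto
    then have "\<tau> * (c * K \<xi>) \<le> E (t - \<tau>) - E t"
      using mult_left_mono[of "c * K \<xi>" "- E' \<xi>" \<tau>] \<tau> \<xi>(3) by simp
    also have "\<dots> < \<delta>" using anti[of t0 "t - \<tau>"] t0 t l[of t] t' by linarith
    finally have "(c * \<tau>) * K \<xi> < (c * \<tau>) * (e / 3)" by (simp add: \<delta>_def algebra_simps)
    then have 1: "K \<xi> < e / 3" using c \<tau> by (simp add: mult_less_cancel_left_pos)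
    obtain \<zeta> where \<zeta>: "\<xi> < \<zeta>" "\<zeta> < t" "K t - K \<xi> = (t - \<xi>) * K' \<zeta>"
      using mvt_half_line[OF K _ \<xi>(2)] \<xi> t' by auto
    have "(t - \<xi>) * K' \<zeta> \<le> (t - \<xi>) * L'"
      using L'(2)[of \<zeta>] \<zeta> \<xi> t' by (intro mult_left_mono) auto
    also have "\<dots> \<le> \<tau> * L'" using \<xi> L' by (intro mult_right_mono) auto
    also have "\<dots> = e / 3" using L' by (simp add: \<tau>_def)
    finally show ?thesis using 1 \<zeta> K_nonneg[of t] t' e by simp
  qed
  then show "\<forall>\<^sub>F t in at_top. dist (K t) 0 < e"
    unfolding eventually_at_top_linorder by blast
qed

section \<open>Conservation of momentum and energy balance\<close>

context mean_field
begin

definition mean_gradV :: "real \<Rightarrow> 'a \<Rightarrow> 'a" where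
  "mean_gradV t r = (\<integral>z. grad V (r - fst z) \<partial>f t)"

definition mean_V :: "real \<Rightarrow> 'a \<Rightarrow> real" where
  "mean_V t r = (\<integral>z. V (r - fst z) \<partial>f t)"

definition kinetic :: "real \<Rightarrow> real" where
  "kinetic t = (\<integral>z. (norm (snd z - v_mean))\<^sup>2 \<partial>f t)"

definition potential :: "real \<Rightarrow> real" where
  "potential t = (\<integral>z. mean_V t (fst z) \<partial>f t)"

text \<open>\<open>s\<close> is the time of the measure that generates the field, \<open>t\<close>
  the time of the measure on which it acts. Keeping them apart allows the field to be frozen when
  differentiating in \<open>t\<close>.\<close>

definition interaction_power :: "real \<Rightarrow> real \<Rightarrow> real" where
  "interaction_power s t = (\<integral>z. (snd z - v_mean) \<bullet> mean_gradV s (fst z) \<partial>f t)"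

definition friction :: "real \<Rightarrow> real" where
  "friction t = (\<integral>z. \<integral>z'. \<psi> (norm (fst z - fst z')) * (norm (snd z - snd z'))\<^sup>2 \<partial>f t \<partial>f t)"

lemma mean_gradV_continuous: "continuous_on ({0..} \<times> UNIV) (\<lambda>(t, r). mean_gradV t r)"
  unfolding mean_gradV_def
  by (rule continuous_on_parametric_integral) (auto simp: case_prod_unfold intro!: continuous_intros)

lemma mean_V_continuous: "continuous_on ({0..} \<times> UNIV) (\<lambda>(t, r). mean_V t r)"
  unfolding mean_V_def
  by (rule continuous_on_parametric_integral) (auto simp: case_prod_unfold intro!: continuous_intros)

lemma mean_gradV_continuous_on [continuous_intros]:
  assumes "continuous_on A a" "continuous_on A b" "\<And>x. x \<in> A \<Longrightarrow> 0 \<le> a x"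
  shows "continuous_on A (\<lambda>x. mean_gradV (a x) (b x))"
  by (rule continuous_on_compose2[OF mean_gradV_continuous, of A "\<lambda>x. (a x, b x)", simplified])
    (use assms in \<open>auto intro!: continuous_intros\<close>)

lemma mean_V_continuous_on [continuous_intros]:
  assumes "continuous_on A a" "continuous_on A b" "\<And>x. x \<in> A \<Longrightarrow> 0 \<le> a x"
  shows "continuous_on A (\<lambda>x. mean_V (a x) (b x))"
  by (rule continuous_on_compose2[OF mean_V_continuous, of A "\<lambda>x. (a x, b x)", simplified])
    (use assms in \<open>auto intro!: continuous_intros\<close>)

lemma mean_V_GDERIV:
  assumes "0 \<le> t"
  shows "GDERIV (mean_V t) r :> mean_gradV t r"
proof -
  interpret compact_measure "f t" "supp (f t)" by (rule compact_measure[OF assms])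
  have "GDERIV (\<lambda>r. \<integral>z. V (r - fst z) \<partial>f t) r :> (\<integral>z. grad V (r - fst z) \<partial>f t)"
  proof (rule GDERIV_integral)
    show "GDERIV (\<lambda>x. V (x - fst z)) r :> grad V (r - fst z)" for r and z :: "'a \<times> 'a"
    proof -
      have "((\<lambda>x. x - fst z) has_derivative (\<lambda>h. h)) (at r)"
        by (auto intro!: derivative_eq_intros)
      then show ?thesis
        unfolding GDERIV_has_derivative
        by (rule has_derivative_compose) (use V_GDERIV in \<open>simp add: GDERIV_has_derivative\<close>)
    qed
  qed (auto simp: case_prod_unfold intro!: continuous_intros)
  then show ?thesis by (simp add: mean_V_def[abs_def] mean_gradV_def)
qed

lemma double_integral_swap:
  fixes u :: "'a \<times> 'a \<Rightarrow> 'a \<times> 'a \<Rightarrow> 'b::{banach, second_countable_topology}"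
  assumes "0 \<le> s" "0 \<le> t" "continuous_on UNIV (\<lambda>(z, z'). u z z')"
  shows "(\<integral>z. \<integral>z'. u z z' \<partial>f t \<partial>f s) = (\<integral>z. \<integral>z'. u z' z \<partial>f s \<partial>f t)"
  by (rule Fubini_continuous[OF compact_measure compact_measure]) (use assms in auto)

lemma inner_integral_continuous:
  fixes u :: "'a \<times> 'a \<Rightarrow> 'a \<times> 'a \<Rightarrow> 'b::{banach, second_countable_topology}"
  assumes "0 \<le> t" "continuous_on UNIV (\<lambda>(z, z'). u z z')"
  shows "continuous_on UNIV (\<lambda>z. \<integral>z'. u z z' \<partial>f t)" "continuous_on UNIV (u z)"
proof -
  have "continuous_on ({0..} \<times> UNIV) (\<lambda>p :: real \<times> ('a \<times> 'a) \<times> 'a \<times> 'a. (\<lambda>(z, z'). u z z') (snd p))"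
    by (rule continuous_on_compose2[OF assms(2)]) (auto intro: continuous_on_snd[OF continuous_on_id])
  then have "continuous_on ({0..} \<times> UNIV) (\<lambda>(t :: real, x, z). u x z)"
    by (simp add: case_prod_unfold)
  then have c: "continuous_on ({0..} \<times> UNIV) (\<lambda>(t, x). \<integral>z. u x z \<partial>f t)"
    by (rule continuous_on_parametric_integral[where u="\<lambda>t x z. u x z"])
  have "continuous_on UNIV (\<lambda>x :: 'a \<times> 'a. (t, x))" by (intro continuous_intros)
  from continuous_on_compose2[OF c this] assms(1)
  show "continuous_on UNIV (\<lambda>z. \<integral>z'. u z z' \<partial>f t)" by auto
  have "continuous_on UNIV (\<lambda>z'. (z, z'))" by (intro continuous_intros)
  from continuous_on_compose2[OF assms(2) this] show "continuous_on UNIV (u z)" by simp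
qed

lemma double_integral_antisym:
  fixes u :: "'a \<times> 'a \<Rightarrow> 'a \<times> 'a \<Rightarrow> real"
  assumes "0 \<le> t" "continuous_on UNIV (\<lambda>(z, z'). u z z')" "\<And>z z'. u z' z = - u z z'"
  shows "(\<integral>z. \<integral>z'. u z z' \<partial>f t \<partial>f t) = 0"
proof -
  have "(\<integral>z. \<integral>z'. u z z' \<partial>f t \<partial>f t) = (\<integral>z. \<integral>z'. u z' z \<partial>f t \<partial>f t)"
    by (rule double_integral_swap[OF assms(1,1,2)])
  also have "\<dots> = (\<integral>z. \<integral>z'. - u z z' \<partial>f t \<partial>f t)"
    by (intro Bochner_Integration.integral_cong refl assms(3))
  also have "\<dots> = - (\<integral>z. \<integral>z'. u z z' \<partial>f t \<partial>f t)"
    by simp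
  finally show ?thesis by simp
qed

text \<open>The time \<open>s\<close> is clipped to \<open>max 0 s\<close> in the proof because nothing is known about \<open>f\<close> at negative times.\<close>

lemma interaction_power_continuous: "continuous_on ({0..} \<times> {0..}) (\<lambda>(s, t). interaction_power s t)"
proof -
  have "continuous_on ({0..} \<times> UNIV) (\<lambda>(t, s). \<integral>z. (snd z - v_mean) \<bullet> mean_gradV (max 0 s) (fst z) \<partial>f t)"
    by (rule continuous_on_parametric_integral) (auto simp: case_prod_unfold intro!: continuous_intros)
  moreover have "continuous_on ({0..} \<times> {0..}) (\<lambda>p :: real \<times> real. (snd p, fst p))"
    by (intro continuous_intros)
  ultimately have "continuous_on ({0..} \<times> {0..}) (\<lambda>p. interaction_power (max 0 (fst p)) (snd p))"
    by (rule continuous_on_compose2[where f="\<lambda>p. (snd p, fst p)", THEN continuous_on_eq])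
      (auto simp: interaction_power_def)
  then show ?thesis
    by (rule continuous_on_eq) auto
qed

text \<open>V x - V(-x) has zero gradient by antisymmetry of \<open>grad V\<close> and vanishes at
  0. Evenness makes the cross potential of two times symmetric.\<close>

lemma V_even: "V (- x) = V x"
proof -
  have "((\<lambda>x. V x - V (- x)) has_derivative (\<lambda>h. 0)) (at x)" for x
  proof -
    have "(uminus has_derivative uminus) (at x)"
      by (auto intro!: derivative_eq_intros)
    then have "((\<lambda>x. V (- x)) has_derivative (\<lambda>h. (- h) \<bullet> grad V (- x))) (at x)"
      by (rule has_derivative_compose) (use V_GDERIV in \<open>simp add: GDERIV_has_derivative\<close>)
    from has_derivative_diff[OF V_GDERIV[of x, unfolded GDERIV_has_derivative] this]
    show ?thesis by (simp add: gradV_antisym)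
  qed
  then obtain c where "\<And>x. V x - V (- x) = c"
    using has_derivative_zero_constant[of UNIV "\<lambda>x. V x - V (- x)"] by auto
  from this[of x] this[of 0] show ?thesis by simp
qed

lemma force_eq:
  assumes "0 \<le> t"
  shows "force t z = (\<integral>z'. \<psi> (norm (fst z - fst z')) *\<^sub>R (snd z - snd z') \<partial>f t) + mean_gradV t (fst z)"
proof -
  have *: "- grad V (fst z' - fst z) = grad V (fst z - fst z')" for z'
    using gradV_antisym[of "fst z' - fst z"] by simp
  have "force t z = (\<integral>z'. \<psi> (norm (fst z - fst z')) *\<^sub>R (snd z - snd z') + grad V (fst z - fst z') \<partial>f t)"
    unfolding force_def *[symmetric] by simp
  then show ?thesis
    unfolding mean_gradV_def using assms
    by (subst (asm) Bochner_Integration.integral_add) (auto intro!: integrable_continuous continuous_intros)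
qed

text \<open>Action equals reaction: the integrand of the mean force is antisymmetric under exchange
  of the two particles, so its double integral vanishes. The argument is run by components because
  observables are real-valued.\<close>

lemma mean_velocity_conserved:
  assumes t: "0 \<le> t"
  shows "(\<integral>z. snd z \<partial>f t) = v_mean"
proof (rule euclidean_eqI)
  fix e :: 'a assume "e \<in> Basis"
  have deriv: "((\<lambda>t. \<integral>z. snd z \<bullet> e \<partial>f t) has_real_derivative 0) (at t within {0..})" if t: "0 \<le> t" for t
  proof -
    have "GDERIV (\<lambda>z. snd z \<bullet> e) z :> (0 :: 'a, e)" for z :: "'a \<times> 'a"
      unfolding GDERIV_has_derivative by (auto intro!: derivative_eq_intros simp: inner_prod_def)
    then have "((\<lambda>t. \<integral>z. snd z \<bullet> e \<partial>f t) has_real_derivative (\<integral>z. drift t z \<bullet> (0, e) \<partial>f t)) (at t within {0..})"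
      by (rule observable_derivative) (auto intro: t)
    moreover have "(\<integral>z. drift t z \<bullet> (0, e) \<partial>f t) = 0"
    proof -
      have "force t z \<bullet> e = (\<integral>z'. (\<psi> (norm (fst z - fst z')) *\<^sub>R (snd z - snd z') - grad V (fst z' - fst z)) \<bullet> e \<partial>f t)" for z
        unfolding force_def
        by (intro integral_inner_left[symmetric] integrable_continuous t) (auto intro!: continuous_intros)
      moreover have "(\<integral>z. (\<integral>z'. (\<psi> (norm (fst z - fst z')) *\<^sub>R (snd z - snd z') - grad V (fst z' - fst z)) \<bullet> e \<partial>f t) \<partial>f t) = 0"
      proof (rule double_integral_antisym[OF t])
        fix z z' :: "'a \<times> 'a"
        have "grad V (fst z - fst z') = - grad V (fst z' - fst z)"
          using gradV_antisym[of "fst z' - fst z"] by simp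
        then show "(\<psi> (norm (fst z' - fst z)) *\<^sub>R (snd z' - snd z) - grad V (fst z - fst z')) \<bullet> e
          = - ((\<psi> (norm (fst z - fst z')) *\<^sub>R (snd z - snd z') - grad V (fst z' - fst z)) \<bullet> e)"
          by (simp add: norm_minus_commute inner_diff_left algebra_simps)
      qed (auto simp: case_prod_unfold intro!: continuous_intros)
      ultimately show ?thesis by (simp add: drift_def inner_prod_def)
    qed
    ultimately show ?thesis by simp
  qed
  then obtain c where c: "\<And>t. 0 \<le> t \<Longrightarrow> (\<integral>z. snd z \<bullet> e \<partial>f t) = c"
    using has_field_derivative_zero_constant[of "{0..}" "\<lambda>t. \<integral>z. snd z \<bullet> e \<partial>f t"] by auto
  have "(\<integral>z. snd z \<bullet> e \<partial>f t) = (\<integral>z. snd z \<partial>f t) \<bullet> e" if "0 \<le> t" for t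
    by (intro integral_inner_left integrable_continuous that) (auto intro!: continuous_intros)
  with c[of t] c[of 0] t have "(\<integral>z. snd z \<partial>f t) \<bullet> e = (\<integral>z. snd z \<partial>f 0) \<bullet> e" by simp
  then show "(\<integral>z. snd z \<partial>f t) \<bullet> e = v_mean \<bullet> e"
    by (simp add: v_mean_def mean_velocity_def initial case_prod_unfold)
qed

lemma kinetic_derivative:
  assumes t: "0 \<le> t"
  shows "(kinetic has_real_derivative - friction t - 2 * interaction_power t t) (at t within {0..})"
proof -
  let ?w = "\<lambda>z. snd z - v_mean"
  let ?a = "\<lambda>z z'. \<psi> (norm (fst z - fst z')) *\<^sub>R (snd z - snd z')"
  have "GDERIV (\<lambda>z. (norm (?w z))\<^sup>2) z :> (0 :: 'a, 2 *\<^sub>R ?w z)" for z :: "'a \<times> 'a"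
    unfolding GDERIV_has_derivative power2_norm_eq_inner
    by (auto intro!: derivative_eq_intros simp: inner_prod_def inner_commute)
  then have "(kinetic has_real_derivative (\<integral>z. drift t z \<bullet> (0, 2 *\<^sub>R ?w z) \<partial>f t)) (at t within {0..})"
    unfolding kinetic_def by (rule observable_derivative) (auto intro!: t continuous_intros)
  moreover have "(\<integral>z. drift t z \<bullet> (0, 2 *\<^sub>R ?w z) \<partial>f t) = - friction t - 2 * interaction_power t t"
  proof -
    have ac: "continuous_on UNIV (\<lambda>z. \<integral>z'. ?a z z' \<partial>f t)"
      by (rule inner_integral_continuous[OF t]) (auto simp: case_prod_unfold intro!: continuous_intros)
    have "(\<integral>z. drift t z \<bullet> (0, 2 *\<^sub>R ?w z) \<partial>f t)
        = (\<integral>z. - 2 * ((\<integral>z'. ?a z z' \<partial>f t) \<bullet> ?w z) - 2 * (?w z \<bullet> mean_gradV t (fst z)) \<partial>f t)"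
      by (simp add: drift_def inner_prod_def force_eq[OF t] inner_left_distrib inner_commute algebra_simps)
    also have "\<dots> = - 2 * (\<integral>z. (\<integral>z'. ?a z z' \<partial>f t) \<bullet> ?w z \<partial>f t) - 2 * interaction_power t t"
      unfolding interaction_power_def using t
      by (subst Bochner_Integration.integral_diff) (auto intro!: integrable_continuous continuous_intros ac)
    finally have A: "(\<integral>z. drift t z \<bullet> (0, 2 *\<^sub>R ?w z) \<partial>f t)
        = - 2 * (\<integral>z. (\<integral>z'. ?a z z' \<partial>f t) \<bullet> ?w z \<partial>f t) - 2 * interaction_power t t" .
    have B: "(\<integral>z. (\<integral>z'. ?a z z' \<partial>f t) \<bullet> ?w z \<partial>f t) = (\<integral>z. (\<integral>z'. ?a z z' \<bullet> ?w z \<partial>f t) \<partial>f t)"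
      by (intro Bochner_Integration.integral_cong refl integral_inner_left[symmetric] integrable_continuous t)
        (auto intro!: continuous_intros)
    \<comment> \<open>Symmetrisation: \<open>?a\<close> changes sign when the particles are
      exchanged, so twice the integral of a \<bullet> w is the integral of a \<bullet> (w - w'), and
      w - w' is the difference of the velocities.\<close>
    have C: "2 * (\<integral>z. (\<integral>z'. ?a z z' \<bullet> ?w z \<partial>f t) \<partial>f t) = friction t"
    proof -
      have c: "continuous_on UNIV (\<lambda>(z, z'). ?a z z' \<bullet> ?w z)" "continuous_on UNIV (\<lambda>(z, z'). ?a z' z \<bullet> ?w z')"
        by (auto simp: case_prod_unfold intro!: continuous_intros)
      note i = inner_integral_continuous[OF t c(1)] inner_integral_continuous[OF t c(2)]
      have "(\<integral>z. (\<integral>z'. ?a z z' \<bullet> ?w z \<partial>f t) \<partial>f t) = (\<integral>z. (\<integral>z'. ?a z' z \<bullet> ?w z' \<partial>f t) \<partial>f t)"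
        by (rule double_integral_swap[OF t t c(1)])
      then have "2 * (\<integral>z. (\<integral>z'. ?a z z' \<bullet> ?w z \<partial>f t) \<partial>f t)
          = (\<integral>z. (\<integral>z'. ?a z z' \<bullet> ?w z \<partial>f t) \<partial>f t) + (\<integral>z. (\<integral>z'. ?a z' z \<bullet> ?w z' \<partial>f t) \<partial>f t)"
        by simp
      also have "\<dots> = (\<integral>z. (\<integral>z'. ?a z z' \<bullet> ?w z \<partial>f t) + (\<integral>z'. ?a z' z \<bullet> ?w z' \<partial>f t) \<partial>f t)"
        by (intro Bochner_Integration.integral_add[symmetric] integrable_continuous t i)
      also have "\<dots> = (\<integral>z. (\<integral>z'. ?a z z' \<bullet> ?w z + ?a z' z \<bullet> ?w z' \<partial>f t) \<partial>f t)"
        by (intro Bochner_Integration.integral_cong refl Bochner_Integration.integral_add[symmetric] integrable_continuous t i)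
      also have "\<dots> = friction t"
        unfolding friction_def power2_norm_eq_inner
        by (simp add: norm_minus_commute inner_diff_left inner_diff_right inner_commute algebra_simps)
      finally show ?thesis .
    qed
    show ?thesis unfolding A B using C by simp
  qed
  ultimately show ?thesis by simp
qed

text \<open>With the field frozen at time \<open>s\<close>, \<open>mean_V s\<close> is a fixed C^1
  observable of position, so only the transport part of the drift contributes.\<close>

lemma cross_potential_derivative:
  assumes "0 \<le> s" "0 \<le> t"
  shows "((\<lambda>t. \<integral>z. mean_V s (fst z) \<partial>f t) has_real_derivative interaction_power s t) (at t within {0..})"
proof -
  have "GDERIV (\<lambda>z. mean_V s (fst z)) z :> (mean_gradV s (fst z), 0 :: 'a)" for z :: "'a \<times> 'a"
  proof -
    have "((\<lambda>z. mean_V s (fst z)) has_derivative (\<lambda>h. fst h \<bullet> mean_gradV s (fst z))) (at z)"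
      by (rule has_derivative_compose[OF has_derivative_fst[OF has_derivative_ident]
            mean_V_GDERIV[OF assms(1), unfolded GDERIV_has_derivative]])
    then show ?thesis by (simp add: GDERIV_has_derivative inner_prod_def)
  qed
  then have "((\<lambda>t. \<integral>z. mean_V s (fst z) \<partial>f t) has_real_derivative
      (\<integral>z. drift t z \<bullet> (mean_gradV s (fst z), 0) \<partial>f t)) (at t within {0..})"
    by (rule observable_derivative) (auto intro!: assms continuous_intros)
  then show ?thesis by (simp add: interaction_power_def drift_def inner_prod_def)
qed

lemma cross_potential_sym:
  assumes "0 \<le> s" "0 \<le> t"
  shows "(\<integral>z. mean_V s (fst z) \<partial>f t) = (\<integral>z. mean_V t (fst z) \<partial>f s)"
proof -
  have "V (fst z' - fst z) = V (fst z - fst z')" for z z' :: "'a \<times> 'a"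
    using V_even[of "fst z - fst z'"] by simp
  then show ?thesis
    unfolding mean_V_def using assms
    by (subst double_integral_swap) (auto simp: case_prod_unfold intro!: continuous_intros)
qed

text \<open>By symmetry of the cross terms, \<open>potential s - potential t\<close> is the sum over \<open>a \<in> {s, t}\<close> of the
  increments of the integral of the fixed observable \<open>mean_V a\<close>.\<close>

lemma potential_derivative:
  assumes t: "0 \<le> t"
  shows "(potential has_real_derivative 2 * interaction_power t t) (at t within {0..})"
  unfolding has_field_derivative_iff
proof (rule tendstoI)
  fix e :: real assume e: "e > 0"
  obtain d where d: "d > 0" "\<And>p. p \<in> {0..} \<times> {0..} \<Longrightarrow> dist p (t, t) < d \<Longrightarrow>
      dist (interaction_power (fst p) (snd p)) (interaction_power t t) < e / 2"
    using interaction_power_continuous[unfolded continuous_on_iff, rule_format, of "(t, t)" "e / 2"] e t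
    by (auto simp: case_prod_unfold)
  have close: "\<bar>interaction_power a b - interaction_power t t\<bar> < e / 2"
    if "0 \<le> a" "0 \<le> b" "\<bar>a - t\<bar> < d / 2" "\<bar>b - t\<bar> < d / 2" for a b
  proof -
    have "dist (a, b) (t, t) \<le> \<bar>a - t\<bar> + \<bar>b - t\<bar>"
      unfolding dist_Pair_Pair dist_real_def by (rule sqrt_sum_squares_le_sum) auto
    then show ?thesis using d(2)[of "(a, b)"] that by (simp add: dist_real_def)
  qed
  have mvt: "\<exists>\<xi>\<ge>0. \<bar>\<xi> - t\<bar> < \<bar>s - t\<bar> \<and>
      (\<integral>z. mean_V a (fst z) \<partial>f s) - (\<integral>z. mean_V a (fst z) \<partial>f t) = (s - t) * interaction_power a \<xi>"
    if "0 \<le> a" "0 \<le> s" "s \<noteq> t" for a s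
  proof (cases "t < s")
    case True
    show ?thesis
    proof (rule mvt_half_line[OF cross_potential_derivative[OF that(1)] t True])
      fix \<xi> assume "t < \<xi>" "\<xi> < s"
        "(\<integral>z. mean_V a (fst z) \<partial>f s) - (\<integral>z. mean_V a (fst z) \<partial>f t) = (s - t) * interaction_power a \<xi>"
      then show ?thesis using t by (intro exI[of _ \<xi>]) auto
    qed
  next
    case False
    then have "s < t" using that by simp
    show ?thesis
    proof (rule mvt_half_line[OF cross_potential_derivative[OF that(1)] that(2) \<open>s < t\<close>])
      fix \<xi> assume "s < \<xi>" "\<xi> < t"
        "(\<integral>z. mean_V a (fst z) \<partial>f t) - (\<integral>z. mean_V a (fst z) \<partial>f s) = (t - s) * interaction_power a \<xi>"
      then show ?thesis using that by (intro exI[of _ \<xi>]) (auto simp: algebra_simps)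
    qed
  qed
  have "dist ((potential s - potential t) / (s - t)) (2 * interaction_power t t) < e"
    if s: "s \<in> {0..}" "s \<noteq> t" "dist s t < d / 2" for s
  proof -
    obtain \<xi> where \<xi>: "\<xi> \<ge> 0" "\<bar>\<xi> - t\<bar> < \<bar>s - t\<bar>"
      "(\<integral>z. mean_V s (fst z) \<partial>f s) - (\<integral>z. mean_V s (fst z) \<partial>f t) = (s - t) * interaction_power s \<xi>"
      using mvt[of s s] s by auto
    obtain \<zeta> where \<zeta>: "\<zeta> \<ge> 0" "\<bar>\<zeta> - t\<bar> < \<bar>s - t\<bar>"
      "(\<integral>z. mean_V t (fst z) \<partial>f s) - (\<integral>z. mean_V t (fst z) \<partial>f t) = (s - t) * interaction_power t \<zeta>"
      using mvt[of t s] s t by auto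
    have "potential s - potential t = (s - t) * (interaction_power s \<xi> + interaction_power t \<zeta>)"
      using \<xi>(3) \<zeta>(3) cross_potential_sym[of s t] s t by (simp add: potential_def algebra_simps)
    then have "(potential s - potential t) / (s - t) = interaction_power s \<xi> + interaction_power t \<zeta>"
      using s by simp
    moreover have "\<bar>interaction_power s \<xi> - interaction_power t t\<bar> < e / 2"
      by (rule close) (use s \<xi> in \<open>auto simp: dist_real_def\<close>)
    moreover have "\<bar>interaction_power t \<zeta> - interaction_power t t\<bar> < e / 2"
      by (rule close) (use s \<zeta> t d in \<open>auto simp: dist_real_def\<close>)
    ultimately show ?thesis unfolding dist_real_def by linarith
  qed
  then show "\<forall>\<^sub>F s in at t within {0..}. dist ((potential s - potential t) / (s - t)) (2 * interaction_power t t) < e"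
    unfolding eventually_at using d by (intro exI[of _ "d / 2"]) auto
qed

end

section \<open>Decay of the kinetic energy\<close>

lemma abs_inner_unit_le: "norm e = 1 \<Longrightarrow> \<bar>x \<bullet> e\<bar> \<le> norm x"
  using Cauchy_Schwarz_ineq2[of x e] by simp

lemma (in Winf_curve) norm_integral_le:
  fixes u :: "'a \<Rightarrow> 'b::{banach, second_countable_topology}"
  assumes "0 \<le> t" "continuous_on UNIV u" "continuous_on UNIV v" "\<And>z. norm (u z) \<le> v z"
  shows "norm (\<integral>z. u z \<partial>f t) \<le> (\<integral>z. v z \<partial>f t)"
  by (rule Bochner_Integration.integral_norm_bound_integral)
    (use assms in \<open>auto intro: integrable_continuous\<close>)

lemma (in Winf_curve) norm_integral_le_const:
  fixes u :: "'a \<Rightarrow> 'b::{banach, second_countable_topology}"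
  assumes "0 \<le> t" "continuous_on UNIV u" "\<And>z. norm (u z) \<le> c"
  shows "norm (\<integral>z. u z \<partial>f t) \<le> c"
  using norm_integral_le[OF assms(1,2) continuous_on_const assms(3)]
    prob_space.prob_space[OF prob_space[OF assms(1)]] by simp

locale dissipative_mean_field = mean_field +
  fixes C \<psi>_low \<psi>_up V_low :: real
  assumes gradV_bound: "norm (grad V x) \<le> C"
    and \<psi>_low_pos: "0 < \<psi>_low"
    and \<psi>_low: "0 \<le> q \<Longrightarrow> \<psi>_low \<le> \<psi> q"
    and \<psi>_up: "0 \<le> q \<Longrightarrow> \<psi> q \<le> \<psi>_up"
    and V_low: "V_low \<le> V x"
begin

definition speed :: "real \<Rightarrow> real" where
  "speed t = (\<integral>z. norm (snd z - v_mean) \<partial>f t)"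

lemma C_nonneg: "0 \<le> C"
  using gradV_bound[of 0] norm_ge_zero order_trans by blast

lemma \<psi>_up_nonneg: "0 \<le> \<psi>_up"
  using \<psi>_low[of 0] \<psi>_up[of 0] \<psi>_low_pos by simp

lemma mean_gradV_bound: "0 \<le> t \<Longrightarrow> norm (mean_gradV t r) \<le> C"
  unfolding mean_gradV_def by (rule norm_integral_le_const) (auto intro!: continuous_intros gradV_bound)

lemma speed_nonneg: "0 \<le> speed t"
  unfolding speed_def by (rule Bochner_Integration.integral_nonneg) simp

lemma kinetic_nonneg: "0 \<le> kinetic t"
  unfolding kinetic_def by (rule Bochner_Integration.integral_nonneg) simp

text \<open>Nonnegativity of the variance of the norm of v - \<open>v_mean\<close>.\<close>

lemma speed_square_le:
  assumes t: "0 \<le> t"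
  shows "(speed t)\<^sup>2 \<le> kinetic t"
proof -
  let ?w = "\<lambda>z. norm (snd z - v_mean)"
  interpret prob_space "f t" by (rule prob_space[OF t])
  have "0 \<le> (\<integral>z. (?w z - speed t)\<^sup>2 \<partial>f t)" by simp
  also have "\<dots> = (\<integral>z. ((?w z)\<^sup>2 - 2 * speed t * ?w z) + (speed t)\<^sup>2 \<partial>f t)"
    by (simp add: power2_eq_square algebra_simps)
  also have "\<dots> = kinetic t - 2 * speed t * speed t + (speed t)\<^sup>2"
    unfolding kinetic_def speed_def
    by (subst Bochner_Integration.integral_add Bochner_Integration.integral_diff;
        (intro integrable_continuous t continuous_intros)?)+
      (simp add: prob_space)
  finally show ?thesis by (simp add: power2_eq_square)
qed

lemma interaction_power_bound:
  assumes "0 \<le> s" "0 \<le> t"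
  shows "\<bar>interaction_power s t\<bar> \<le> C * speed t"
proof -
  have "norm (interaction_power s t) \<le> (\<integral>z. C * norm (snd z - v_mean) \<partial>f t)"
    unfolding interaction_power_def
  proof (rule norm_integral_le)
    fix z :: "'a \<times> 'a"
    have "\<bar>(snd z - v_mean) \<bullet> mean_gradV s (fst z)\<bar> \<le> norm (snd z - v_mean) * norm (mean_gradV s (fst z))"
      by (rule Cauchy_Schwarz_ineq2)
    also have "\<dots> \<le> norm (snd z - v_mean) * C"
      by (intro mult_left_mono mean_gradV_bound assms) simp
    finally show "norm ((snd z - v_mean) \<bullet> mean_gradV s (fst z)) \<le> C * norm (snd z - v_mean)"
      by (simp add: mult.commute)
  qed (auto intro!: assms continuous_intros)
  then show ?thesis by (simp add: speed_def)
qed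

text \<open>The cross term in the expanded square integrates to 0 because \<open>v_mean\<close> is
  still the mean velocity at time t; each of the two variables contributes one kinetic
  energy.\<close>

lemma velocity_spread:
  assumes t: "0 \<le> t"
  shows "(\<integral>z. \<integral>z'. (norm (snd z - snd z'))\<^sup>2 \<partial>f t \<partial>f t) = 2 * kinetic t"
proof -
  let ?w = "\<lambda>z. snd z - v_mean"
  interpret prob_space "f t" by (rule prob_space[OF t])
  have w0: "(\<integral>z. ?w z \<partial>f t) = 0"
    using mean_velocity_conserved[OF t]
    by (subst Bochner_Integration.integral_diff) (auto simp: prob_space intro!: integrable_continuous t continuous_intros)
  have "(\<integral>z'. (norm (snd z - snd z'))\<^sup>2 \<partial>f t) = (norm (?w z))\<^sup>2 + kinetic t" for z :: "'a \<times> 'a"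
  proof -
    have "(\<integral>z'. (norm (snd z - snd z'))\<^sup>2 \<partial>f t)
        = (\<integral>z'. (norm (?w z))\<^sup>2 + ((norm (?w z'))\<^sup>2 - 2 * (?w z \<bullet> ?w z')) \<partial>f t)"
      unfolding power2_norm_eq_inner
      by (intro Bochner_Integration.integral_cong refl) (simp add: inner_diff_left inner_diff_right inner_commute)
    also have "\<dots> = (norm (?w z))\<^sup>2 + (kinetic t - 2 * (?w z \<bullet> (\<integral>z'. ?w z' \<partial>f t)))"
      unfolding kinetic_def
      by (subst Bochner_Integration.integral_add Bochner_Integration.integral_diff integral_inner_right[symmetric];
          (intro integrable_continuous t continuous_intros)?)+
        (simp add: prob_space)
    finally show ?thesis by (simp add: w0)
  qed
  then have "(\<integral>z. \<integral>z'. (norm (snd z - snd z'))\<^sup>2 \<partial>f t \<partial>f t) = (\<integral>z. (norm (?w z))\<^sup>2 + kinetic t \<partial>f t)"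
    by simp
  also have "\<dots> = 2 * kinetic t"
    by (subst Bochner_Integration.integral_add)
      (auto intro!: integrable_continuous t continuous_intros simp: prob_space kinetic_def)
  finally show ?thesis .
qed

lemma friction_ge:
  assumes t: "0 \<le> t"
  shows "2 * \<psi>_low * kinetic t \<le> friction t"
proof -
  have c: "continuous_on UNIV (\<lambda>(z, z'). \<psi>_low * (norm (snd z - snd z'))\<^sup>2)"
    "continuous_on UNIV (\<lambda>(z, z'). \<psi> (norm (fst z - fst z')) * (norm (snd z - snd z'))\<^sup>2)"
    by (auto simp: case_prod_unfold intro!: continuous_intros)
  note i = inner_integral_continuous[OF t c(1)] inner_integral_continuous[OF t c(2)]
  have "(\<integral>z. \<integral>z'. \<psi>_low * (norm (snd z - snd z'))\<^sup>2 \<partial>f t \<partial>f t) \<le> friction t"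
    unfolding friction_def
    by (intro integral_mono integrable_continuous t i mult_right_mono \<psi>_low) auto
  then show ?thesis using velocity_spread[OF t] by simp
qed

lemma potential_ge:
  assumes t: "0 \<le> t"
  shows "V_low \<le> potential t"
proof -
  interpret prob_space "f t" by (rule prob_space[OF t])
  have "(\<integral>z. V_low \<partial>f t) \<le> mean_V t r" for r
    unfolding mean_V_def
    by (intro integral_mono integrable_continuous t continuous_intros V_low)
  then have "(\<integral>z. V_low \<partial>f t) \<le> potential t"
    unfolding potential_def using t
    by (intro integral_mono integrable_continuous continuous_intros) (auto simp: prob_space)
  then show ?thesis by (simp add: prob_space)
qed

text \<open>The interaction power enters the two derivatives with opposite signs and
  cancels.\<close>

lemma energy_derivative:
  assumes "0 \<le> t"
  shows "((\<lambda>t. kinetic t + potential t) has_real_derivative - friction t) (at t within {0..})"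
  using DERIV_add[OF kinetic_derivative[OF assms] potential_derivative[OF assms]] by simp

lemma kinetic_tendsto_0: "(kinetic \<longlongrightarrow> 0) at_top"
proof (rule dissipation_tendsto_0[OF energy_derivative kinetic_derivative])
  \<comment> \<open>Initial energy above the lowest possible potential energy. It bounds the kinetic
    energy at all times, hence the mean speed by 1 + M, which bounds the interaction power.\<close>
  define M where "M = \<bar>kinetic 0 + potential 0 - V_low\<bar>"
  show "- friction t \<le> - (2 * \<psi>_low) * kinetic t" if "0 \<le> t" for t
    using friction_ge[OF that] by simp
  have friction_nonneg: "0 \<le> friction t" if "0 \<le> t" for t
    using friction_ge[OF that] kinetic_nonneg[of t] \<psi>_low_pos
    by (meson mult_nonneg_nonneg order_trans zero_le_numeral less_imp_le)
  have M: "kinetic t \<le> M" if "0 \<le> t" for t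
  proof (cases "t = 0")
    case True
    then show ?thesis using potential_ge[of 0] by (simp add: M_def)
  next
    case False
    with that have "0 < t" by simp
    obtain \<xi> where "0 < \<xi>" "(kinetic t + potential t) - (kinetic 0 + potential 0) = (t - 0) * - friction \<xi>"
      using mvt_half_line[OF energy_derivative order_refl \<open>0 < t\<close>] by metis
    moreover have "0 \<le> t * friction \<xi>" using \<open>0 < t\<close> \<open>0 < \<xi>\<close> friction_nonneg by simp
    ultimately show ?thesis using potential_ge[OF that] by (simp add: M_def)
  qed
  show "- friction t - 2 * interaction_power t t \<le> 2 * C * (1 + M)" if t: "0 \<le> t" for t
  proof -
    have "speed t \<le> 1 + M"
    proof (cases "speed t \<le> 1")
      case True
      then show ?thesis by (simp add: M_def)
    next
      case False
      then have "speed t \<le> (speed t)\<^sup>2" by (simp add: power2_eq_square)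
      then show ?thesis using speed_square_le[OF t] M[OF t] by linarith
    qed
    then have "C * speed t \<le> C * (1 + M)" by (intro mult_left_mono C_nonneg)
    then show ?thesis using interaction_power_bound[OF t t] friction_nonneg[OF t] by linarith
  qed
  show "V_low \<le> kinetic t + potential t" if "0 \<le> t" for t
    using potential_ge[OF that] kinetic_nonneg[of t] by linarith
qed (use \<psi>_low_pos kinetic_nonneg in auto)

lemma speed_tendsto_0: "(speed \<longlongrightarrow> 0) at_top"
proof (rule tendsto_sandwich[OF _ _ tendsto_const])
  show "\<forall>\<^sub>F t in at_top. speed t \<le> sqrt (kinetic t)"
    using eventually_ge_at_top[of 0] by eventually_elim (simp add: real_le_rsqrt speed_square_le)
  show "((\<lambda>t. sqrt (kinetic t)) \<longlongrightarrow> 0) at_top"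
    using tendsto_real_sqrt[OF kinetic_tendsto_0] by simp
qed (simp add: speed_nonneg)

section \<open>Difference quotients of the mean potential\<close>

lemma mean_V_time_derivative:
  assumes "0 \<le> t"
  shows "((\<lambda>t. mean_V t r) has_real_derivative
    (\<integral>z. - ((snd z - v_mean) \<bullet> grad V (r - fst z)) \<partial>f t)) (at t within {0..})"
proof -
  have "GDERIV (\<lambda>z. V (r - fst z)) z :> (- grad V (r - fst z), 0 :: 'a)" for z :: "'a \<times> 'a"
  proof -
    have "((\<lambda>z. r - fst z) has_derivative (\<lambda>h. - fst h)) (at z)"
      by (auto intro!: derivative_eq_intros)
    then have "((\<lambda>z. V (r - fst z)) has_derivative (\<lambda>h. (- fst h) \<bullet> grad V (r - fst z))) (at z)"
      by (rule has_derivative_compose) (use V_GDERIV in \<open>simp add: GDERIV_has_derivative\<close>)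
    then show ?thesis by (simp add: GDERIV_has_derivative inner_prod_def)
  qed
  then have "((\<lambda>t. \<integral>z. V (r - fst z) \<partial>f t) has_real_derivative
      (\<integral>z. drift t z \<bullet> (- grad V (r - fst z), 0) \<partial>f t)) (at t within {0..})"
    by (rule observable_derivative) (auto intro!: assms continuous_intros)
  then show ?thesis by (simp add: mean_V_def[abs_def] drift_def inner_prod_def)
qed

text \<open>Stands in for \<open>mean_gradV t r \<bullet> e\<close>. Being assembled from values of
  \<open>mean_V\<close>, it can be differentiated in position and in time without a second
  derivative of \<open>V\<close>; the price is a factor 1 / \<epsilon> in these derivatives.\<close>

definition quot :: "'a \<Rightarrow> real \<Rightarrow> real \<Rightarrow> 'a \<Rightarrow> real" where
  "quot e \<epsilon> t r = (mean_V t (r + \<epsilon> *\<^sub>R e) - mean_V t r) / \<epsilon>"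

definition quot_grad :: "'a \<Rightarrow> real \<Rightarrow> real \<Rightarrow> 'a \<Rightarrow> 'a" where
  "quot_grad e \<epsilon> t r = (1 / \<epsilon>) *\<^sub>R (mean_gradV t (r + \<epsilon> *\<^sub>R e) - mean_gradV t r)"

lemma quot_continuous_on [continuous_intros]:
  "continuous_on A b \<Longrightarrow> 0 \<le> t \<Longrightarrow> continuous_on A (\<lambda>x. quot e \<epsilon> t (b x))"
  "continuous_on A b \<Longrightarrow> 0 \<le> t \<Longrightarrow> continuous_on A (\<lambda>x. quot_grad e \<epsilon> t (b x))"
  unfolding quot_def quot_grad_def divide_inverse by (auto intro!: continuous_intros)

lemma quot_GDERIV:
  assumes "0 \<le> t"
  shows "GDERIV (quot e \<epsilon> t) r :> quot_grad e \<epsilon> t r"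
proof -
  have "((\<lambda>r. r + \<epsilon> *\<^sub>R e) has_derivative (\<lambda>h. h)) (at r)"
    by (auto intro!: derivative_eq_intros)
  from has_derivative_compose[OF this mean_V_GDERIV[OF assms, unfolded GDERIV_has_derivative]]
  have "((\<lambda>r. mean_V t (r + \<epsilon> *\<^sub>R e)) has_derivative (\<lambda>h. h \<bullet> mean_gradV t (r + \<epsilon> *\<^sub>R e))) (at r)" .
  from has_derivative_diff[OF this mean_V_GDERIV[OF assms, of r, unfolded GDERIV_has_derivative]]
  have "((\<lambda>r. (1 / \<epsilon>) * (mean_V t (r + \<epsilon> *\<^sub>R e) - mean_V t r)) has_derivative
      (\<lambda>h. (1 / \<epsilon>) * (h \<bullet> mean_gradV t (r + \<epsilon> *\<^sub>R e) - h \<bullet> mean_gradV t r))) (at r)"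
    by (rule has_derivative_mult_right)
  then show ?thesis
    by (simp add: GDERIV_has_derivative quot_def[abs_def] quot_grad_def inner_diff_right)
qed

text \<open>The quotient is itself a value of the mean force component, at a point less than
  \<epsilon> away. Hence it inherits the bound \<open>C\<close> independently of \<epsilon>, and it
  differs from the component at r by at most the oscillation of \<open>grad V\<close>.\<close>

lemma quot_mvt:
  assumes "0 \<le> t" "0 < \<epsilon>"
  obtains \<theta> where "0 < \<theta>" "\<theta> < \<epsilon>" "quot e \<epsilon> t r = mean_gradV t (r + \<theta> *\<^sub>R e) \<bullet> e"
proof -
  obtain \<xi> where "0 < \<xi>" "\<xi> < 1"
    "mean_V t (r + \<epsilon> *\<^sub>R e) - mean_V t r = (\<epsilon> *\<^sub>R e) \<bullet> mean_gradV t (r + \<xi> *\<^sub>R \<epsilon> *\<^sub>R e)"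
    using GDERIV_mvt[OF mean_V_GDERIV[OF assms(1)]] by blast
  then show ?thesis
    using assms by (intro that[of "\<xi> * \<epsilon>"]) (auto simp: quot_def inner_commute)
qed

context
  fixes e :: 'a and \<epsilon> :: real
  assumes e: "norm e = 1" and \<epsilon>: "0 < \<epsilon>"
begin

lemma quot_bound: "0 \<le> t \<Longrightarrow> \<bar>quot e \<epsilon> t r\<bar> \<le> C"
  by (rule quot_mvt[of t \<epsilon> e r])
    (use \<epsilon> in \<open>auto intro: order_trans[OF abs_inner_unit_le[OF e] mean_gradV_bound]\<close>)

lemma quot_grad_bound: "0 \<le> t \<Longrightarrow> norm (quot_grad e \<epsilon> t r) \<le> 2 * C / \<epsilon>"
  using norm_triangle_ineq4[of "mean_gradV t (r + \<epsilon> *\<^sub>R e)" "mean_gradV t r"]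
    mean_gradV_bound[of t r] mean_gradV_bound[of t "r + \<epsilon> *\<^sub>R e"] \<epsilon>
  by (simp add: quot_grad_def divide_right_mono)

lemma quot_close:
  assumes "\<And>x \<theta>. 0 < \<theta> \<Longrightarrow> \<theta> < \<epsilon> \<Longrightarrow> norm (grad V (x + \<theta> *\<^sub>R e) - grad V x) \<le> \<omega>" "0 \<le> t"
  shows "\<bar>quot e \<epsilon> t r - mean_gradV t r \<bullet> e\<bar> \<le> \<omega>"
proof -
  obtain \<theta> where \<theta>: "0 < \<theta>" "\<theta> < \<epsilon>" "quot e \<epsilon> t r = mean_gradV t (r + \<theta> *\<^sub>R e) \<bullet> e"
    using quot_mvt[OF assms(2) \<epsilon>] by blast
  have "norm (\<integral>z. grad V (r + \<theta> *\<^sub>R e - fst z) - grad V (r - fst z) \<partial>f t) \<le> \<omega>"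
  proof (rule norm_integral_le_const[OF assms(2)])
    show "norm (grad V (r + \<theta> *\<^sub>R e - fst z) - grad V (r - fst z)) \<le> \<omega>" for z :: "'a \<times> 'a"
      using assms(1)[OF \<theta>(1,2), of "r - fst z"] by (simp add: algebra_simps)
  qed (intro continuous_intros)
  also have "(\<integral>z. grad V (r + \<theta> *\<^sub>R e - fst z) - grad V (r - fst z) \<partial>f t)
      = mean_gradV t (r + \<theta> *\<^sub>R e) - mean_gradV t r"
    unfolding mean_gradV_def
    by (intro Bochner_Integration.integral_diff integrable_continuous assms(2)) (intro continuous_intros)+
  finally show ?thesis
    using abs_inner_unit_le[OF e, of "mean_gradV t (r + \<theta> *\<^sub>R e) - mean_gradV t r"]
    by (simp add: \<theta>(3) inner_diff_left)
qed

text \<open>At a fixed position, \<open>mean_V\<close> changes only because the particles move, at a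
  rate of at most \<open>C\<close> times their mean speed. The quotient contains two such terms
  divided by \<epsilon>, and the time window has length at most 1.\<close>

lemma quot_time_change:
  assumes t: "0 \<le> t" "t \<le> s" "s \<le> t + 1" and \<sigma>: "\<And>\<xi>. t \<le> \<xi> \<Longrightarrow> speed \<xi> \<le> \<sigma>"
  shows "\<bar>quot e \<epsilon> s r - quot e \<epsilon> t r\<bar> \<le> 2 * C / \<epsilon> * \<sigma>"
proof (cases "s = t")
  case True
  have "0 \<le> \<sigma>" using \<sigma>[of t] speed_nonneg[of t] by linarith
  with True show ?thesis using C_nonneg \<epsilon> by simp
next
  case False
  with t have "t < s" by simp
  define D where "D t = ((\<integral>z. - ((snd z - v_mean) \<bullet> grad V (r + \<epsilon> *\<^sub>R e - fst z)) \<partial>f t)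
      - (\<integral>z. - ((snd z - v_mean) \<bullet> grad V (r - fst z)) \<partial>f t)) / \<epsilon>" for t
  have "((\<lambda>t. quot e \<epsilon> t r) has_real_derivative D t) (at t within {0..})" if "0 \<le> t" for t
    unfolding quot_def[abs_def] D_def
    by (intro DERIV_cdivide DERIV_diff mean_V_time_derivative that)
  from mvt_half_line[OF this t(1) \<open>t < s\<close>] obtain \<xi> where
    \<xi>: "t < \<xi>" "\<xi> < s" "quot e \<epsilon> s r - quot e \<epsilon> t r = (s - t) * D \<xi>" by blast
  have \<xi>0: "0 \<le> \<xi>" using \<xi> t by simp
  have "norm (\<integral>z. (snd z - v_mean) \<bullet> grad V (r + x - fst z) \<partial>f \<xi>) \<le> (\<integral>z. C * norm (snd z - v_mean) \<partial>f \<xi>)" for x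
  proof (rule norm_integral_le[OF \<xi>0])
    fix z :: "'a \<times> 'a"
    have "\<bar>(snd z - v_mean) \<bullet> grad V (r + x - fst z)\<bar> \<le> norm (snd z - v_mean) * norm (grad V (r + x - fst z))"
      by (rule Cauchy_Schwarz_ineq2)
    also have "\<dots> \<le> norm (snd z - v_mean) * C"
      by (intro mult_left_mono gradV_bound) simp
    finally show "norm ((snd z - v_mean) \<bullet> grad V (r + x - fst z)) \<le> C * norm (snd z - v_mean)"
      by (simp add: mult.commute)
  qed (intro continuous_intros)+
  from this[of "\<epsilon> *\<^sub>R e"] this[of 0]
  have "\<bar>D \<xi>\<bar> \<le> 2 * C * speed \<xi> / \<epsilon>"
    using \<epsilon> by (simp add: D_def speed_def[symmetric] divide_right_mono)
  also have "\<dots> \<le> 2 * C * \<sigma> / \<epsilon>"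
    using \<sigma>[of \<xi>] \<xi> \<epsilon> C_nonneg by (intro divide_right_mono mult_left_mono) auto
  finally have "\<bar>D \<xi>\<bar> \<le> 2 * C / \<epsilon> * \<sigma>" by simp
  moreover have "\<bar>(s - t) * D \<xi>\<bar> \<le> \<bar>D \<xi>\<bar>"
    using t unfolding abs_mult by (intro mult_left_le_one_le) auto
  ultimately show ?thesis using \<xi>(3) by simp
qed

end

end

section \<open>Decay of the mean force\<close>

context dissipative_mean_field
begin

lemma friction_force_bound:
  assumes t: "0 \<le> t"
  shows "norm (\<integral>z'. \<psi> (norm (fst z - fst z')) *\<^sub>R (snd z - snd z') \<partial>f t)
    \<le> \<psi>_up * (norm (snd z - v_mean) + speed t)"
proof -
  interpret prob_space "f t" by (rule prob_space[OF t])
  have "norm (\<integral>z'. \<psi> (norm (fst z - fst z')) *\<^sub>R (snd z - snd z') \<partial>f t)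
      \<le> (\<integral>z'. \<psi>_up * (norm (snd z - v_mean) + norm (snd z' - v_mean)) \<partial>f t)"
  proof (rule norm_integral_le[OF t])
    fix z' :: "'a \<times> 'a"
    have "norm (snd z - snd z') \<le> norm (snd z - v_mean) + norm (snd z' - v_mean)"
      using norm_triangle_ineq4[of "snd z - v_mean" "snd z' - v_mean"] by simp
    moreover have "0 \<le> \<psi> (norm (fst z - fst z'))"
      using \<psi>_low[of "norm (fst z - fst z')"] \<psi>_low_pos by simp
    ultimately show "norm (\<psi> (norm (fst z - fst z')) *\<^sub>R (snd z - snd z'))
        \<le> \<psi>_up * (norm (snd z - v_mean) + norm (snd z' - v_mean))"
      by (auto intro!: mult_mono \<psi>_up \<psi>_up_nonneg)
  qed (auto intro!: continuous_intros)
  also have "\<dots> = \<psi>_up * (norm (snd z - v_mean) + speed t)"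
    unfolding integral_mult_right_zero speed_def
    by (subst Bochner_Integration.integral_add)
      (auto intro!: integrable_continuous t continuous_intros simp: prob_space)
  finally show ?thesis .
qed

section \<open>The functional with force frozen at time t\<close>

context
  fixes e :: 'a and \<epsilon> \<omega> \<sigma> t :: real
  assumes e: "norm e = 1" and \<epsilon>: "0 < \<epsilon>"
    and modulus: "\<And>x \<theta>. 0 < \<theta> \<Longrightarrow> \<theta> < \<epsilon> \<Longrightarrow> norm (grad V (x + \<theta> *\<^sub>R e) - grad V x) \<le> \<omega>"
    and t: "0 \<le> t"
    and speed_le: "\<And>\<xi>. t \<le> \<xi> \<Longrightarrow> speed \<xi> \<le> \<sigma>" and kinetic_le: "\<And>\<xi>. t \<le> \<xi> \<Longrightarrow> kinetic \<xi> \<le> \<sigma>"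
begin

abbreviation (input) "y \<equiv> quot e \<epsilon> t"
abbreviation (input) "Dy \<equiv> quot_grad e \<epsilon> t"
abbreviation (input) "L \<equiv> 2 * C / \<epsilon>"

lemma L_nonneg: "0 \<le> L"
  using C_nonneg \<epsilon> by simp

text \<open>The mean value theorem in \<open>mean_gradV_component_bound\<close> yields the integral
  of y^2 at some later time of the window, which has to be brought back to t. Its time derivative is
  the integral of 2 y (w \<bullet> Dy), with w = v - \<open>v_mean\<close>, and is at most 2 C L
  times the mean speed.\<close>

lemma quot_square_time_change:
  assumes "t < s" "s \<le> t + 1"
  shows "(\<integral>z. (y (fst z))\<^sup>2 \<partial>f t) - 2 * C * L * \<sigma> \<le> (\<integral>z. (y (fst z))\<^sup>2 \<partial>f s)"
proof -
  define D where "D s = (\<integral>z. 2 * y (fst z) * ((snd z - v_mean) \<bullet> Dy (fst z)) \<partial>f s)" for s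
  have "GDERIV (\<lambda>z. (y (fst z))\<^sup>2) z :> ((2 * y (fst z)) *\<^sub>R Dy (fst z), 0 :: 'a)" for z :: "'a \<times> 'a"
  proof -
    have "((\<lambda>z. y (fst z)) has_derivative (\<lambda>h. fst h \<bullet> Dy (fst z))) (at z)"
      by (rule has_derivative_compose[OF has_derivative_fst[OF has_derivative_ident]
            quot_GDERIV[OF t, unfolded GDERIV_has_derivative]])
    then show ?thesis
      unfolding GDERIV_has_derivative by (auto intro!: derivative_eq_intros simp: inner_prod_def)
  qed
  then have "((\<lambda>s. \<integral>z. (y (fst z))\<^sup>2 \<partial>f s) has_real_derivative
      (\<integral>z. drift s z \<bullet> ((2 * y (fst z)) *\<^sub>R Dy (fst z), 0) \<partial>f s)) (at s within {0..})" if "0 \<le> s" for s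
    by (rule observable_derivative) (auto intro!: continuous_intros t that)
  then have "((\<lambda>s. \<integral>z. (y (fst z))\<^sup>2 \<partial>f s) has_real_derivative D s) (at s within {0..})" if "0 \<le> s" for s
    using that by (simp add: D_def drift_def inner_prod_def)
  from mvt_half_line[OF this t assms(1)] obtain \<xi> where
    \<xi>: "t < \<xi>" "\<xi> < s" "(\<integral>z. (y (fst z))\<^sup>2 \<partial>f s) - (\<integral>z. (y (fst z))\<^sup>2 \<partial>f t) = (s - t) * D \<xi>"
    by blast
  have "norm (D \<xi>) \<le> (\<integral>z. 2 * C * L * norm (snd z - v_mean) \<partial>f \<xi>)"
    unfolding D_def
  proof (rule norm_integral_le)
    fix z :: "'a \<times> 'a"
    have "\<bar>(snd z - v_mean) \<bullet> Dy (fst z)\<bar> \<le> norm (snd z - v_mean) * norm (Dy (fst z))"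
      by (rule Cauchy_Schwarz_ineq2)
    also have "\<dots> \<le> norm (snd z - v_mean) * L"
      by (intro mult_left_mono quot_grad_bound e \<epsilon> t) simp
    finally have "\<bar>2 * y (fst z)\<bar> * \<bar>(snd z - v_mean) \<bullet> Dy (fst z)\<bar> \<le> (2 * C) * (norm (snd z - v_mean) * L)"
      using quot_bound[OF e \<epsilon> t, of "fst z"] C_nonneg by (intro mult_mono) auto
    then show "norm (2 * y (fst z) * ((snd z - v_mean) \<bullet> Dy (fst z))) \<le> 2 * C * L * norm (snd z - v_mean)"
      by (simp add: abs_mult mult_ac)
  qed (use \<xi> t \<epsilon> in \<open>auto intro!: continuous_intros\<close>)
  also have "\<dots> \<le> 2 * C * L * \<sigma>"
    using speed_le[of \<xi>] \<xi> L_nonneg C_nonneg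
    by (simp only: integral_mult_right_zero speed_def[symmetric]) (intro mult_left_mono mult_nonneg_nonneg, auto)
  finally have "\<bar>D \<xi>\<bar> \<le> 2 * C * L * \<sigma>" by simp
  moreover have "\<bar>(s - t) * D \<xi>\<bar> \<le> \<bar>D \<xi>\<bar>"
    using assms unfolding abs_mult by (intro mult_left_le_one_le) auto
  ultimately show ?thesis using \<xi>(3) by linarith
qed

text \<open>Factor the difference of squares: the sum of the two terms is at most 2 C and their
  difference at most \<omega>.\<close>

lemma mean_gradV_square_quot:
  "(\<integral>z. (mean_gradV t (fst z) \<bullet> e)\<^sup>2 \<partial>f t) \<le> (\<integral>z. (y (fst z))\<^sup>2 \<partial>f t) + 2 * C * \<omega>"
proof -
  interpret prob_space "f t" by (rule prob_space[OF t])
  have "(\<integral>z. (mean_gradV t (fst z) \<bullet> e)\<^sup>2 \<partial>f t) \<le> (\<integral>z. (y (fst z))\<^sup>2 + 2 * C * \<omega> \<partial>f t)"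
  proof (intro integral_mono integrable_continuous t)
    fix z :: "'a \<times> 'a"
    let ?x = "mean_gradV t (fst z) \<bullet> e" and ?y = "y (fst z)"
    have "\<bar>?x + ?y\<bar> \<le> C + C"
      using order_trans[OF abs_inner_unit_le[OF e] mean_gradV_bound[OF t, of "fst z"]]
        quot_bound[OF e \<epsilon> t, of "fst z"] by linarith
    moreover have "\<bar>?x - ?y\<bar> \<le> \<omega>"
      using quot_close[OF e \<epsilon> modulus t, of "fst z"] by (simp add: abs_minus_commute)
    ultimately have "\<bar>?x + ?y\<bar> * \<bar>?x - ?y\<bar> \<le> (C + C) * \<omega>"
      using C_nonneg by (intro mult_mono) auto
    moreover have "?x\<^sup>2 - ?y\<^sup>2 \<le> \<bar>?x + ?y\<bar> * \<bar>?x - ?y\<bar>"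
      unfolding abs_mult[symmetric] by (simp add: power2_eq_square algebra_simps)
    ultimately show "?x\<^sup>2 \<le> ?y\<^sup>2 + 2 * C * \<omega>" by simp
  qed (use t in \<open>auto intro!: continuous_intros\<close>)
  also have "\<dots> = (\<integral>z. (y (fst z))\<^sup>2 \<partial>f t) + 2 * C * \<omega>"
    using t by (subst Bochner_Integration.integral_add)
      (auto intro!: integrable_continuous continuous_intros simp: prob_space)
  finally show ?thesis .
qed

text \<open>The mean value theorem is applied on [t, t + 1] to the integral B of (w \<bullet> e) y,
  with w = v - \<open>v_mean\<close>. Origin of the constants: 2 C \<sigma> from B at the two ends;
  L \<sigma> from transport of y, by the kinetic energy; 2 \<open>\<psi>_up\<close> C \<sigma> from
  friction, half from the particle itself and half from the others; C \<omega> from replacing the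
  mean force at the intermediate time \<xi> by its quotient; C L \<sigma> from moving that quotient
  back to time t; 2 C L \<sigma> from moving the integral of y^2 back to t; and 2 C \<omega> from
  returning to the mean force at t.\<close>

lemma mean_gradV_component_bound:
  "(\<integral>z. (mean_gradV t (fst z) \<bullet> e)\<^sup>2 \<partial>f t)
    \<le> 3 * C * \<omega> + (2 * C + L + 2 * \<psi>_up * C + 3 * C * L) * \<sigma>"
proof -
  let ?w = "\<lambda>z. snd z - v_mean"
  define B where "B s = (\<integral>z. (?w z \<bullet> e) * y (fst z) \<partial>f s)" for s
  define b where "b s z = (?w z \<bullet> e) * (?w z \<bullet> Dy (fst z)) - y (fst z) * (force s z \<bullet> e)" for s z
  have "GDERIV (\<lambda>z. (?w z \<bullet> e) * y (fst z)) z :> ((?w z \<bullet> e) *\<^sub>R Dy (fst z), y (fst z) *\<^sub>R e)" for z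
  proof -
    have "((\<lambda>z. y (fst z)) has_derivative (\<lambda>h. fst h \<bullet> Dy (fst z))) (at z)"
      by (rule has_derivative_compose[OF has_derivative_fst[OF has_derivative_ident]
            quot_GDERIV[OF t, unfolded GDERIV_has_derivative]])
    then show ?thesis
      unfolding GDERIV_has_derivative
      by (auto intro!: derivative_eq_intros simp: inner_prod_def algebra_simps)
  qed
  then have "(B has_real_derivative
      (\<integral>z. drift s z \<bullet> ((?w z \<bullet> e) *\<^sub>R Dy (fst z), y (fst z) *\<^sub>R e) \<partial>f s)) (at s within {0..})" if "0 \<le> s" for s
    unfolding B_def by (rule observable_derivative) (auto intro!: continuous_intros t that)
  then have B': "(B has_real_derivative (\<integral>z. b s z \<partial>f s)) (at s within {0..})" if "0 \<le> s" for s
    using that by (simp add: b_def drift_def inner_prod_def)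
  obtain \<xi> where \<xi>: "t < \<xi>" "\<xi> < t + 1" "B (t + 1) - B t = (\<integral>z. b \<xi> z \<partial>f \<xi>)"
    using mvt_half_line[OF B' t, of "t + 1"] by auto
  have \<xi>0: "0 \<le> \<xi>" using \<xi> t by simp
  interpret prob_space "f \<xi>" by (rule prob_space[OF \<xi>0])
  have B_bound: "\<bar>B s\<bar> \<le> C * \<sigma>" if "t \<le> s" for s
  proof -
    have "norm (B s) \<le> (\<integral>z. C * norm (?w z) \<partial>f s)"
      unfolding B_def
    proof (rule norm_integral_le)
      fix z :: "'a \<times> 'a"
      have "\<bar>?w z \<bullet> e\<bar> * \<bar>y (fst z)\<bar> \<le> norm (?w z) * C"
        using quot_bound[OF e \<epsilon> t, of "fst z"] abs_inner_unit_le[OF e] by (intro mult_mono) auto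
      then show "norm (?w z \<bullet> e * y (fst z)) \<le> C * norm (?w z)"
        by (simp add: abs_mult mult.commute)
    qed (use t that in \<open>auto intro!: continuous_intros\<close>)
    also have "\<dots> \<le> C * \<sigma>"
      using speed_le[OF that] C_nonneg by (simp add: speed_def mult_left_mono)
    finally show ?thesis by simp
  qed
  have "b \<xi> z \<le> L * (norm (?w z))\<^sup>2 + C * \<psi>_up * norm (?w z)
      + (C * \<psi>_up * speed \<xi> + C * \<omega> + C * L * \<sigma>) - (y (fst z))\<^sup>2" for z
  proof -
    let ?Y = "y (fst z)" and ?Y' = "quot e \<epsilon> \<xi> (fst z)" and ?X = "mean_gradV \<xi> (fst z) \<bullet> e"
    let ?F = "\<integral>z'. \<psi> (norm (fst z - fst z')) *\<^sub>R (snd z - snd z') \<partial>f \<xi>"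
    note Y = quot_bound[OF e \<epsilon> t, of "fst z"]
    have "\<bar>?w z \<bullet> Dy (fst z)\<bar> \<le> norm (?w z) * norm (Dy (fst z))"
      by (rule Cauchy_Schwarz_ineq2)
    also have "\<dots> \<le> norm (?w z) * L"
      by (intro mult_left_mono quot_grad_bound e \<epsilon> t) simp
    finally have "\<bar>?w z \<bullet> e\<bar> * \<bar>?w z \<bullet> Dy (fst z)\<bar> \<le> norm (?w z) * (norm (?w z) * L)"
      using abs_inner_unit_le[OF e] by (intro mult_mono) auto
    then have 1: "(?w z \<bullet> e) * (?w z \<bullet> Dy (fst z)) \<le> L * (norm (?w z))\<^sup>2"
      unfolding abs_mult[symmetric] by (simp add: power2_eq_square mult_ac)
    have "\<bar>?Y\<bar> * \<bar>?F \<bullet> e\<bar> \<le> C * (\<psi>_up * (norm (?w z) + speed \<xi>))"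
      using Y order_trans[OF abs_inner_unit_le[OF e] friction_force_bound[OF \<xi>0, of z]] by (intro mult_mono) auto
    then have 2: "- (?Y * (?F \<bullet> e)) \<le> C * \<psi>_up * norm (?w z) + C * \<psi>_up * speed \<xi>"
      unfolding abs_mult[symmetric] by (simp add: algebra_simps)
    have "\<bar>?Y\<bar> * \<bar>?X - ?Y'\<bar> \<le> C * \<omega>"
      using Y quot_close[OF e \<epsilon> modulus \<xi>0, of "fst z"] C_nonneg
      by (intro mult_mono) (auto simp: abs_minus_commute)
    then have 3: "- (?Y * (?X - ?Y')) \<le> C * \<omega>"
      unfolding abs_mult[symmetric] by simp
    have "\<bar>?Y\<bar> * \<bar>?Y' - ?Y\<bar> \<le> C * (L * \<sigma>)"
      using Y quot_time_change[OF e \<epsilon> t _ _ speed_le, of \<xi> "fst z"] \<xi> C_nonneg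
      by (intro mult_mono) auto
    then have 4: "- (?Y * (?Y' - ?Y)) \<le> C * L * \<sigma>"
      unfolding abs_mult[symmetric] by simp
    \<comment> \<open>The force at time \<xi> is friction plus mean force, and the latter is
      telescoped as X = (X - Y') + (Y' - Y) + Y; the last summand produces the leading term
      -Y^2.\<close>
    have "b \<xi> z = (?w z \<bullet> e) * (?w z \<bullet> Dy (fst z)) - (?Y * (?F \<bullet> e)) - (?Y * (?X - ?Y')) - (?Y * (?Y' - ?Y)) - ?Y\<^sup>2"
      by (simp add: b_def force_eq[OF \<xi>0] inner_left_distrib algebra_simps power2_eq_square)
    with 1 2 3 4 show ?thesis by linarith
  qed
  moreover have i: "integrable (f \<xi>) (\<lambda>z. (norm (?w z))\<^sup>2)" "integrable (f \<xi>) (\<lambda>z. norm (?w z))"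
    "integrable (f \<xi>) (\<lambda>z. (y (fst z))\<^sup>2)" "integrable (f \<xi>) (b \<xi>)"
    using t unfolding b_def
    by (auto intro!: integrable_continuous \<xi>0 continuous_intros force_continuous_snd)
  ultimately have "(\<integral>z. b \<xi> z \<partial>f \<xi>) \<le> (\<integral>z. L * (norm (?w z))\<^sup>2 + C * \<psi>_up * norm (?w z)
      + (C * \<psi>_up * speed \<xi> + C * \<omega> + C * L * \<sigma>) - (y (fst z))\<^sup>2 \<partial>f \<xi>)"
    by (intro integral_mono) auto
  also have "\<dots> = L * kinetic \<xi> + C * \<psi>_up * speed \<xi> + (C * \<psi>_up * speed \<xi> + C * \<omega> + C * L * \<sigma>)
      - (\<integral>z. (y (fst z))\<^sup>2 \<partial>f \<xi>)"
    by (simp add: i kinetic_def speed_def prob_space)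
  also have "\<dots> \<le> L * \<sigma> + C * \<psi>_up * \<sigma> + (C * \<psi>_up * \<sigma> + C * \<omega> + C * L * \<sigma>)
      - ((\<integral>z. (y (fst z))\<^sup>2 \<partial>f t) - 2 * C * L * \<sigma>)"
    using kinetic_le[of \<xi>] speed_le[of \<xi>] \<xi> L_nonneg C_nonneg \<psi>_up_nonneg quot_square_time_change[of \<xi>]
    by (intro diff_mono add_mono mult_left_mono mult_nonneg_nonneg order_refl) auto
  finally have "- (2 * C * \<sigma>) \<le> L * \<sigma> + C * \<psi>_up * \<sigma> + (C * \<psi>_up * \<sigma> + C * \<omega> + C * L * \<sigma>)
      - ((\<integral>z. (y (fst z))\<^sup>2 \<partial>f t) - 2 * C * L * \<sigma>)"
    using \<xi>(3) B_bound[of t] B_bound[of "t + 1"] by simp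
  then show ?thesis
    using mean_gradV_square_quot by (simp add: algebra_simps)
qed

end

text \<open>The order of choices matters: \<omega> from the target accuracy, then \<epsilon> from
  uniform continuity, valid for all times, then the constant \<open>D\<close>, which grows like 1 /
  \<epsilon>, and only then \<sigma> and the time after which speed and kinetic energy stay below
  it.\<close>

lemma mean_gradV_component_tendsto_0:
  assumes uc: "uniformly_continuous_on UNIV (grad V)" and e: "norm e = 1"
  shows "((\<lambda>t. \<integral>z. (mean_gradV t (fst z) \<bullet> e)\<^sup>2 \<partial>f t) \<longlongrightarrow> 0) at_top"
proof (rule tendstoI)
  fix \<delta> :: real assume \<delta>: "\<delta> > 0"
  \<comment> \<open>The summand 1, here and in \<open>\<sigma>\<close>, covers vanishing constants
    and makes the bounds by half of \<delta> strict.\<close>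
  define \<omega> where "\<omega> = \<delta> / (2 * (3 * C + 1))"
  have \<omega>: "\<omega> > 0" "3 * C * \<omega> < \<delta> / 2"
    using \<delta> C_nonneg by (auto simp: \<omega>_def field_simps)
  obtain \<epsilon> where \<epsilon>: "\<epsilon> > 0" "\<And>x x'. dist x' x < \<epsilon> \<Longrightarrow> dist (grad V x') (grad V x) < \<omega>"
    using uc[unfolded uniformly_continuous_on_def, rule_format, OF \<omega>(1)] by auto
  define D where "D = 2 * C + 2 * C / \<epsilon> + 2 * \<psi>_up * C + 3 * C * (2 * C / \<epsilon>)"
  have D: "0 \<le> D" using C_nonneg \<psi>_up_nonneg \<epsilon> by (simp add: D_def)
  define \<sigma> where "\<sigma> = \<delta> / (2 * (D + 1))"
  have \<sigma>: "\<sigma> > 0" "D * \<sigma> < \<delta> / 2"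
    using \<delta> D by (auto simp: \<sigma>_def field_simps)
  have "\<forall>\<^sub>F t in at_top. speed t < \<sigma> \<and> kinetic t < \<sigma>"
    by (rule eventually_conj[OF order_tendstoD(2)[OF speed_tendsto_0 \<sigma>(1)]
          order_tendstoD(2)[OF kinetic_tendsto_0 \<sigma>(1)]])
  then obtain T where T: "\<And>t. T \<le> t \<Longrightarrow> speed t < \<sigma> \<and> kinetic t < \<sigma>"
    unfolding eventually_at_top_linorder by blast
  have "dist (\<integral>z. (mean_gradV t (fst z) \<bullet> e)\<^sup>2 \<partial>f t) 0 < \<delta>" if t: "max 0 T \<le> t" for t
  proof -
    have "(\<integral>z. (mean_gradV t (fst z) \<bullet> e)\<^sup>2 \<partial>f t) \<le> 3 * C * \<omega> + D * \<sigma>"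
      unfolding D_def
    proof (rule mean_gradV_component_bound[OF e \<epsilon>(1)])
      show "norm (grad V (x + \<theta> *\<^sub>R e) - grad V x) \<le> \<omega>" if "0 < \<theta>" "\<theta> < \<epsilon>" for x \<theta>
        using \<epsilon>(2)[of "x + \<theta> *\<^sub>R e" x] that e by (simp add: dist_norm)
      show "speed \<xi> \<le> \<sigma>" "kinetic \<xi> \<le> \<sigma>" if "t \<le> \<xi>" for \<xi>
        using T[of \<xi>] t that by auto
    qed (use t in simp)
    moreover have "0 \<le> (\<integral>z. (mean_gradV t (fst z) \<bullet> e)\<^sup>2 \<partial>f t)" by simp
    ultimately show ?thesis using \<omega>(2) \<sigma>(2) by simp
  qed
  then show "\<forall>\<^sub>F t in at_top. dist (\<integral>z. (mean_gradV t (fst z) \<bullet> e)\<^sup>2 \<partial>f t) 0 < \<delta>"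
    unfolding eventually_at_top_linorder by blast
qed

lemma mean_gradV_tendsto_0:
  assumes "uniformly_continuous_on UNIV (grad V)"
  shows "((\<lambda>t. \<integral>z. (norm (mean_gradV t (fst z)))\<^sup>2 \<partial>f t) \<longlongrightarrow> 0) at_top"
proof (rule Lim_transform_eventually)
  show "((\<lambda>t. \<Sum>e\<in>Basis. \<integral>z. (mean_gradV t (fst z) \<bullet> e)\<^sup>2 \<partial>f t) \<longlongrightarrow> 0) at_top"
    by (rule tendsto_null_sum) (rule mean_gradV_component_tendsto_0[OF assms norm_Basis])
  show "\<forall>\<^sub>F t in at_top. (\<Sum>e\<in>Basis. \<integral>z. (mean_gradV t (fst z) \<bullet> e)\<^sup>2 \<partial>f t)
      = (\<integral>z. (norm (mean_gradV t (fst z)))\<^sup>2 \<partial>f t)"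
    using eventually_ge_at_top[of 0]
  proof eventually_elim
    case (elim t)
    have "(norm x)\<^sup>2 = (\<Sum>e\<in>Basis. (x \<bullet> e)\<^sup>2)" for x :: 'a
      unfolding power2_norm_eq_inner by (subst euclidean_inner) (simp add: power2_eq_square)
    then have "(\<integral>z. (norm (mean_gradV t (fst z)))\<^sup>2 \<partial>f t)
        = (\<integral>z. (\<Sum>e\<in>Basis. (mean_gradV t (fst z) \<bullet> e)\<^sup>2) \<partial>f t)" by simp
    also have "\<dots> = (\<Sum>e\<in>Basis. \<integral>z. (mean_gradV t (fst z) \<bullet> e)\<^sup>2 \<partial>f t)"
      using elim by (intro Bochner_Integration.integral_sum integrable_continuous continuous_intros) auto
    finally show ?case by simp
  qed
qed

end

theorem theorem1p3:
  fixes V :: "real ^ 'n \<Rightarrow> real"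
    and \<psi> :: "real \<Rightarrow> real"
    and \<psi>_low :: real
    and f0 :: "((real ^ 'n) \<times> (real ^ 'n)) measure"
    and f :: "real \<Rightarrow> ((real ^ 'n) \<times> (real ^ 'n)) measure"
  assumes V_C1: "C_k 1 V"
    and V_bdd_below: "bdd_below (range V)"
    and gradV_antisym: "\<And>x. grad V (- x) = - grad V x"
    and gradV_lipschitz: "locally_lipschitz_on UNIV (grad V)"
    and gradV_bounded: "bounded (range (grad V))"
    and \<psi>_nonneg: "\<And>x. 0 \<le> x \<Longrightarrow> 0 \<le> \<psi> x"
    and \<psi>_continuous: "continuous_on {0..} \<psi>"
    and \<psi>_bounded: "bounded (\<psi> ` {0..})"
    and \<psi>_lipschitz: "locally_lipschitz_on {0..} \<psi>"
    and \<psi>_low_pos: "0 < \<psi>_low"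
    and \<psi>_lower_bound: "\<And>x. 0 \<le> x \<Longrightarrow> \<psi>_low \<le> \<psi> x"
    and f0_prob: "f0 \<in> prob_compact"
    and f0_centered: "mean_position f0 = 0"
    and f_solution: "mean_field_solution V \<psi> f0 f"
  shows "((\<lambda>t. \<integral>(r, v). (norm (v - mean_velocity f0))\<^sup>2 \<partial>f t) \<longlongrightarrow> 0) at_top \<and>
    (uniformly_continuous_on UNIV (grad V) \<longrightarrow>
      ((\<lambda>t. \<integral>(r, v). (norm (\<integral>(r', v'). grad V (r - r') \<partial>f t))\<^sup>2 \<partial>f t) \<longlongrightarrow> 0) at_top)"
proof -
  obtain C where C: "\<And>x. norm (grad V x) \<le> C"
    using gradV_bounded unfolding bounded_iff by auto
  obtain \<psi>_up where \<psi>_up: "\<And>x. 0 \<le> x \<Longrightarrow> \<bar>\<psi> x\<bar> \<le> \<psi>_up"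
    using \<psi>_bounded unfolding bounded_iff by auto
  obtain V_low where V_low: "\<And>x. V_low \<le> V x"
    using V_bdd_below unfolding bdd_below_def by auto
  interpret dissipative_mean_field V \<psi> f0 f C \<psi>_low \<psi>_up V_low
  proof
    show "\<psi> q \<le> \<psi>_up" if "0 \<le> q" for q
      using \<psi>_up[OF that] by simp
  qed (fact V_C1 gradV_antisym \<psi>_continuous f_solution C \<psi>_low_pos \<psi>_lower_bound V_low)+
  have "(\<lambda>t. \<integral>(r, v). (norm (v - mean_velocity f0))\<^sup>2 \<partial>f t) = kinetic"
    by (simp add: fun_eq_iff kinetic_def v_mean_def case_prod_unfold)
  moreover have "(\<lambda>t. \<integral>(r, v). (norm (\<integral>(r', v'). grad V (r - r') \<partial>f t))\<^sup>2 \<partial>f t)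
      = (\<lambda>t. \<integral>z. (norm (mean_gradV t (fst z)))\<^sup>2 \<partial>f t)"
    by (simp add: mean_gradV_def case_prod_unfold)
  ultimately show ?thesis
    using kinetic_tendsto_0 mean_gradV_tendsto_0 by (simp only:) blast
qed

end
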